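(* Let $d\ge1$, $n_k\ge1$, $\alpha\in\mathbb{C}\setminus\{0,1\}$, and let $Q$ be the set of tuples $(i_0,\dots,i_d)$ of integers with $0\le i_k<n_k$ for all $k$ and $i_k=0$ for some $k$. Then for every $0\le j\le d$, the subspace $\bigoplus_{(i_0,\dots,i_d)\in Q}H^j_{\mathrm{dR}}(U_\alpha/\mathbb{C})(i_0,\dots,i_d)$ of $H^j_{\mathrm{dR}}(U_\alpha/\mathbb{C})$ is generated by exterior products of the forms $\frac{dx_i}{x_i-\nu_i}$, $\nu_i\in\mu_{n_i}$. More precisely, for $(i_0,\dots,i_d)\in Q$ put $I=\{k: i_k>0\}$, $I^c=\{0,\dots,d\}\setminus I$, $s=\#I$, and $\omega=\bigwedge_{k\in I}\frac{x_k^{i_k-1}dx_k}{x_k^{n_k}-1}\in H^s_{\mathrm{dR}}(U_\alpha/\mathbb{C})(i_0,\dots,i_d)$. For $l\in I^c$ let $p_l:U_\alpha\to T_l=\mathbb{A}^1(y_l)\setminus\{y_l=1\}$ be given by $p_l^*y_l=x_l^{n_l}$; fix $k_0\in I^c$, put $T=\prod_{l\in I^c\setminus\{k_0\}}T_l$ and $p=\prod p_l:U_\alpha\to T$. Then the map $H^{j-s}_{\mathrm{dR}}(T/\mathbb{C})\to H^j_{\mathrm{dR}}(U_\alpha/\mathbb{C})(i_0,\dots,i_d)$, $x\mapsto\omega\wedge p^*x$, is bijective. In particular $\dim H^j_{\mathrm{dR}}(U_\alpha/\mathbb{C})(i_0,\dots,i_d)=\binom{d-s}{j-s}=\binom{d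-s}{d-j}$.
   Context: $U_\alpha=\operatorname{Spec}\mathbb{C}[x_0,\dots,x_d]/((1-x_0^{n_0})\cdots(1-x_d^{n_d})-\alpha)$; $H(i_0,\dots,i_d)$ is the eigenspace on which $(\nu_0,\dots,\nu_d)\in\mu_{n_0}\times\cdots\times\mu_{n_d}$, acting via $x_k\mapsto\nu_kx_k$, acts by $\nu_0^{i_0}\cdots\nu_d^{i_d}$. *)

theory Defs
  imports Complex_Main "HOL-Library.Poly_Mapping" "HOL-Library.Function_Algebras"
begin

type_synonym mpoly = "(nat \<Rightarrow>\<^sub>0 nat) \<Rightarrow>\<^sub>0 complex"

(* a differential form: coefficient of dx_S (S a finite set of variable indices, wedge in increasing order) *)
type_synonym dform = "nat set \<Rightarrow> mpoly"

definition Var :: "nat \<Rightarrow> mpoly" where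
  "Var k = Poly_Mapping.single (Poly_Mapping.single k 1) 1"

definition Const :: "complex \<Rightarrow> mpoly" where
  "Const c = Poly_Mapping.single 0 c"

definition pderiv_mp :: "nat \<Rightarrow> mpoly \<Rightarrow> mpoly" where
  "pderiv_mp k p = Abs_poly_mapping
     (\<lambda>(m::nat \<Rightarrow>\<^sub>0 nat). of_nat (Poly_Mapping.lookup m k + 1) * Poly_Mapping.lookup p (m + Poly_Mapping.single k 1))"

definition subst_mp :: "(nat \<Rightarrow> mpoly) \<Rightarrow> mpoly \<Rightarrow> mpoly" where
  "subst_mp \<phi> p = (\<Sum>m\<in>Poly_Mapping.keys p. Const (Poly_Mapping.lookup p m) * (\<Prod>v\<in>Poly_Mapping.keys m. \<phi> v ^ Poly_Mapping.lookup m v))"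

definition poly_in :: "nat set \<Rightarrow> mpoly \<Rightarrow> bool" where
  "poly_in V p \<longleftrightarrow> (\<forall>m\<in>Poly_Mapping.keys p. Poly_Mapping.keys m \<subseteq> V)"

definition is_form :: "nat set \<Rightarrow> nat \<Rightarrow> dform \<Rightarrow> bool" where
  "is_form V j \<eta> \<longleftrightarrow> (\<forall>S. \<eta> S \<noteq> 0 \<longrightarrow> S \<subseteq> V \<and> card S = j \<and> poly_in V (\<eta> S))"

(* sign of dx_S /\ dx_T relative to dx_(S Un T) *)
definition sgn_sets :: "nat set \<Rightarrow> nat set \<Rightarrow> complex" where
  "sgn_sets S T = (-1) ^ card {(s, t). s \<in> S \<and> t \<in> T \<and> t < s}"

definition wedge :: "dform \<Rightarrow> dform \<Rightarrow> dform" where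
  "wedge \<eta> \<theta> = (\<lambda>U. if finite U then
      (\<Sum>S\<in>Pow U. Const (sgn_sets S (U - S)) * \<eta> S * \<theta> (U - S)) else 0)"

definition one_form :: dform where
  "one_form = (\<lambda>U. if U = {} then 1 else 0)"

definition pmult :: "mpoly \<Rightarrow> dform \<Rightarrow> dform" where
  "pmult p \<eta> = (\<lambda>S. p * \<eta> S)"

definition cmul :: "complex \<Rightarrow> dform \<Rightarrow> dform" where
  "cmul c \<eta> = pmult (Const c) \<eta>"

definition ext_d :: "dform \<Rightarrow> dform" where
  "ext_d \<eta> = (\<lambda>U. if finite U then
      (\<Sum>k\<in>U. Const (sgn_sets {k} (U - {k})) * pderiv_mp k (\<eta> (U - {k}))) else 0)"

definition dpoly :: "mpoly \<Rightarrow> dform" where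
  "dpoly g = (\<lambda>U. if card U = 1 then pderiv_mp (the_elem U) g else 0)"

definition wedge_list :: "dform list \<Rightarrow> dform" where
  "wedge_list ws = foldr wedge ws one_form"

(* Omega^j = (+)_S A dx_S / (G * Omega^j + dG /\ Omega^(j-1)); this is the submodule of relations *)
definition rel_forms :: "nat set \<Rightarrow> mpoly set \<Rightarrow> nat \<Rightarrow> dform set" where
  "rel_forms V G j = {\<eta>. \<exists>a b. (\<forall>g\<in>G. is_form V j (a g) \<and>
        (if j = 0 then b g = 0 else is_form V (j - 1) (b g))) \<and>
        \<eta> = (\<Sum>g\<in>G. pmult g (a g) + wedge (dpoly g) (b g))}"

definition closed_forms :: "nat set \<Rightarrow> mpoly set \<Rightarrow> nat \<Rightarrow> dform set" where
  "closed_forms V G j = {\<eta>. is_form V j \<eta> \<and> ext_d \<eta> \<in> rel_forms V G (Suc j)}"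

definition exact_forms :: "nat set \<Rightarrow> mpoly set \<Rightarrow> nat \<Rightarrow> dform set" where
  "exact_forms V G j = {\<eta>. is_form V j \<eta> \<and> (\<exists>\<theta>.
        (if j = 0 then \<theta> = 0 else is_form V (j - 1) \<theta>) \<and> \<eta> - ext_d \<theta> \<in> rel_forms V G j)}"

(* H^j = closed / exact; "dim (A/B) = m" for sets of representatives A and B *)
definition quot_dim :: "dform set \<Rightarrow> dform set \<Rightarrow> nat \<Rightarrow> bool" where
  "quot_dim A B m \<longleftrightarrow> (\<exists>e. (\<forall>i<m. e i \<in> A) \<and>
      (\<forall>c. (\<Sum>i<m. cmul (c i) (e i)) \<in> B \<longrightarrow> (\<forall>i<m. c i = 0)) \<and>
      (\<forall>v\<in>A. \<exists>c. v - (\<Sum>i<m. cmul (c i) (e i)) \<in> B))"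

definition pullback :: "nat set \<Rightarrow> (nat \<Rightarrow> mpoly) \<Rightarrow> dform \<Rightarrow> dform" where
  "pullback W \<phi> \<eta> = (\<Sum>S\<in>Pow W. pmult (subst_mp \<phi> (\<eta> S))
       (wedge_list (map (\<lambda>v. dpoly (\<phi> v)) (sorted_list_of_set S))))"

definition mu :: "nat \<Rightarrow> complex set" where
  "mu m = {z. z ^ m = 1}"

definition Uvars :: "nat \<Rightarrow> nat set" where
  "Uvars d = {..d}"

definition Ueq :: "nat \<Rightarrow> (nat \<Rightarrow> nat) \<Rightarrow> complex \<Rightarrow> mpoly" where
  "Ueq d n \<alpha> = (\<Prod>k\<le>d. 1 - Var k ^ n k) - Const \<alpha>"

definition HU_closed where "HU_closed d n \<alpha> j = closed_forms (Uvars d) {Ueq d n \<alpha>} j"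
definition HU_exact where "HU_exact d n \<alpha> j = exact_forms (Uvars d) {Ueq d n \<alpha>} j"

(* representative of the inverse of x_k^(n_k) - 1 in the coordinate ring of U_alpha *)
definition uinv :: "nat \<Rightarrow> (nat \<Rightarrow> nat) \<Rightarrow> complex \<Rightarrow> nat \<Rightarrow> mpoly" where
  "uinv d n \<alpha> k = - (\<Prod>l\<in>{..d} - {k}. 1 - Var l ^ n l) * Const (1 / \<alpha>)"

definition act_poly :: "(nat \<Rightarrow> complex) \<Rightarrow> mpoly \<Rightarrow> mpoly" where
  "act_poly \<nu> p = Abs_poly_mapping (\<lambda>(m::nat \<Rightarrow>\<^sub>0 nat). (\<Prod>k\<in>Poly_Mapping.keys m. \<nu> k ^ Poly_Mapping.lookup m k) * Poly_Mapping.lookup p m)"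

definition act_form :: "(nat \<Rightarrow> complex) \<Rightarrow> dform \<Rightarrow> dform" where
  "act_form \<nu> \<eta> = (\<lambda>S. Const (\<Prod>k\<in>S. \<nu> k) * act_poly \<nu> (\<eta> S))"

definition chi :: "nat \<Rightarrow> (nat \<Rightarrow> nat) \<Rightarrow> (nat \<Rightarrow> complex) \<Rightarrow> complex" where
  "chi d i \<nu> = (\<Prod>k\<le>d. \<nu> k ^ i k)"

definition eig_closed where
  "eig_closed d n \<alpha> i j = {\<eta>\<in>HU_closed d n \<alpha> j. \<forall>\<nu>. (\<forall>k\<le>d. \<nu> k \<in> mu (n k)) \<longrightarrow>
       act_form \<nu> \<eta> - cmul (chi d i \<nu>) \<eta> \<in> HU_exact d n \<alpha> j}"

definition Qset :: "nat \<Rightarrow> (nat \<Rightarrow> nat) \<Rightarrow> (nat \<Rightarrow> nat) set" where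
  "Qset d n = {i. (\<forall>k\<le>d. i k < n k) \<and> (\<forall>k>d. i k = 0) \<and> (\<exists>k\<le>d. i k = 0)}"

definition Qpart where
  "Qpart d n \<alpha> j = {\<eta>. is_form (Uvars d) j \<eta> \<and> (\<exists>\<eta>s. (\<forall>i\<in>Qset d n. \<eta>s i \<in> eig_closed d n \<alpha> i j) \<and>
       \<eta> - (\<Sum>i\<in>Qset d n. \<eta>s i) \<in> HU_exact d n \<alpha> j)}"

(* dx_k/(x_k - nu), using 1/(x_k-nu) = (sum_{m<n_k} nu^(n_k-1-m) x_k^m)/(x_k^(n_k)-1) *)
definition dlog_form :: "nat \<Rightarrow> (nat \<Rightarrow> nat) \<Rightarrow> complex \<Rightarrow> nat \<Rightarrow> complex \<Rightarrow> dform" where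
  "dlog_form d n \<alpha> k \<nu> = (\<lambda>U. if U = {k} then
      (\<Sum>m<n k. Const (\<nu> ^ (n k - 1 - m)) * Var k ^ m) * uinv d n \<alpha> k else 0)"

definition gen_form :: "nat \<Rightarrow> (nat \<Rightarrow> nat) \<Rightarrow> complex \<Rightarrow> nat set \<Rightarrow> (nat \<Rightarrow> complex) \<Rightarrow> dform" where
  "gen_form d n \<alpha> K \<nu> = wedge_list (map (\<lambda>k. dlog_form d n \<alpha> k (\<nu> k)) (sorted_list_of_set K))"

definition Iset :: "nat \<Rightarrow> (nat \<Rightarrow> nat) \<Rightarrow> nat set" where
  "Iset d i = {k. k \<le> d \<and> 0 < i k}"

definition omega :: "nat \<Rightarrow> (nat \<Rightarrow> nat) \<Rightarrow> complex \<Rightarrow> (nat \<Rightarrow> nat) \<Rightarrow> dform" where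
  "omega d n \<alpha> i = wedge_list (map (\<lambda>k U. if U = {k} then Var k ^ (i k - 1) * uinv d n \<alpha> k else 0)
      (sorted_list_of_set (Iset d i)))"

(* T_l presented as Spec C[y_l, z_l]/(z_l (y_l - 1) - 1), y_l = variable 2l, z_l = variable 2l+1 *)
definition Lset :: "nat \<Rightarrow> (nat \<Rightarrow> nat) \<Rightarrow> nat \<Rightarrow> nat set" where
  "Lset d i k0 = ({..d} - Iset d i) - {k0}"

definition Tvars :: "nat set \<Rightarrow> nat set" where
  "Tvars L = (\<lambda>l. 2 * l) ` L \<union> (\<lambda>l. 2 * l + 1) ` L"

definition Tgens :: "nat set \<Rightarrow> mpoly set" where
  "Tgens L = (\<lambda>l. Var (2 * l + 1) * (Var (2 * l) - 1) - 1) ` L"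

(* p^* y_l = x_l^(n_l), hence p^* z_l = 1/(x_l^(n_l) - 1) *)
definition pmap :: "nat \<Rightarrow> (nat \<Rightarrow> nat) \<Rightarrow> complex \<Rightarrow> nat \<Rightarrow> mpoly" where
  "pmap d n \<alpha> v = (if even v then Var (v div 2) ^ n (v div 2) else uinv d n \<alpha> (v div 2))"

definition omega_pull where
  "omega_pull d n \<alpha> i k0 x = wedge (omega d n \<alpha> i) (pullback (Tvars (Lset d i k0)) (pmap d n \<alpha>) x)"

end

theory Submission
  imports Defs "HOL-Library.FuncSet" "HOL-Computational_Algebra.Polynomial"
begin

text \<open>Fix an eigenspace \<open>i\<close> and an index \<open>k0\<close> with \<open>i k0 = 0\<close>. On \<open>U\<^sub>\<alpha>\<close> every \<open>u\<^sub>l = x\<^sub>l\<^sup>n - 1\<close> is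
  invertible, and the equation expresses the \<open>n k0\<close>-th power of \<open>x\<^sub>k\<^sub>0\<close> and its differential through
  the other coordinates. Modulo the relations, the forms in the eigenspace are therefore spanned by
  products over \<open>l \<noteq> k0\<close> of Laurent monomials in \<open>u\<^sub>l\<close> times fixed powers of \<open>x\<^sub>l\<close> and possibly \<open>dx\<^sub>l\<close>.
  They are independent because the coordinates \<open>x\<^sub>l\<close> can be prescribed freely among large values. So
  the eigenspace is a tensor product of two-term complexes, one for each \<open>l\<close>. In each of them a change
  of basis that is triangular in the exponent of \<open>u\<^sub>l\<close> makes the differential a bijection between the
  basis elements, apart from the \<^emph>\<open>harmonic\<close> ones: \<open>x\<^sub>l\<^bsup>i-1\<^esup> dx\<^sub>l / u\<^sub>l\<close> if \<open>i l > 0\<close>, and \<open>1\<close> and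
  \<open>x\<^sub>l\<^bsup>n-1\<^esup> dx\<^sub>l / u\<^sub>l\<close> if \<open>i l = 0\<close>. A Koszul homotopy contracts everything else, hence the products of
  harmonic elements represent a basis of the cohomology.

  The torus carries the same structure with all \<open>n l = 1\<close> and \<open>i l = 0\<close>, and \<open>x \<mapsto> \<omega> \<and> p\<^sup>*x\<close> maps its basis
  forms to nonzero multiples of basis forms. A Fourier transform over \<open>\<mu>\<^sub>n\<close> turns the harmonic forms
  into products of \<open>dx\<^sub>k / (x\<^sub>k - \<nu>)\<close> and back.\<close>

section \<open>Linear algebra modulo a subspace\<close>

locale vector_space_modulo = vector_space scale
  for scale :: "'a::field \<Rightarrow> 'b::ab_group_add \<Rightarrow> 'b" (infixr "*s" 75)
begin

definition independent_modulo :: "'b set \<Rightarrow> ('i \<Rightarrow> 'b) \<Rightarrow> 'i set \<Rightarrow> bool" where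
  "independent_modulo Z b J \<longleftrightarrow>
     (\<forall>F c. finite F \<longrightarrow> F \<subseteq> J \<longrightarrow> (\<Sum>j\<in>F. c j *s b j) \<in> Z \<longrightarrow> (\<forall>j\<in>F. c j = 0))"

definition basis_modulo :: "'b set \<Rightarrow> 'b set \<Rightarrow> ('i \<Rightarrow> 'b) \<Rightarrow> 'i set \<Rightarrow> bool" where
  "basis_modulo Z V b J \<longleftrightarrow>
     independent_modulo Z b J \<and> b ` J \<subseteq> V \<and> (\<forall>v\<in>V. \<exists>y\<in>span (b ` J). v - y \<in> Z)"

lemma independent_moduloD:
  "independent_modulo Z b J \<Longrightarrow> finite F \<Longrightarrow> F \<subseteq> J \<Longrightarrow> (\<Sum>j\<in>F. c j *s b j) \<in> Z \<Longrightarrow> j \<in> F \<Longrightarrow> c j = 0"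
  unfolding independent_modulo_def by blast

lemma independent_modulo_reindex:
  assumes "independent_modulo Z b J" "inj_on h K" "h ` K \<subseteq> J"
    and \<kappa>: "\<And>k. k \<in> K \<Longrightarrow> \<kappa> k \<noteq> 0" and b': "\<And>k. k \<in> K \<Longrightarrow> b' k = \<kappa> k *s b (h k)"
  shows "independent_modulo Z b' K"
  unfolding independent_modulo_def
proof (intro allI impI ballI)
  fix F c k
  assume F: "finite F" "F \<subseteq> K" and Z: "(\<Sum>k\<in>F. c k *s b' k) \<in> Z" and k: "k \<in> F"
  have inj: "inj_on h F"
    using assms(2) F(2) inj_on_subset by blast
  define a where "a j = c (the_inv_into F h j) * \<kappa> (the_inv_into F h j)" for j
  have a: "a (h k) = c k * \<kappa> k" if "k \<in> F" for k
    by (simp add: a_def the_inv_into_f_f[OF inj that])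
  have "(\<Sum>j\<in>h ` F. a j *s b j) = (\<Sum>k\<in>F. c k *s b' k)"
    unfolding sum.reindex[OF inj] using F b' by (intro sum.cong) (auto simp: a)
  then have "a (h k) = 0"
    using independent_moduloD[OF assms(1), of "h ` F" a] F assms(3) Z k by auto
  then show "c k = 0"
    using a k \<kappa> F(2) by auto
qed

lemma in_span_imageE:
  assumes "y \<in> span (b ` J)"
  obtains F c where "finite F" "F \<subseteq> J" "y = (\<Sum>j\<in>F. c j *s b j)"
proof -
  obtain t r where t: "finite t" "t \<subseteq> b ` J" "y = (\<Sum>x\<in>t. r x *s x)"
    using assms unfolding span_explicit by blast
  then obtain F where F: "F \<subseteq> J" "inj_on b F" "t = b ` F"
    by (auto simp: subset_image_inj)
  then have "finite F"
    using t(1) finite_imageD by blast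
  with t(3) F show thesis
    by (intro that[of F "r \<circ> b"]) (simp_all add: sum.reindex)
qed

lemma in_span_image_finiteE:
  assumes "y \<in> span (b ` J)" "finite J"
  obtains c where "y = (\<Sum>j\<in>J. c j *s b j)"
proof -
  obtain F c where F: "finite F" "F \<subseteq> J" "y = (\<Sum>j\<in>F. c j *s b j)"
    using assms(1) by (rule in_span_imageE)
  have "y = (\<Sum>j\<in>J. (if j \<in> F then c j else 0) *s b j)"
    unfolding F(3) using F(2) assms(2) by (intro sum.mono_neutral_cong_left) auto
  then show thesis by (rule that)
qed

lemma independent_modulo_coeff_zero:
  assumes "independent_modulo Z b J" "j \<in> J" "y \<in> span (b ` (J - {j}))" "a *s b j + y \<in> Z"
  shows "a = 0"
proof -
  obtain F c where F: "finite F" "F \<subseteq> J - {j}" "y = (\<Sum>k\<in>F. c k *s b k)"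
    using assms(3) by (rule in_span_imageE)
  have "(\<Sum>k\<in>insert j F. (if k = j then a else c k) *s b k)
      = a *s b j + (\<Sum>k\<in>F. (if k = j then a else c k) *s b k)"
    using F by (subst sum.insert) auto
  also have "(\<Sum>k\<in>F. (if k = j then a else c k) *s b k) = y"
    unfolding F(3) using F(2) by (intro sum.cong) auto
  finally show ?thesis
    using independent_moduloD[OF assms(1), of "insert j F" "\<lambda>k. if k = j then a else c k" j] F
      assms(2,4) by auto
qed

lemma independent_modulo_triangular:
  fixes rank :: "'i \<Rightarrow> nat"
  assumes e: "independent_modulo Z e J" and \<kappa>: "\<And>j. j \<in> J \<Longrightarrow> \<kappa> j \<noteq> 0"
    and b: "\<And>j. j \<in> J \<Longrightarrow> b j - \<kappa> j *s e j \<in> span (e ` {k \<in> J. rank k < rank j})"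
  shows "independent_modulo Z b J"
  unfolding independent_modulo_def
proof (intro allI impI, rule ccontr)
  fix F c
  assume F: "finite F" "F \<subseteq> J" and Z: "(\<Sum>j\<in>F. c j *s b j) \<in> Z" and "\<not> (\<forall>j\<in>F. c j = 0)"
  define E where "E = {j \<in> F. c j \<noteq> 0}"
  have E: "finite E" "E \<noteq> {}" "E \<subseteq> J"
    using F \<open>\<not> (\<forall>j\<in>F. c j = 0)\<close> by (auto simp: E_def)
  have "Max (rank ` E) \<in> rank ` E"
    using E by (intro Max_in) auto
  then obtain i where i: "i \<in> E" and top: "rank i = Max (rank ` E)"
    by auto
  have max: "\<And>j. j \<in> E \<Longrightarrow> rank j \<le> rank i"
    using top E(1) by simp
  let ?r = "\<lambda>j. c j *s (b j - \<kappa> j *s e j)"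
  have lower: "?r j \<in> span (e ` (J - {i}))" if "j \<in> E" for j
  proof -
    have "e ` {k \<in> J. rank k < rank j} \<subseteq> e ` (J - {i})"
      using max[OF that] by auto
    with b[of j] that E(3) show ?thesis
      by (meson span_mono span_scale subset_iff)
  qed
  have "(\<Sum>j\<in>F. c j *s b j) = (\<Sum>j\<in>E. c j *s b j)"
    using F(1) by (intro sum.mono_neutral_right) (auto simp: E_def)
  also have "\<dots> = (\<Sum>j\<in>E. (c j * \<kappa> j) *s e j) + (\<Sum>j\<in>E. ?r j)"
    by (simp add: scale_right_diff_distrib flip: sum.distrib)
  also have "(\<Sum>j\<in>E. (c j * \<kappa> j) *s e j) = (c i * \<kappa> i) *s e i + (\<Sum>j\<in>E - {i}. (c j * \<kappa> j) *s e j)"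
    using E(1) i by (rule sum.remove)
  finally have "(c i * \<kappa> i) *s e i + ((\<Sum>j\<in>E - {i}. (c j * \<kappa> j) *s e j) + (\<Sum>j\<in>E. ?r j)) \<in> Z"
    using Z by (simp add: add.assoc)
  moreover have "(\<Sum>j\<in>E - {i}. (c j * \<kappa> j) *s e j) + (\<Sum>j\<in>E. ?r j) \<in> span (e ` (J - {i}))"
    using E(3) by (intro span_add span_sum lower span_scale span_base) auto
  ultimately have "c i * \<kappa> i = 0"
    using independent_modulo_coeff_zero[OF e] i E(3) by blast
  then show False
    using i \<kappa> E(3) by (auto simp: E_def)
qed

lemma span_triangular:
  fixes rank :: "'i \<Rightarrow> nat"
  assumes \<kappa>: "\<And>j. j \<in> J \<Longrightarrow> \<kappa> j \<noteq> 0"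
    and b: "\<And>j. j \<in> J \<Longrightarrow> b j - \<kappa> j *s e j \<in> span (e ` {k \<in> J. rank k < rank j})"
  shows "e ` J \<subseteq> span (b ` J)"
proof -
  have "e j \<in> span (b ` J)" if "j \<in> J" for j
    using that
  proof (induction "rank j" arbitrary: j rule: less_induct)
    case less
    then have "span (e ` {k \<in> J. rank k < rank j}) \<subseteq> span (b ` J)"
      by (intro span_minimal) auto
    then have "b j - \<kappa> j *s e j \<in> span (b ` J)"
      using b[OF less.prems] by blast
    then have "b j - (b j - \<kappa> j *s e j) \<in> span (b ` J)"
      using less.prems by (blast intro: span_diff span_base)
    then have "inverse (\<kappa> j) *s (\<kappa> j *s e j) \<in> span (b ` J)"
      by (simp only: diff_diff_eq2 add_diff_cancel_left' span_scale)
    then show ?case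
      using \<kappa>[OF less.prems] by simp
  qed
  then show ?thesis by blast
qed

lemma basis_modulo_restrict:
  assumes "basis_modulo Z V b J" "subspace Z" "subspace W" "V' \<subseteq> W" "b ` J \<subseteq> V'"
    and "\<And>v. v \<in> V' \<Longrightarrow> \<exists>v0\<in>V. v - v0 \<in> Z"
  shows "basis_modulo (Z \<inter> W) V' b J"
  unfolding basis_modulo_def
proof (intro conjI ballI)
  show "independent_modulo (Z \<inter> W) b J"
    using assms(1) unfolding basis_modulo_def independent_modulo_def by blast
  fix v assume v: "v \<in> V'"
  then obtain v0 where v0: "v0 \<in> V" "v - v0 \<in> Z"
    using assms(6) by blast
  then obtain y where y: "y \<in> span (b ` J)" "v0 - y \<in> Z"
    using assms(1) by (auto simp: basis_modulo_def)
  have "v - y \<in> Z"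
    using subspace_add[OF assms(2) v0(2) y(2)] by simp
  moreover have "y \<in> W"
    using y(1) span_minimal[of "b ` J" W] assms(3-5) by blast
  then have "v - y \<in> W"
    using v assms(3,4) by (blast intro: subspace_diff)
  ultimately show "\<exists>y\<in>span (b ` J). v - y \<in> Z \<inter> W"
    using y(1) by blast
qed (rule assms(5))

lemma independent_modulo_inj_on:
  assumes "independent_modulo Z b J" "0 \<in> Z"
  shows "inj_on b J"
proof (rule inj_onI, rule ccontr)
  fix j k assume jk: "j \<in> J" "k \<in> J" "b j = b k" "j \<noteq> k"
  have "1 *s b j + (- 1) *s b k \<in> Z"
    using jk(3) assms(2) by simp
  moreover have "(- 1) *s b k \<in> span (b ` (J - {j}))"
    using jk by (intro span_scale span_base) auto
  ultimately show False
    using independent_modulo_coeff_zero[OF assms(1) jk(1)] by (metis zero_neq_one)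
qed

lemma independent_Un_independent_modulo:
  assumes C: "independent C" "C \<subseteq> Z" and Z: "subspace Z" and b: "independent_modulo Z b J"
  shows "independent (C \<union> b ` J)" "C \<inter> b ` J = {}"
proof -
  have sum_in_Z: "(\<Sum>v\<in>s. r v *s v) \<in> Z" if "s \<subseteq> C" for s r
    using that C(2) by (intro subspace_sum[OF Z] subspace_scale[OF Z]) auto
  have "b j \<notin> Z" if "j \<in> J" for j
    using independent_modulo_coeff_zero[OF b that, of 0 1] span_zero by auto
  then show disjoint: "C \<inter> b ` J = {}"
    using C(2) by auto
  show "independent (C \<union> b ` J)"
    unfolding independent_explicit_module
  proof (intro allI impI)
    fix t r v
    assume t: "finite t" "t \<subseteq> C \<union> b ` J" "(\<Sum>v\<in>t. r v *s v) = 0" "v \<in> t"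
    define s where "s = t \<inter> C"
    obtain F where F: "F \<subseteq> J" "inj_on b F" "t - C = b ` F"
      using t(2) subset_image_inj[of "t - C" b J] by blast
    have finF: "finite F"
      using F t(1) finite_image_iff[of b F] by (metis finite_Diff)
    have split: "(\<Sum>v\<in>s. r v *s v) + (\<Sum>j\<in>F. r (b j) *s b j) = 0"
      using t(1,3) F by (simp add: s_def sum.Int_Diff[of t _ C] sum.reindex)
    then have "(\<Sum>j\<in>F. r (b j) *s b j) = - (\<Sum>v\<in>s. r v *s v)"
      by (simp add: add_eq_0_iff)
    also have "\<dots> \<in> Z"
      using sum_in_Z[of s] by (intro subspace_neg[OF Z]) (simp add: s_def)
    finally have r_b: "r (b j) = 0" if "j \<in> F" for j
      using independent_moduloD[OF b finF F(1), of "\<lambda>j. r (b j)"] that by blast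
    then have "(\<Sum>v\<in>s. r v *s v) = 0"
      using split by simp
    then have "r v = 0" if "v \<in> s" for v
      using independentD[OF C(1), of s] t(1) that by (simp add: s_def)
    moreover have "v \<in> s \<or> v \<in> b ` F"
      using t(4) F(3) by (auto simp: s_def)
    ultimately show "r v = 0"
      using r_b by blast
  qed
qed

end

locale vector_space_modulo_pair =
  vs1: vector_space_modulo s1 + vs2: vector_space_modulo s2
  for s1 :: "'a::field \<Rightarrow> 'b::ab_group_add \<Rightarrow> 'b" and s2 :: "'a \<Rightarrow> 'c::ab_group_add \<Rightarrow> 'c"
begin

sublocale vector_space_pair s1 s2 ..

lemma linear_span_into:
  assumes "Vector_Spaces.linear s1 s2 T" "vs2.subspace W" "\<And>x. x \<in> S \<Longrightarrow> T x \<in> W" "z \<in> vs1.span S"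
  shows "T z \<in> W"
proof -
  interpret Vector_Spaces.linear s1 s2 T by fact
  have "T ` S \<subseteq> W"
    using assms(3) by blast
  then have "T ` vs1.span S \<subseteq> W"
    unfolding span_image[symmetric] using assms(2) by (rule vs2.span_minimal)
  with assms(4) show ?thesis by blast
qed

lemma exists_linear_modulo:
  assumes "vs1.subspace Z" "vs1.independent_modulo Z b J"
  obtains H where "Vector_Spaces.linear s1 s2 H" "\<And>z. z \<in> Z \<Longrightarrow> H z = 0" "\<And>j. j \<in> J \<Longrightarrow> H (b j) = y j"
proof -
  obtain C where C: "C \<subseteq> Z" "vs1.independent C" "Z \<subseteq> vs1.span C"
    using vs1.maximal_independent_subset by blast
  note Un = vs1.independent_Un_independent_modulo[OF C(2,1) assms]
  have inj: "inj_on b J"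
    using vs1.independent_modulo_inj_on assms vs1.subspace_0 by blast
  define f where "f v = (if v \<in> C then 0 else y (the_inv_into J b v))" for v
  obtain H where H: "Vector_Spaces.linear s1 s2 H" "\<And>v. v \<in> C \<union> b ` J \<Longrightarrow> H v = f v"
    using linear_independent_extend[OF Un(1), of f] by blast
  interpret Vector_Spaces.linear s1 s2 H by fact
  show thesis
  proof (rule that[OF H(1)])
    show "H z = 0" if "z \<in> Z" for z
      using eq_0_on_span[of C z] H(2) C(3) that by (auto simp: f_def)
    show "H (b j) = y j" if "j \<in> J" for j
      using H(2)[of "b j"] Un(2) the_inv_into_f_f[OF inj that] that by (auto simp: f_def)
  qed
qed

lemma independent_modulo_linear_vimage:
  assumes "Vector_Spaces.linear s1 s2 T" "T ` Z \<subseteq> Z'" "vs2.independent_modulo Z' (\<lambda>j. T (b j)) J"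
  shows "vs1.independent_modulo Z b J"
  unfolding vs1.independent_modulo_def
proof (intro allI impI ballI)
  fix F c j assume F: "finite F" "F \<subseteq> J" "(\<Sum>j\<in>F. s1 (c j) (b j)) \<in> Z" "j \<in> F"
  interpret Vector_Spaces.linear s1 s2 T by fact
  have "(\<Sum>j\<in>F. s2 (c j) (T (b j))) \<in> Z'"
    using assms(2) F(3) by (auto simp flip: scale sum)
  with F show "c j = 0"
    using vs2.independent_moduloD[OF assms(3)] by blast
qed

lemma basis_modulo_linear_injective:
  assumes "Vector_Spaces.linear s1 s2 T" "vs1.subspace Z" "vs2.subspace Z'" "T ` Z \<subseteq> Z'"
    and "vs1.basis_modulo Z V b J" "vs2.independent_modulo Z' (\<lambda>j. T (b j)) J"
    and "v \<in> V" "T v \<in> Z'"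
  shows "v \<in> Z"
proof -
  interpret Vector_Spaces.linear s1 s2 T by fact
  obtain y where y: "y \<in> vs1.span (b ` J)" "v - y \<in> Z"
    using assms(5,7) by (auto simp: vs1.basis_modulo_def)
  obtain F c where F: "finite F" "F \<subseteq> J" "y = (\<Sum>j\<in>F. s1 (c j) (b j))"
    using y(1) by (rule vs1.in_span_imageE)
  have "T v - T (v - y) \<in> Z'"
    using assms(4) y(2) by (intro vs2.subspace_diff assms(3,8)) auto
  then have "(\<Sum>j\<in>F. s2 (c j) (T (b j))) \<in> Z'"
    by (simp add: diff F(3) sum scale)
  then have "\<And>j. j \<in> F \<Longrightarrow> c j = 0"
    using vs2.independent_moduloD[OF assms(6) F(1,2)] by blast
  then have "y = 0"
    unfolding F(3) by (intro sum.neutral) auto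
  with y(2) show ?thesis by simp
qed

lemma basis_modulo_linear_surjective:
  assumes "Vector_Spaces.linear s1 s2 T" "vs1.subspace V" "vs2.basis_modulo Z' V' b' J'"
    "b' ` J' \<subseteq> T ` V" "v' \<in> V'"
  shows "\<exists>v\<in>V. v' - T v \<in> Z'"
proof -
  interpret Vector_Spaces.linear s1 s2 T by fact
  obtain y where y: "y \<in> vs2.span (b' ` J')" "v' - y \<in> Z'"
    using assms(3,5) by (auto simp: vs2.basis_modulo_def)
  have "y \<in> T ` V"
    using y(1) vs2.span_minimal[OF assms(4) subspace_image[OF assms(2)]] by blast
  with y(2) show ?thesis by blast
qed

end

section \<open>Polynomials\<close>

abbreviation lookup :: "('a \<Rightarrow>\<^sub>0 'b::zero) \<Rightarrow> 'a \<Rightarrow> 'b" where "lookup \<equiv> Poly_Mapping.lookup"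
abbreviation single :: "'a \<Rightarrow> 'b \<Rightarrow> ('a \<Rightarrow>\<^sub>0 'b::zero)" where "single \<equiv> Poly_Mapping.single"
abbreviation keys :: "('a \<Rightarrow>\<^sub>0 'b::zero) \<Rightarrow> 'a set" where "keys \<equiv> Poly_Mapping.keys"

lemma Const_0 [simp]: "Const 0 = 0" and Const_1 [simp]: "Const 1 = 1"
  by (simp_all add: Const_def)

lemma Const_add: "Const (a + b) = Const a + Const b"
  and Const_mult: "Const (a * b) = Const a * Const b"
  and Const_uminus: "Const (- a) = - Const a"
  and Const_diff: "Const (a - b) = Const a - Const b"
  by (simp_all add: Const_def single_add mult_single single_uminus single_diff)

lemma Const_inject [simp]: "Const a = Const b \<longleftrightarrow> a = b"
  by (metis Const_def lookup_single_eq)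

lemma Const_power: "Const (a ^ k) = Const a ^ k"
  by (induction k) (simp_all add: Const_mult)

lemma Const_sum: "Const (\<Sum>x\<in>A. h x) = (\<Sum>x\<in>A. Const (h x))"
  by (induction A rule: infinite_finite_induct) (simp_all add: Const_add)

lemma Const_prod: "Const (\<Prod>x\<in>A. h x) = (\<Prod>x\<in>A. Const (h x))"
  by (induction A rule: infinite_finite_induct) (simp_all add: Const_mult)

lemma Const_of_nat: "Const (of_nat k) = of_nat k"
  by (induction k) (simp_all add: Const_add)

lemma Const_of_int: "Const (of_int k) = of_int k"
  by (cases k rule: int_diff_cases) (simp add: Const_diff Const_of_nat)

lemma lookup_Const_mult [simp]: "lookup (Const c * p) m = c * lookup p m"
proof -
  have "Const c * p = Poly_Mapping.map ((*) c) p"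
    by (simp add: mult_map_scale_conv_mult Const_def)
  then show ?thesis
    by (simp add: map.rep_eq when_def)
qed

interpretation mpoly: vector_space_modulo "\<lambda>c p. Const c * p"
  by unfold_locales (simp_all add: algebra_simps Const_add Const_mult)

interpretation mpoly_ring: module "(*) :: mpoly \<Rightarrow> mpoly \<Rightarrow> mpoly"
  by unfold_locales (simp_all add: algebra_simps)

declare mpoly.scale_scale [simp del] mpoly_ring.scale_scale [simp del]

abbreviation ideal :: "mpoly set \<Rightarrow> mpoly set" where
  "ideal \<equiv> mpoly_ring.span"

lemma mpoly_sum_monomials: "(\<Sum>m\<in>keys p. single m (lookup p m)) = p"
  by (rule poly_mapping_eqI) (auto simp: lookup_sum lookup_single when_def in_keys_iff)

lemma single_eq_Const_mult: "single m c = Const c * single m (1::complex)"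
  by (simp add: Const_def mult_single)

lemma Var_power: "Var v ^ k = single (single v k) 1"
  by (induction k) (simp_all add: Var_def mult_single flip: single_add)

lemma prod_Var_power: "finite A \<Longrightarrow> (\<Prod>v\<in>A. Var v ^ e v) = single (\<Sum>v\<in>A. single v (e v)) 1"
  by (induction A rule: finite_induct) (simp_all add: Var_power mult_single)

lemma monomial_eq_prod_Var:
  assumes "finite A" "keys m \<subseteq> A"
  shows "single m (1::complex) = (\<Prod>v\<in>A. Var v ^ lookup m v)"
proof -
  have "(\<Sum>v\<in>A. single v (lookup m v)) = m"
    using assms by (intro poly_mapping_eqI) (auto simp: lookup_sum lookup_single when_def in_keys_iff)
  then show ?thesis
    using assms(1) by (simp add: prod_Var_power)
qed

lemma mpoly_induct [case_names mono add]:
  assumes "\<And>m c. P (single m c)" "\<And>p q. P p \<Longrightarrow> P q \<Longrightarrow> P (p + q)"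
  shows "P (p :: mpoly)"
proof -
  have "P (\<Sum>m\<in>A. single m (lookup p m))" if "finite A" for A
    using that by (induction A) (auto intro: assms assms(1)[of 0 0, simplified])
  then show ?thesis by (metis mpoly_sum_monomials finite_keys)
qed

lemma poly_in_induct [consumes 1, case_names Const Var add mult]:
  assumes "poly_in W p" "\<And>c. P (Const c)" "\<And>v. v \<in> W \<Longrightarrow> P (Var v)"
    "\<And>p q. P p \<Longrightarrow> P q \<Longrightarrow> P (p + q)" "\<And>p q. P p \<Longrightarrow> P q \<Longrightarrow> P (p * q)"
  shows "P p"
proof -
  have pow: "P (Var v ^ k)" if "v \<in> W" for v k
    using that assms(2)[of 1] assms(3,5) by (induction k) auto
  have prod: "P (\<Prod>v\<in>A. Var v ^ lookup m v)" if "finite A" "A \<subseteq> W" for A and m :: "nat \<Rightarrow>\<^sub>0 nat"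
    using that assms(2)[of 1] by (induction A) (auto intro: assms(5) pow)
  have sgl: "P (single m c)" if "keys m \<subseteq> W" for m c
    using prod[of "keys m" m] that assms(2,5)
    by (subst single_eq_Const_mult, subst monomial_eq_prod_Var[of "keys m"]) auto
  have "P (\<Sum>m\<in>A. single m (lookup p m))" if "finite A" "A \<subseteq> keys p" for A
    using that assms(1) assms(2)[of 0]
    by (induction A) (auto intro!: assms(4) sgl simp: poly_in_def)
  then show ?thesis by (metis mpoly_sum_monomials finite_keys order_refl)
qed

lemma keys_add_nat: "keys (m + m') = keys m \<union> keys (m' :: nat \<Rightarrow>\<^sub>0 nat)"
  by (auto simp: in_keys_iff lookup_add)

definition poly_supp :: "((nat \<Rightarrow>\<^sub>0 nat) \<Rightarrow> bool) \<Rightarrow> mpoly \<Rightarrow> bool" where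
  "poly_supp R p \<longleftrightarrow> (\<forall>m\<in>keys p. R m)"

lemma poly_supp_0 [simp]: "poly_supp R 0"
  by (simp add: poly_supp_def)

lemma poly_supp_add: "poly_supp R p \<Longrightarrow> poly_supp R q \<Longrightarrow> poly_supp R (p + q)"
  using keys_add[of p q] by (auto simp: poly_supp_def)

lemma poly_supp_Const_mult: "poly_supp R p \<Longrightarrow> poly_supp R (Const c * p)"
  by (auto simp: poly_supp_def in_keys_iff)

lemma subspace_poly_supp: "mpoly.subspace {p. poly_supp R p}"
  by (intro mpoly.subspaceI) (auto intro: poly_supp_add poly_supp_Const_mult)

lemma poly_supp_diff: "poly_supp R p \<Longrightarrow> poly_supp R q \<Longrightarrow> poly_supp R (p - q)"
  using mpoly.subspace_diff[OF subspace_poly_supp] by blast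

lemma poly_supp_sum: "(\<And>x. x \<in> A \<Longrightarrow> poly_supp R (h x)) \<Longrightarrow> poly_supp R (\<Sum>x\<in>A. h x)"
  using mpoly.subspace_sum[OF subspace_poly_supp, of A h] by blast

lemma poly_supp_mult:
  assumes "poly_supp R p" "poly_supp R' q" "\<And>m m'. R m \<Longrightarrow> R' m' \<Longrightarrow> R'' (m + m')"
  shows "poly_supp R'' (p * q)"
  unfolding poly_supp_def
proof
  fix m assume "m \<in> keys (p * q)"
  then obtain a b where "a \<in> keys p" "b \<in> keys q" "m = a + b"
    using keys_mult[of p q] by auto
  with assms show "R'' m" by (auto simp: poly_supp_def)
qed

lemma poly_in_poly_supp: "poly_in V p \<longleftrightarrow> poly_supp (\<lambda>m. keys m \<subseteq> V) p"
  by (simp add: poly_in_def poly_supp_def)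

lemma poly_in_Const [simp]: "poly_in V (Const c)"
  by (auto simp: poly_in_def Const_def split: if_splits)

lemma poly_in_1 [simp]: "poly_in V 1"
  using poly_in_Const[of V 1] by simp

lemma poly_in_Var [simp]: "poly_in V (Var v) \<longleftrightarrow> v \<in> V"
  by (auto simp: poly_in_def Var_def)

lemma poly_in_diff: "poly_in V p \<Longrightarrow> poly_in V q \<Longrightarrow> poly_in V (p - q)"
  unfolding poly_in_poly_supp by (rule poly_supp_diff)

lemma poly_in_mult: "poly_in V p \<Longrightarrow> poly_in V q \<Longrightarrow> poly_in V (p * q)"
  unfolding poly_in_poly_supp by (erule poly_supp_mult) (auto simp: keys_add_nat)

lemma poly_in_prod: "(\<And>x. x \<in> A \<Longrightarrow> poly_in V (h x)) \<Longrightarrow> poly_in V (\<Prod>x\<in>A. h x)"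
  by (induction A rule: infinite_finite_induct) (auto intro: poly_in_mult)

lemma prod_in_subspace:
  assumes "finite L" "mpoly.subspace W" "\<And>l. l \<in> L \<Longrightarrow> p l \<in> mpoly.span (X l)"
    and "\<And>x. (\<And>l. l \<in> L \<Longrightarrow> x l \<in> X l) \<Longrightarrow> (\<Prod>l\<in>L. x l) \<in> W"
  shows "(\<Prod>l\<in>L. p l) \<in> W"
  using assms
proof (induction L arbitrary: W rule: finite_induct)
  case (insert a L)
  have vimage: "mpoly.subspace {q. q * r \<in> W}" for r
    using mpoly.subspace_0[OF insert.prems(1)] mpoly.subspace_add[OF insert.prems(1)]
      mpoly.subspace_scale[OF insert.prems(1)]
    by (intro mpoly.subspaceI) (simp_all add: distrib_right mult.assoc)
  have "q * (\<Prod>l\<in>L. p l) \<in> W" if q: "q \<in> X a" for q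
  proof -
    have "(\<Prod>l\<in>L. p l) \<in> {r. r * q \<in> W}"
    proof (rule insert.IH[OF vimage])
      fix x assume "\<And>l. l \<in> L \<Longrightarrow> x l \<in> X l"
      then have "(\<Prod>l\<in>insert a L. (x(a := q)) l) \<in> W"
        using q by (intro insert.prems(3)) auto
      moreover have "(\<Prod>l\<in>L. (x(a := q)) l) = (\<Prod>l\<in>L. x l)"
        using insert.hyps by (intro prod.cong) auto
      ultimately show "(\<Prod>l\<in>L. x l) \<in> {r. r * q \<in> W}"
        using insert.hyps by (simp add: mult.commute)
    qed (simp add: insert.prems(2))
    then show ?thesis by (simp add: mult.commute)
  qed
  then have "mpoly.span (X a) \<subseteq> {q. q * (\<Prod>l\<in>L. p l) \<in> W}"
    by (intro mpoly.span_minimal vimage) auto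
  then show ?case
    using insert.prems(2)[of a] insert.hyps by auto
qed auto

lemma ideal_mult_right: "p \<in> ideal G \<Longrightarrow> p * q \<in> ideal G"
  using mpoly_ring.span_scale[of p G q] by (simp add: mult.commute)

lemma ideal_diff_mult:
  assumes "p - p' \<in> ideal G" "q - q' \<in> ideal G"
  shows "p * q - p' * q' \<in> ideal G"
proof -
  have "p * q - p' * q' = q * (p - p') + p' * (q - q')"
    by (simp add: algebra_simps)
  then show ?thesis
    using assms by (simp only: mpoly_ring.span_add mpoly_ring.span_scale)
qed

lemma ideal_diff_prod:
  "(\<And>x. x \<in> A \<Longrightarrow> h x - h' x \<in> ideal G) \<Longrightarrow> (\<Prod>x\<in>A. h x) - (\<Prod>x\<in>A. h' x) \<in> ideal G"
  by (induction A rule: infinite_finite_induct) (auto intro: ideal_diff_mult mpoly_ring.span_zero)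

subsection \<open>Partial derivatives\<close>

lemma lookup_pderiv:
  "lookup (pderiv_mp k p) m = of_nat (lookup m k + 1) * lookup p (m + single k 1)"
proof -
  have "{m. of_nat (lookup m k + 1) * lookup p (m + single k 1) \<noteq> 0} \<subseteq> (\<lambda>m'. m' - single k 1) ` keys p"
  proof
    fix m assume "m \<in> {m. of_nat (lookup m k + 1) * lookup p (m + single k 1) \<noteq> 0}"
    then have "m + single k 1 \<in> keys p" by (auto simp: in_keys_iff)
    moreover have "m = (m + single k 1) - single k 1" by simp
    ultimately show "m \<in> (\<lambda>m'. m' - single k 1) ` keys p" by blast
  qed
  then have "finite {m. of_nat (lookup m k + 1) * lookup p (m + single k 1) \<noteq> 0}"
    by (rule finite_subset) simp
  then show ?thesis by (simp add: pderiv_mp_def)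
qed

lemma pderiv_add [simp]: "pderiv_mp k (p + q) = pderiv_mp k p + pderiv_mp k q"
  by (rule poly_mapping_eqI) (simp add: lookup_pderiv lookup_add algebra_simps)

lemma pderiv_uminus [simp]: "pderiv_mp k (- p) = - pderiv_mp k p"
  by (rule poly_mapping_eqI) (simp add: lookup_pderiv)

lemma pderiv_diff [simp]: "pderiv_mp k (p - q) = pderiv_mp k p - pderiv_mp k q"
  by (rule poly_mapping_eqI) (simp add: lookup_pderiv lookup_minus algebra_simps)

lemma pderiv_0 [simp]: "pderiv_mp k 0 = 0"
  by (rule poly_mapping_eqI) (simp add: lookup_pderiv)

lemma pderiv_sum: "pderiv_mp k (\<Sum>x\<in>A. h x) = (\<Sum>x\<in>A. pderiv_mp k (h x))"
  by (induction A rule: infinite_finite_induct) simp_all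

lemma pderiv_single: "pderiv_mp k (single m c) = single (m - single k 1) (of_nat (lookup m k) * c)"
proof (rule poly_mapping_eqI)
  fix m'
  show "lookup (pderiv_mp k (single m c)) m'
      = lookup (single (m - single k 1) (of_nat (lookup m k) * c)) m'"
  proof (cases "lookup m k = 0")
    case True
    then have "m \<noteq> m' + single k 1" by (auto simp: lookup_add)
    with True show ?thesis by (simp add: lookup_pderiv lookup_single when_def)
  next
    case False
    then have m: "m = (m - single k 1) + single k 1"
      by (intro poly_mapping_eqI) (auto simp: lookup_add lookup_minus lookup_single when_def)
    then have "m = m' + single k 1 \<longleftrightarrow> m - single k 1 = m'" by auto
    moreover have "m - single k 1 = m' \<Longrightarrow> lookup m k = lookup m' k + 1"
      by (subst m) (simp add: lookup_add)
    ultimately show ?thesis by (auto simp: lookup_pderiv lookup_single when_def)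
  qed
qed

lemma single_minus_add:
  "single (m - single k 1 + m') (of_nat (lookup m k) * c)
      = single (m + m' - single k 1) (of_nat (lookup m k) * c :: complex)"
proof (cases "lookup m k = 0")
  case False
  then have "m - single k 1 + m' = m + m' - single k 1"
    by (intro poly_mapping_eqI) (auto simp: lookup_add lookup_minus lookup_single when_def)
  then show ?thesis by simp
qed simp

lemma pderiv_mult: "pderiv_mp k (p * q) = pderiv_mp k p * q + p * pderiv_mp k q"
proof (induction p rule: mpoly_induct)
  case (mono m c)
  show ?case
  proof (induction q rule: mpoly_induct)
    case (mono m' c')
    show ?case
      using single_minus_add[of m k m' "c * c'"] single_minus_add[of m' k m "c * c'"]
      by (simp add: mult_single pderiv_single lookup_add algebra_simps flip: single_add)
  qed (simp add: algebra_simps)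
qed (simp add: algebra_simps)

lemma pderiv_Const [simp]: "pderiv_mp k (Const c) = 0"
  by (simp add: Const_def pderiv_single)

lemma pderiv_1 [simp]: "pderiv_mp k 1 = 0"
  using pderiv_Const[of k 1] by simp

lemma pderiv_Const_mult [simp]: "pderiv_mp k (Const c * p) = Const c * pderiv_mp k p"
  by (simp add: pderiv_mult)

lemma pderiv_Var: "pderiv_mp k (Var v) = (if k = v then 1 else 0)"
  by (auto simp: Var_def pderiv_single lookup_single)

lemma pderiv_power: "pderiv_mp k (p ^ e) = of_nat e * p ^ (e - 1) * pderiv_mp k p"
proof (induction e)
  case (Suc e)
  show ?case by (cases e) (use Suc in \<open>auto simp: pderiv_mult algebra_simps\<close>)
qed simp

lemma pderiv_commute: "pderiv_mp k (pderiv_mp l p) = pderiv_mp l (pderiv_mp k p)"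
  by (rule poly_mapping_eqI) (auto simp: lookup_pderiv lookup_add lookup_single when_def ac_simps)

subsection \<open>Substitution and evaluation\<close>

lemma subst_superset:
  assumes "finite A" "keys p \<subseteq> A"
  shows "subst_mp \<phi> p = (\<Sum>m\<in>A. Const (lookup p m) * (\<Prod>v\<in>keys m. \<phi> v ^ lookup m v))"
  unfolding subst_mp_def using assms
  by (intro sum.mono_neutral_left) (auto simp: in_keys_iff)

lemma subst_add [simp]: "subst_mp \<phi> (p + q) = subst_mp \<phi> p + subst_mp \<phi> q"
proof -
  let ?A = "keys p \<union> keys q"
  have "keys (p + q) \<subseteq> ?A" by (rule keys_add)
  then show ?thesis
    by (subst (1 2 3) subst_superset[of ?A])
       (auto simp: lookup_add Const_add algebra_simps sum.distrib)
qed

lemma subst_0 [simp]: "subst_mp \<phi> 0 = 0"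
  by (simp add: subst_mp_def)

lemma subst_single: "subst_mp \<phi> (single m c) = Const c * (\<Prod>v\<in>keys m. \<phi> v ^ lookup m v)"
  by (subst subst_superset[of "{m}"]) (auto split: if_splits)

lemma subst_mult [simp]: "subst_mp \<phi> (p * q) = subst_mp \<phi> p * subst_mp \<phi> q"
proof (induction p rule: mpoly_induct)
  case (mono m c)
  show ?case
  proof (induction q rule: mpoly_induct)
    case (mono m' c')
    let ?A = "keys m \<union> keys m'"
    have sup: "(\<Prod>v\<in>keys a. \<phi> v ^ lookup a v) = (\<Prod>v\<in>?A. \<phi> v ^ lookup a v)" if "keys a \<subseteq> ?A" for a
      using that by (intro prod.mono_neutral_left) (auto simp: in_keys_iff)
    show ?case
      by (simp add: mult_single subst_single sup keys_add_nat lookup_add power_add prod.distrib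
        Const_mult)
  qed (simp add: algebra_simps)
qed (simp add: algebra_simps)

lemma subst_Const [simp]: "subst_mp \<phi> (Const c) = Const c"
  using subst_single[of \<phi> 0 c] by (simp add: Const_def)

lemma subst_1 [simp]: "subst_mp \<phi> 1 = 1"
  using subst_Const[of \<phi> 1] by simp

lemma subst_Var [simp]: "subst_mp \<phi> (Var v) = \<phi> v"
  by (simp add: Var_def subst_single)

lemma subst_uminus [simp]: "subst_mp \<phi> (- p) = - subst_mp \<phi> p"
  by (metis add_eq_0_iff subst_add subst_0 add.right_inverse)

lemma subst_diff [simp]: "subst_mp \<phi> (p - q) = subst_mp \<phi> p - subst_mp \<phi> q"
  using subst_add[of \<phi> p "- q"] by simp

lemma subst_power [simp]: "subst_mp \<phi> (p ^ k) = subst_mp \<phi> p ^ k"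
  by (induction k) simp_all

lemma subst_prod: "subst_mp \<phi> (\<Prod>x\<in>A. h x) = (\<Prod>x\<in>A. subst_mp \<phi> (h x))"
  by (induction A rule: infinite_finite_induct) simp_all

lemma subst_sum: "subst_mp \<phi> (\<Sum>x\<in>A. h x) = (\<Sum>x\<in>A. subst_mp \<phi> (h x))"
  by (induction A rule: infinite_finite_induct) simp_all

lemma pderiv_subst:
  assumes "finite W" "poly_in W p"
  shows "pderiv_mp k (subst_mp \<phi> p) = (\<Sum>v\<in>W. subst_mp \<phi> (pderiv_mp v p) * pderiv_mp k (\<phi> v))"
  using assms(2)
proof (induction p rule: poly_in_induct)
  case (Var v)
  have "(\<Sum>w\<in>W. subst_mp \<phi> (pderiv_mp w (Var v)) * pderiv_mp k (\<phi> w))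
      = (\<Sum>w\<in>W. if w = v then pderiv_mp k (\<phi> w) else 0)"
    by (intro sum.cong) (auto simp: pderiv_Var)
  then show ?case using Var assms(1) by simp
qed (auto simp: pderiv_mult algebra_simps sum.distrib sum_distrib_left)

definition eval_mp :: "(nat \<Rightarrow> complex) \<Rightarrow> mpoly \<Rightarrow> complex" where
  "eval_mp x p = lookup (subst_mp (\<lambda>v. Const (x v)) p) 0"

lemma Const_eval_mp: "Const (eval_mp x p) = subst_mp (\<lambda>v. Const (x v)) p"
proof -
  have "\<exists>c. subst_mp (\<lambda>v. Const (x v)) p = Const c"
  proof -
    have "poly_in UNIV p" by (simp add: poly_in_def)
    then show ?thesis
      by (induction p rule: poly_in_induct) (auto simp flip: Const_add Const_mult)
  qed
  then show ?thesis by (auto simp: eval_mp_def Const_def)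
qed

lemma eval_mp_add [simp]: "eval_mp x (p + q) = eval_mp x p + eval_mp x q"
  and eval_mp_mult [simp]: "eval_mp x (p * q) = eval_mp x p * eval_mp x q"
  and eval_mp_uminus [simp]: "eval_mp x (- p) = - eval_mp x p"
  and eval_mp_diff [simp]: "eval_mp x (p - q) = eval_mp x p - eval_mp x q"
  and eval_mp_Const [simp]: "eval_mp x (Const c) = c"
  and eval_mp_Var [simp]: "eval_mp x (Var v) = x v"
  and eval_mp_power [simp]: "eval_mp x (p ^ k) = eval_mp x p ^ k"
  and eval_mp_0 [simp]: "eval_mp x 0 = 0" and eval_mp_1 [simp]: "eval_mp x 1 = 1"
  by (subst Const_inject[symmetric], simp add: Const_eval_mp Const_add Const_mult Const_uminus
    Const_diff Const_power)+

lemma eval_mp_prod: "eval_mp x (\<Prod>a\<in>A. h a) = (\<Prod>a\<in>A. eval_mp x (h a))"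
  by (induction A rule: infinite_finite_induct) simp_all

lemma eval_mp_sum: "eval_mp x (\<Sum>a\<in>A. h a) = (\<Sum>a\<in>A. eval_mp x (h a))"
  by (induction A rule: infinite_finite_induct) simp_all

section \<open>Differential forms\<close>

lemma sum_fun_apply: "(\<Sum>x\<in>A. h x) y = (\<Sum>x\<in>A. h x (y::'b) :: 'c::comm_monoid_add)"
  by (induction A rule: infinite_finite_induct) simp_all

lemma pmult_apply: "pmult p \<eta> S = p * \<eta> S"
  by (simp add: pmult_def)

lemma cmul_apply: "cmul c \<eta> S = Const c * \<eta> S"
  by (simp add: cmul_def pmult_apply)

lemmas form_apply =
  plus_fun_apply zero_fun_apply sum_fun_apply minus_apply uminus_apply pmult_apply cmul_apply

text \<open>As simplification rules the pointwise equations also fire on unapplied sums of forms,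
  turning them into abstractions.\<close>

declare plus_fun_apply [simp del] zero_fun_apply [simp del] minus_apply [simp del]
  uminus_apply [simp del]

interpretation form_module: module pmult
  by unfold_locales (simp_all add: fun_eq_iff form_apply algebra_simps)

lemmas pmult_simps =
  form_module.scale_right_distrib form_module.scale_left_distrib
  form_module.scale_right_diff_distrib form_module.scale_left_diff_distrib

interpretation form: vector_space_modulo cmul
  by unfold_locales (simp_all add: cmul_def pmult_simps Const_add Const_mult)

interpretation form_pair: vector_space_modulo_pair cmul cmul ..

lemmas cmul_simps =
  form.scale_right_distrib form.scale_left_distrib form.scale_right_diff_distrib
  form.scale_left_diff_distrib

lemma linear_formI:
  "(\<And>\<eta> \<theta>. T (\<eta> + \<theta>) = T \<eta> + T \<theta>) \<Longrightarrow> (\<And>c \<eta>. T (cmul c \<eta>) = cmul c (T \<eta>)) \<Longrightarrow>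
      Vector_Spaces.linear cmul cmul T"
  by unfold_locales auto

subsection \<open>Signs\<close>

lemma finite_inversions [simp]:
  "finite S \<Longrightarrow> finite T \<Longrightarrow> finite {(s, t). s \<in> S \<and> t \<in> T \<and> (t::nat) < s}"
  by (rule finite_subset[of _ "S \<times> T"]) auto

lemma sgn_sets_empty [simp]: "sgn_sets {} T = 1" "sgn_sets S {} = 1"
  by (simp_all add: sgn_sets_def)

lemma sgn_sets_Un_left:
  assumes "finite A" "finite B" "finite T" "A \<inter> B = {}"
  shows "sgn_sets (A \<union> B) T = sgn_sets A T * sgn_sets B T"
proof -
  have "{(s, t). s \<in> A \<union> B \<and> t \<in> T \<and> t < s} =
     {(s, t). s \<in> A \<and> t \<in> T \<and> t < s} \<union> {(s, t). s \<in> B \<and> t \<in> T \<and> t < s}" by auto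
  moreover have "{(s, t). s \<in> A \<and> t \<in> T \<and> t < s} \<inter> {(s, t). s \<in> B \<and> t \<in> T \<and> t < s} = {}"
    using assms(4) by auto
  ultimately show ?thesis
    using assms by (simp add: sgn_sets_def card_Un_disjoint power_add)
qed

lemma sgn_sets_Un_right:
  assumes "finite A" "finite B" "finite S" "A \<inter> B = {}"
  shows "sgn_sets S (A \<union> B) = sgn_sets S A * sgn_sets S B"
proof -
  have "{(s, t). s \<in> S \<and> t \<in> A \<union> B \<and> t < s} =
     {(s, t). s \<in> S \<and> t \<in> A \<and> t < s} \<union> {(s, t). s \<in> S \<and> t \<in> B \<and> t < s}" by auto
  moreover have "{(s, t). s \<in> S \<and> t \<in> A \<and> t < s} \<inter> {(s, t). s \<in> S \<and> t \<in> B \<and> t < s} = {}"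
    using assms(4) by auto
  ultimately show ?thesis
    using assms by (simp add: sgn_sets_def card_Un_disjoint power_add)
qed

lemma sgn_sets_square [simp]: "sgn_sets S T * sgn_sets S T = 1"
  by (simp add: sgn_sets_def flip: power_mult_distrib)

lemma sgn_sets_nonzero [simp]: "sgn_sets S T \<noteq> 0"
  by (simp add: sgn_sets_def)

lemma sgn_sets_singletons: "sgn_sets {k} {l} = (if l < k then -1 else 1)"
proof -
  have "{(s, t). s \<in> {k} \<and> t \<in> {l} \<and> t < s} = (if l < k then {(k, l)} else {})" by auto
  then show ?thesis by (simp add: sgn_sets_def)
qed

lemma sgn_sets_insert_right:
  "finite T \<Longrightarrow> finite S \<Longrightarrow> l \<notin> T \<Longrightarrow> sgn_sets S (insert l T) = sgn_sets S {l} * sgn_sets S T"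
  using sgn_sets_Un_right[of "{l}" T S] by simp

lemma sgn_sets_insert_left:
  "finite T \<Longrightarrow> finite S \<Longrightarrow> l \<notin> S \<Longrightarrow> sgn_sets (insert l S) T = sgn_sets {l} T * sgn_sets S T"
  using sgn_sets_Un_left[of "{l}" S T] by simp

lemma sgn_sets_singleton_swap:
  assumes "finite T" "k \<notin> T" shows "sgn_sets T {k} = (-1) ^ card T * sgn_sets {k} T"
  using assms
proof (induction T)
  case (insert l T)
  then show ?case
    by (auto simp: sgn_sets_insert_left[of "{k}" T l] sgn_sets_insert_right[of T "{k}" l]
      sgn_sets_singletons)
qed simp

lemma sgn_sets_less:
  assumes "\<And>s t. s \<in> S \<Longrightarrow> t \<in> T \<Longrightarrow> s < t" shows "sgn_sets S T = 1"
proof -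
  have "{(s, t). s \<in> S \<and> t \<in> T \<and> t < s} = {}" using assms by (auto dest: less_asym)
  then show ?thesis unfolding sgn_sets_def by (simp only: card.empty power_0)
qed

lemma sgn_sets_image:
  assumes "strict_mono v" shows "sgn_sets (v ` S) (v ` T) = sgn_sets S T"
proof -
  have "{(s, t). s \<in> v ` S \<and> t \<in> v ` T \<and> t < s}
      = (\<lambda>(s,t). (v s, v t)) ` {(s, t). s \<in> S \<and> t \<in> T \<and> t < s}"
    using strict_mono_less[OF assms] by (auto simp: image_iff)
  moreover have "inj_on (\<lambda>(s,t). (v s, v t)) {(s, t). s \<in> S \<and> t \<in> T \<and> t < s}"
    using strict_mono_eq[OF assms] by (auto simp: inj_on_def)
  ultimately show ?thesis by (simp add: sgn_sets_def card_image)
qed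

subsection \<open>The wedge product\<close>

definition dterm :: "nat set \<Rightarrow> mpoly \<Rightarrow> dform" where
  "dterm S p = (\<lambda>U. if U = S then p else 0)"

definition degree_one :: "dform \<Rightarrow> bool" where
  "degree_one w \<longleftrightarrow> (\<forall>U. w U \<noteq> 0 \<longrightarrow> (\<exists>k. U = {k}))"

definition grade_involution :: "dform \<Rightarrow> dform" where
  "grade_involution \<eta> = (\<lambda>S. (-1) ^ card S * \<eta> S)"

lemma grade_involution_involutive [simp]: "grade_involution (grade_involution \<eta>) = \<eta>"
  by (auto simp: grade_involution_def fun_eq_iff form_apply)

lemma pmult_dterm [simp]: "pmult p (dterm S q) = dterm S (p * q)"
  by (auto simp: dterm_def fun_eq_iff form_apply)

lemma cmul_dterm [simp]: "cmul c (dterm S q) = dterm S (Const c * q)"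
  by (simp add: cmul_def)

interpretation dterm: Vector_Spaces.linear "\<lambda>c p. Const c * p" cmul "dterm S" for S
  by unfold_locales (auto simp: dterm_def fun_eq_iff form_apply)

lemma one_form_dterm: "one_form = dterm {} 1"
  by (simp add: one_form_def dterm_def)

lemma wedge_simps:
  "wedge (a + b) c = wedge a c + wedge b c" "wedge (a - b) c = wedge a c - wedge b c"
  "wedge a (b + c) = wedge a b + wedge a c" "wedge a (b - c) = wedge a b - wedge a c"
  "wedge 0 a = 0" "wedge a 0 = 0" "wedge (- a) b = - wedge a b" "wedge a (- b) = - wedge a b"
  by (auto simp: wedge_def fun_eq_iff form_apply algebra_simps sum.distrib sum_subtractf sum_negf)

lemma wedge_pmult [simp]:
  "wedge (pmult p a) b = pmult p (wedge a b)" "wedge a (pmult p b) = pmult p (wedge a b)"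
  by (auto simp: wedge_def fun_eq_iff form_apply sum_distrib_left ac_simps)

lemma wedge_cmul [simp]:
  "wedge (cmul c a) b = cmul c (wedge a b)" "wedge a (cmul c b) = cmul c (wedge a b)"
  by (simp_all add: cmul_def)

lemma wedge_sum_left: "wedge (\<Sum>x\<in>A. h x) a = (\<Sum>x\<in>A. wedge (h x) a)"
  by (induction A rule: infinite_finite_induct) (simp_all add: wedge_simps)

lemma wedge_sum_right: "wedge a (\<Sum>x\<in>A. h x) = (\<Sum>x\<in>A. wedge a (h x))"
  by (induction A rule: infinite_finite_induct) (simp_all add: wedge_simps)

lemma wedge_apply_cong:
  assumes "\<And>S. S \<subseteq> U \<Longrightarrow> a S = a' S" "\<And>S. S \<subseteq> U \<Longrightarrow> b S = b' S"
  shows "wedge a b U = wedge a' b' U"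
  unfolding wedge_def using assms by (auto intro!: sum.cong)

lemma wedge_infinite [simp]: "infinite U \<Longrightarrow> wedge a b U = 0"
  by (simp add: wedge_def)

lemma wedge_assoc: "wedge (wedge a b) c = wedge a (wedge b c)"
proof
  fix U
  show "wedge (wedge a b) c U = wedge a (wedge b c) U"
  proof (cases "finite U")
    case fin: True
    have finS: "finite S" if "S \<subseteq> U" for S using that fin finite_subset by blast
    let ?f = "\<lambda>S R. Const (sgn_sets S (U - S)) * Const (sgn_sets R (S - R)) * a R * b (S - R)
        * c (U - S)"
    let ?g = "\<lambda>R B. Const (sgn_sets R (U - R)) * Const (sgn_sets B (U - R - B)) * a R * b B
        * c (U - R - B)"
    have "wedge (wedge a b) c U = (\<Sum>S\<in>Pow U. \<Sum>R\<in>Pow S. ?f S R)"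
      using fin finS by (auto simp: wedge_def sum_distrib_left sum_distrib_right ac_simps
        intro!: sum.cong)
    also have "\<dots> = (\<Sum>(S,R)\<in>Sigma (Pow U) Pow. ?f S R)"
      using fin finS by (subst sum.Sigma) auto
    also have "\<dots> = (\<Sum>(R,B)\<in>Sigma (Pow U) (\<lambda>R. Pow (U - R)). ?g R B)"
    proof (rule sum.reindex_bij_witness[where i = "\<lambda>(R,B). (R \<union> B, R)" and j = "\<lambda>(S,R). (R, S - R)"],
      goal_cases)
      case (5 x)
      then obtain S R where x: "x = (S, R)" "S \<subseteq> U" "R \<subseteq> S" by auto
      define B C where "B = S - R" and "C = U - S"
      have fins: "finite R" "finite B" "finite C" using x finS fin by (auto simp: B_def C_def)
      have eqs: "S = R \<union> B" "U - R = B \<union> C" "U - R - B = C" "R \<inter> B = {}" "B \<inter> C = {}" "S - R = B"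
        "U - S = C" using x by (auto simp: B_def C_def)
      have "sgn_sets S C * sgn_sets R B = sgn_sets R (U - R) * sgn_sets B C"
        using eqs fins by (simp add: sgn_sets_Un_left sgn_sets_Un_right)
      then have "Const (sgn_sets S C) * Const (sgn_sets R B)
          = Const (sgn_sets R (U - R)) * Const (sgn_sets B C)"
        by (simp flip: Const_mult)
      then show ?case using x eqs by simp
    qed auto
    also have "\<dots> = (\<Sum>R\<in>Pow U. \<Sum>B\<in>Pow (U - R). ?g R B)"
      using fin by (subst sum.Sigma) auto
    also have "\<dots> = wedge a (wedge b c) U"
      using fin by (auto simp: wedge_def sum_distrib_left sum_distrib_right ac_simps intro!: sum.cong)
    finally show ?thesis .
  qed simp
qed

lemma wedge_dterm_left:
  assumes "finite U"
  shows "wedge (dterm S p) b U = (if S \<subseteq> U then Const (sgn_sets S (U - S)) * p * b (U - S) else 0)"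
proof -
  have "wedge (dterm S p) b U
      = (\<Sum>R\<in>Pow U. if R = S then Const (sgn_sets S (U - S)) * p * b (U - S) else 0)"
    unfolding wedge_def dterm_def using assms by (simp only: if_True, intro sum.cong) auto
  then show ?thesis using assms by simp
qed

lemma wedge_dterm:
  assumes "finite S" "finite T" "S \<inter> T = {}"
  shows "wedge (dterm S p) (dterm T q) = dterm (S \<union> T) (Const (sgn_sets S T) * p * q)"
proof
  fix U show "wedge (dterm S p) (dterm T q) U = dterm (S \<union> T) (Const (sgn_sets S T) * p * q) U"
  proof (cases "finite U")
    case True
    moreover have "S \<subseteq> U \<and> U - S = T \<longleftrightarrow> U = S \<union> T" using assms by auto
    ultimately have "wedge (dterm S p) (dterm T q) U
        = (if U = S \<union> T then Const (sgn_sets S (U - S)) * p * q else 0)"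
      unfolding wedge_dterm_left[OF \<open>finite U\<close>] by (auto simp: dterm_def)
    moreover have "U = S \<union> T \<Longrightarrow> U - S = T" using assms by auto
    ultimately show ?thesis by (auto simp: dterm_def)
  qed (use assms in \<open>auto simp: dterm_def\<close>)
qed

lemma wedge_dterm_not_disjoint:
  assumes "S \<inter> T \<noteq> {}"
  shows "wedge (dterm S p) (dterm T q) = 0"
proof
  fix U show "wedge (dterm S p) (dterm T q) U = 0 U"
  proof (cases "finite U")
    case True
    have "S \<subseteq> U \<Longrightarrow> U - S \<noteq> T" using assms by auto
    then show ?thesis unfolding wedge_dterm_left[OF True] by (simp add: dterm_def form_apply)
  qed (simp add: form_apply)
qed

lemma degree_one_simps [simp]: "degree_one (dterm {k} p)" "degree_one (dpoly g)" "degree_one 0"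
  by (auto simp: form_apply degree_one_def dterm_def dpoly_def card_1_singleton_iff)

lemma wedge_degree_one_left:
  assumes "degree_one w" "finite U"
  shows "wedge w b U = (\<Sum>k\<in>U. Const (sgn_sets {k} (U - {k})) * w {k} * b (U - {k}))"
proof -
  have "wedge w b U = (\<Sum>S\<in>(\<lambda>k. {k}) ` U. Const (sgn_sets S (U - S)) * w S * b (U - S))"
    unfolding wedge_def using assms
    by (simp, intro sum.mono_neutral_right) (auto simp: degree_one_def image_iff)
  also have "\<dots> = (\<Sum>k\<in>U. Const (sgn_sets {k} (U - {k})) * w {k} * b (U - {k}))"
    by (subst sum.reindex) (auto simp: inj_on_def)
  finally show ?thesis .
qed

lemma wedge_degree_one_right:
  assumes "degree_one w" "finite U"
  shows "wedge b w U = (\<Sum>k\<in>U. Const (sgn_sets (U - {k}) {k}) * b (U - {k}) * w {k})"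
proof -
  have "wedge b w U = (\<Sum>S\<in>(\<lambda>k. U - {k}) ` U. Const (sgn_sets S (U - S)) * b S * w (U - S))"
    unfolding wedge_def using assms
  proof (simp, intro sum.mono_neutral_right ballI)
    fix S assume S: "S \<in> Pow U - (\<lambda>k. U - {k}) ` U"
    have "w (U - S) = 0"
    proof (rule ccontr)
      assume "w (U - S) \<noteq> 0"
      then obtain k where "U - S = {k}" using assms by (auto simp: degree_one_def)
      then have "S = U - {k}" "k \<in> U" using S by auto
      then show False using S by auto
    qed
    then show "Const (sgn_sets S (U - S)) * b S * w (U - S) = 0" by simp
  qed auto
  also have "\<dots> = (\<Sum>k\<in>U. Const (sgn_sets (U - {k}) {k}) * b (U - {k}) * w {k})"
  proof (subst sum.reindex)
    have "U - (U - {k}) = {k}" if "k \<in> U" for k using that by auto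
    then show "sum ((\<lambda>S. Const (sgn_sets S (U - S)) * b S * w (U - S)) \<circ> (\<lambda>k. U - {k})) U
       = (\<Sum>k\<in>U. Const (sgn_sets (U - {k}) {k}) * b (U - {k}) * w {k})"
      by (intro sum.cong) simp_all
  qed (auto simp: inj_on_def)
  finally show ?thesis .
qed

lemma wedge_degree_one_commute:
  assumes "degree_one w" shows "wedge b w = wedge w (grade_involution b)"
proof
  fix U show "wedge b w U = wedge w (grade_involution b) U"
  proof (cases "finite U")
    case True
    have "Const (sgn_sets (U - {k}) {k}) = Const (sgn_sets {k} (U - {k})) * (- 1) ^ card (U - {k})"
      for k
      using True by (simp add: sgn_sets_singleton_swap Const_mult Const_power Const_uminus)
    then show ?thesis using True assms
      by (simp add: wedge_degree_one_left wedge_degree_one_right grade_involution_def ac_simps)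
  qed simp
qed

lemma grade_involution_degree_one: "degree_one w \<Longrightarrow> grade_involution w = - w"
proof
  fix U assume "degree_one w"
  then have "w U = 0 \<or> (\<exists>k. U = {k})" by (auto simp: degree_one_def)
  then show "grade_involution w U = (- w) U" by (auto simp: grade_involution_def form_apply)
qed

lemma wedge_degree_one_anticommute:
  "degree_one a \<Longrightarrow> degree_one b \<Longrightarrow> wedge a b = - wedge b a"
  by (simp add: wedge_degree_one_commute[of b a] grade_involution_degree_one wedge_simps)

lemma wedge_degree_one_self:
  assumes "degree_one a"
  shows "wedge a a = 0"
proof -
  have "wedge a a = - wedge a a"
    using assms by (intro wedge_degree_one_anticommute)
  then have "wedge a a S = - wedge a a S" for S by (metis uminus_apply)
  then show ?thesis by (auto simp: fun_eq_iff form_apply)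
qed

subsection \<open>The exterior derivative\<close>

definition pderiv_form :: "nat \<Rightarrow> dform \<Rightarrow> dform" where
  "pderiv_form k \<eta> = (\<lambda>S. pderiv_mp k (\<eta> S))"

lemma ext_d_wedge_sum:
  assumes "finite V" "U \<subseteq> V"
  shows "ext_d \<eta> U = (\<Sum>k\<in>V. wedge (dterm {k} 1) (pderiv_form k \<eta>)) U"
proof -
  have U: "finite U" using assms finite_subset by blast
  have "(\<Sum>k\<in>V. wedge (dterm {k} 1) (pderiv_form k \<eta>)) U
      = (\<Sum>k\<in>U. wedge (dterm {k} 1) (pderiv_form k \<eta>) U)"
    using assms U by (simp add: form_apply, intro sum.mono_neutral_right) (auto simp: wedge_dterm_left)
  then show ?thesis using U by (simp add: ext_d_def wedge_dterm_left pderiv_form_def)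
qed

lemma pderiv_form_wedge:
  "pderiv_form k (wedge a b) = wedge (pderiv_form k a) b + wedge a (pderiv_form k b)"
  by (auto simp: fun_eq_iff form_apply pderiv_form_def wedge_def pderiv_sum pderiv_mult algebra_simps
    sum.distrib intro!: sum.cong)

lemma ext_d_infinite [simp]: "infinite U \<Longrightarrow> ext_d a U = 0"
  by (simp add: ext_d_def)

lemma ext_d_wedge: "ext_d (wedge a b) = wedge (ext_d a) b + wedge (grade_involution a) (ext_d b)"
proof
  fix U show "ext_d (wedge a b) U = (wedge (ext_d a) b + wedge (grade_involution a) (ext_d b)) U"
  proof (cases "finite U")
    case True
    let ?d = "\<lambda>k. dterm {k} 1"
    have comm: "wedge (?d k) c = wedge (grade_involution c) (?d k)" for k c
      using wedge_degree_one_commute[of "?d k" "grade_involution c"] by simp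
    have "ext_d (wedge a b) U = (\<Sum>k\<in>U. wedge (wedge (?d k) (pderiv_form k a)) b
        + wedge (wedge (?d k) a) (pderiv_form k b)) U"
      using True by (simp add: ext_d_wedge_sum[of U U] pderiv_form_wedge wedge_simps wedge_assoc
        form_apply)
    also have "\<dots> = wedge (\<Sum>k\<in>U. wedge (?d k) (pderiv_form k a)) b U
        + wedge (grade_involution a) (\<Sum>k\<in>U. wedge (?d k) (pderiv_form k b)) U"
      by (simp add: comm[of _ a] wedge_assoc wedge_sum_left wedge_sum_right sum.distrib form_apply)
    also have "wedge (\<Sum>k\<in>U. wedge (?d k) (pderiv_form k a)) b U = wedge (ext_d a) b U"
      by (rule wedge_apply_cong) (simp_all only: ext_d_wedge_sum[OF True])
    also have "wedge (grade_involution a) (\<Sum>k\<in>U. wedge (?d k) (pderiv_form k b)) U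
        = wedge (grade_involution a) (ext_d b) U"
      by (rule wedge_apply_cong) (simp_all only: ext_d_wedge_sum[OF True])
    finally show ?thesis by (simp add: form_apply)
  qed (simp add: form_apply)
qed

interpretation ext_d: Vector_Spaces.linear cmul cmul ext_d
  by (rule linear_formI) (auto simp: ext_d_def fun_eq_iff form_apply algebra_simps sum.distrib
    sum_distrib_left)

lemma dpoly_singleton [simp]: "dpoly g {k} = pderiv_mp k g"
  by (simp add: dpoly_def)

lemma ext_d_pmult: "ext_d (pmult p a) = wedge (dpoly p) a + pmult p (ext_d a)"
proof
  fix U show "ext_d (pmult p a) U = (wedge (dpoly p) a + pmult p (ext_d a)) U"
    by (cases "finite U")
       (auto simp: form_apply ext_d_def wedge_degree_one_left pderiv_mult algebra_simps sum.distrib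
         sum_distrib_left)
qed

lemma dpoly_simps:
  "dpoly (p + q) = dpoly p + dpoly q" "dpoly (p - q) = dpoly p - dpoly q" "dpoly (- p) = - dpoly p"
  "dpoly (p * q) = pmult p (dpoly q) + pmult q (dpoly p)" "dpoly (Const c) = 0" "dpoly 0 = 0"
  "dpoly 1 = 0"
  by (auto simp: dpoly_def fun_eq_iff form_apply pderiv_mult algebra_simps)

lemma dpoly_power: "dpoly (p ^ e) = pmult (of_nat e * p ^ (e - 1)) (dpoly p)"
  by (auto simp: dpoly_def fun_eq_iff form_apply pderiv_power)

lemma dpoly_Var: "dpoly (Var v) = dterm {v} 1"
  by (auto simp: dpoly_def fun_eq_iff form_apply dterm_def pderiv_Var card_1_singleton_iff)

lemma ext_d_dpoly: "ext_d (dpoly g) = 0"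
proof
  fix U show "ext_d (dpoly g) U = 0 U"
  proof (cases "\<exists>k l. k < l \<and> U = {k, l}")
    case True
    then obtain k l where "k < l" and U: "U = {k, l}" by auto
    moreover from this have "{k, l} - {k} = {l}" "{k, l} - {l} = {k}" by auto
    ultimately show ?thesis
      by (simp add: form_apply ext_d_def sgn_sets_singletons Const_uminus pderiv_commute[of k l])
  next
    case False
    have "card (U - {k}) \<noteq> 1" if "k \<in> U" for k
    proof
      assume "card (U - {k}) = 1"
      then obtain l where "U - {k} = {l}" by (auto simp: card_1_singleton_iff)
      then have "U = {k, l}" "k \<noteq> l" using that by auto
      then show False using False by (metis insert_commute linorder_neqE_nat)
    qed
    then show ?thesis by (simp add: form_apply ext_d_def dpoly_def)
  qed
qed

lemma ext_d_dpoly_wedge: "ext_d (wedge (dpoly g) b) = wedge (dpoly g) (- ext_d b)"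
  by (simp add: ext_d_wedge ext_d_dpoly grade_involution_degree_one wedge_simps)

lemma ext_d_dterm_one [simp]: "ext_d (dterm S 1) = 0"
  by (auto simp: ext_d_def dterm_def fun_eq_iff form_apply intro!: sum.neutral)

lemma ext_d_dterm: "ext_d (dterm S p) = wedge (dpoly p) (dterm S 1)"
  using ext_d_pmult[of p "dterm S 1"] by (simp add: pmult_simps)

lemma wedge_degree_one_one: "degree_one w \<Longrightarrow> wedge w one_form = w"
proof
  fix U assume w: "degree_one w"
  show "wedge w one_form U = w U"
  proof (cases "\<exists>k. U = {k}")
    case True then show ?thesis using w by (auto simp: wedge_degree_one_left one_form_def)
  next
    case False
    then have "U - {k} \<noteq> {}" if "k \<in> U" for k using that by auto
    moreover have "w U = 0" using False w by (auto simp: degree_one_def)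
    ultimately show ?thesis using w
      by (cases "finite U") (auto simp: wedge_degree_one_left one_form_def)
  qed
qed

lemma dpoly_prod:
  "finite A \<Longrightarrow> dpoly (\<Prod>x\<in>A. h x) = (\<Sum>x\<in>A. pmult (\<Prod>y\<in>A - {x}. h y) (dpoly (h x)))"
proof (induction A rule: finite_induct)
  case (insert a A)
  have "(\<Sum>x\<in>A. pmult (\<Prod>y\<in>insert a A - {x}. h y) (dpoly (h x))) =
     (\<Sum>x\<in>A. pmult (h a) (pmult (\<Prod>y\<in>A - {x}. h y) (dpoly (h x))))"
  proof (rule sum.cong[OF refl])
    fix x assume "x \<in> A"
    then have "insert a A - {x} = insert a (A - {x})" "a \<notin> A - {x}" using insert by auto
    then show "pmult (\<Prod>y\<in>insert a A - {x}. h y) (dpoly (h x))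
        = pmult (h a) (pmult (\<Prod>y\<in>A - {x}. h y) (dpoly (h x)))"
      using insert by (simp add: pmult_simps)
  qed
  moreover have "insert a A - {a} = A" using insert by auto
  ultimately show ?case using insert by (simp add: dpoly_simps form_module.scale_sum_right)
qed (simp add: dpoly_simps)

lemma dpoly_ext_d: "dpoly p = ext_d (dterm {} p)"
proof -
  have "wedge (dpoly p) one_form = dpoly p" by (rule wedge_degree_one_one) simp
  then show ?thesis by (simp add: ext_d_dterm one_form_dterm)
qed

lemma dpoly_Var_power: "dpoly (Var k ^ e) = dterm {k} (of_nat e * Var k ^ (e - 1))"
  by (simp add: dpoly_power dpoly_Var)

lemma dform_eq_sum_dterm:
  assumes "finite W" "\<And>S. \<not> S \<subseteq> W \<Longrightarrow> \<eta> S = 0"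
  shows "\<eta> = (\<Sum>S\<in>Pow W. dterm S (\<eta> S))"
proof
  fix U
  have "(\<Sum>S\<in>Pow W. dterm S (\<eta> S)) U = (\<Sum>S\<in>Pow W. if S = U then \<eta> U else 0)"
    unfolding form_apply by (intro sum.cong) (auto simp: dterm_def)
  then show "\<eta> U = (\<Sum>S\<in>Pow W. dterm S (\<eta> S)) U" using assms by auto
qed

section \<open>Relations and exact forms\<close>

text \<open>The relations of \<^term>\<open>rel_forms\<close> without constraints on degree and variables;
  \<open>rels_rel_forms\<close> shows that for homogeneous forms they can be restored.\<close>

definition rels :: "mpoly set \<Rightarrow> dform set" where
  "rels G = form_module.span ((\<Union>g\<in>G. range (pmult g)) \<union> (\<Union>g\<in>G. range (wedge (dpoly g))))"

definition exacts :: "mpoly set \<Rightarrow> dform set" where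
  "exacts G = {\<eta>. \<exists>\<theta>. \<eta> - ext_d \<theta> \<in> rels G}"

lemma pmult_in_rels: "g \<in> G \<Longrightarrow> pmult g \<eta> \<in> rels G"
  unfolding rels_def by (rule form_module.span_base) blast

lemma dpoly_wedge_in_rels: "g \<in> G \<Longrightarrow> wedge (dpoly g) \<eta> \<in> rels G"
  unfolding rels_def by (rule form_module.span_base) blast

lemma rels_pmult: "\<eta> \<in> rels G \<Longrightarrow> pmult p \<eta> \<in> rels G"
  unfolding rels_def by (rule form_module.span_scale)

lemma subspace_rels: "form.subspace (rels G)"
  unfolding rels_def cmul_def
  by (intro form.subspaceI[unfolded cmul_def] form_module.span_zero form_module.span_add
    form_module.span_scale)

lemmas rels_0 [simp] = form.subspace_0[OF subspace_rels]
lemmas rels_add = form.subspace_add[OF subspace_rels]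
lemmas rels_diff = form.subspace_diff[OF subspace_rels]
lemmas rels_neg = form.subspace_neg[OF subspace_rels]
lemmas rels_cmul = form.subspace_scale[OF subspace_rels]
lemmas rels_sum = form.subspace_sum[OF subspace_rels]

lemma rels_induct [consumes 1, case_names zero pmult dpoly_wedge add]:
  assumes "\<eta> \<in> rels G" "P 0" "\<And>g \<theta>. g \<in> G \<Longrightarrow> P (pmult g \<theta>)" "\<And>g \<theta>. g \<in> G \<Longrightarrow> P (wedge (dpoly g) \<theta>)"
    and "\<And>\<eta> \<theta>. P \<eta> \<Longrightarrow> P \<theta> \<Longrightarrow> P (\<eta> + \<theta>)"
  shows "P \<eta>"
  using assms(1) unfolding rels_def
proof (induction rule: form_module.span_induct_alt)
  case (step c x y)
  have "P (pmult c x)"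
    using step.hyps assms(3)[of _ "pmult c _"] assms(4)[of _ "pmult c _"] by (auto simp: mult.commute)
  then show ?case by (rule assms(5)) (rule step.IH)
qed (rule assms(2))

lemma rels_finiteE:
  assumes "finite G" "\<eta> \<in> rels G"
  obtains a b where "\<eta> = (\<Sum>g\<in>G. pmult g (a g) + wedge (dpoly g) (b g))"
proof -
  let ?\<Sigma> = "\<lambda>a b. \<Sum>g\<in>G. pmult g (a g) + wedge (dpoly g) (b g)"
  have "\<exists>a b. \<eta> = ?\<Sigma> a b"
    using assms(2)
  proof (induction rule: rels_induct)
    case zero
    show ?case
      by (intro exI[of _ "\<lambda>_. 0"]) (simp add: wedge_simps)
  next
    case (pmult g \<theta>)
    have "?\<Sigma> (\<lambda>h. if h = g then \<theta> else 0) (\<lambda>_. 0) = (\<Sum>h\<in>G. if h = g then pmult g \<theta> else 0)"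
      by (intro sum.cong) (auto simp: wedge_simps)
    also have "\<dots> = pmult g \<theta>"
      using assms(1) pmult by simp
    finally show ?case by (intro exI) (rule sym)
  next
    case (dpoly_wedge g \<theta>)
    have "?\<Sigma> (\<lambda>_. 0) (\<lambda>h. if h = g then \<theta> else 0) = (\<Sum>h\<in>G. if h = g then wedge (dpoly g) \<theta> else 0)"
      by (intro sum.cong) (auto simp: wedge_simps)
    also have "\<dots> = wedge (dpoly g) \<theta>"
      using assms(1) dpoly_wedge by simp
    finally show ?case by (intro exI) (rule sym)
  next
    case (add \<eta> \<theta>)
    then obtain a b a' b' where ab: "\<eta> = ?\<Sigma> a b" "\<theta> = ?\<Sigma> a' b'" by blast
    have "\<eta> + \<theta> = ?\<Sigma> (\<lambda>g. a g + a' g) (\<lambda>g. b g + b' g)"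
      unfolding ab by (simp add: pmult_simps wedge_simps sum.distrib algebra_simps)
    then show ?case by (intro exI)
  qed
  with that show thesis by blast
qed

lemma rels_wedge_right: "\<eta> \<in> rels G \<Longrightarrow> wedge \<eta> \<theta> \<in> rels G"
  by (induction rule: rels_induct)
    (auto simp: wedge_simps wedge_assoc intro: rels_add pmult_in_rels dpoly_wedge_in_rels)

lemma rels_wedge_left: "\<eta> \<in> rels G \<Longrightarrow> wedge \<theta> \<eta> \<in> rels G"
proof (induction rule: rels_induct)
  case (dpoly_wedge g \<eta>)
  have "wedge \<theta> (wedge (dpoly g) \<eta>) = wedge (dpoly g) (wedge (grade_involution \<theta>) \<eta>)"
    by (simp add: wedge_degree_one_commute[of "dpoly g" \<theta>] flip: wedge_assoc)
  with dpoly_wedge show ?case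
    by (simp add: dpoly_wedge_in_rels)
qed (auto simp: wedge_simps intro: rels_add pmult_in_rels)

lemma rels_ext_d: "\<eta> \<in> rels G \<Longrightarrow> ext_d \<eta> \<in> rels G"
  by (induction rule: rels_induct)
    (auto simp: ext_d.add ext_d_pmult ext_d_dpoly_wedge intro: rels_add pmult_in_rels
      dpoly_wedge_in_rels)

lemma rels_ideal: "p \<in> ideal G \<Longrightarrow> pmult p \<theta> \<in> rels G"
proof (induction rule: mpoly_ring.span_induct_alt)
  case (step c g p)
  have "pmult (c * g + p) \<theta> = pmult g (pmult c \<theta>) + pmult p \<theta>"
    by (simp add: pmult_simps mult.commute)
  with step show ?case
    by (simp add: rels_add pmult_in_rels del: form_module.scale_scale)
qed simp

lemma rels_dpoly_ideal: "p \<in> ideal G \<Longrightarrow> dpoly p \<in> rels G"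
proof (induction rule: mpoly_ring.span_induct_alt)
  case (step c g p)
  have "dpoly g \<in> rels G"
    using dpoly_wedge_in_rels[OF step.hyps, of one_form] by (simp add: wedge_degree_one_one)
  with step show ?case
    by (simp add: dpoly_simps rels_add rels_pmult pmult_in_rels)
qed (simp add: dpoly_simps)

lemma rels_dterm_ideal: "p - q \<in> ideal G \<Longrightarrow> dterm S p - dterm S q \<in> rels G"
  using rels_ideal[of "p - q" G "dterm S 1"] by (simp add: dterm.diff)

lemma exactsI: "\<eta> - ext_d \<theta> \<in> rels G \<Longrightarrow> \<eta> \<in> exacts G"
  by (auto simp: exacts_def)

lemma rels_exacts: "\<eta> \<in> rels G \<Longrightarrow> \<eta> \<in> exacts G"
  by (rule exactsI[of _ 0]) simp

lemma subspace_exacts: "form.subspace (exacts G)"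
proof (rule form.subspaceI)
  show "\<eta> + \<eta>' \<in> exacts G" if "\<eta> \<in> exacts G" "\<eta>' \<in> exacts G" for \<eta> \<eta>'
  proof -
    obtain \<theta> \<theta>' where "\<eta> - ext_d \<theta> \<in> rels G" "\<eta>' - ext_d \<theta>' \<in> rels G"
      using \<open>\<eta> \<in> exacts G\<close> \<open>\<eta>' \<in> exacts G\<close> by (auto simp: exacts_def)
    from rels_add[OF this] show ?thesis
      by (intro exactsI[of _ "\<theta> + \<theta>'"]) (simp add: ext_d.add algebra_simps)
  qed
  show "cmul c \<eta> \<in> exacts G" if "\<eta> \<in> exacts G" for c \<eta>
  proof -
    obtain \<theta> where "\<eta> - ext_d \<theta> \<in> rels G"
      using \<open>\<eta> \<in> exacts G\<close> by (auto simp: exacts_def)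
    from rels_cmul[OF this, of c] show ?thesis
      by (intro exactsI[of _ "cmul c \<theta>"]) (simp add: ext_d.scale cmul_simps)
  qed
qed (simp add: rels_exacts)

section \<open>Gradings of the algebra of forms\<close>

type_synonym term_pred = "(nat \<Rightarrow>\<^sub>0 nat) \<Rightarrow> nat set \<Rightarrow> bool"

definition poly_filter :: "((nat \<Rightarrow>\<^sub>0 nat) \<Rightarrow> bool) \<Rightarrow> mpoly \<Rightarrow> mpoly" where
  "poly_filter R p = Poly_Mapping.mapp (\<lambda>m c. if R m then c else 0) p"

definition form_filter :: "term_pred \<Rightarrow> dform \<Rightarrow> dform" where
  "form_filter Q \<eta> = (\<lambda>S. poly_filter (\<lambda>m. Q m S) (\<eta> S))"

definition form_supp :: "term_pred \<Rightarrow> dform \<Rightarrow> bool" where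
  "form_supp Q \<eta> \<longleftrightarrow> (\<forall>S. poly_supp (\<lambda>m. Q m S) (\<eta> S))"

lemma lookup_poly_filter: "lookup (poly_filter R p) m = (if R m then lookup p m else 0)"
  by (auto simp: poly_filter_def lookup_mapp when_def in_keys_iff)

lemma poly_filter_add [simp]: "poly_filter R (p + q) = poly_filter R p + poly_filter R q"
  by (rule poly_mapping_eqI) (simp add: lookup_poly_filter lookup_add)

lemma poly_filter_0 [simp]: "poly_filter R 0 = 0"
  by (rule poly_mapping_eqI) (simp add: lookup_poly_filter)

lemma poly_filter_sum: "poly_filter R (\<Sum>x\<in>A. h x) = (\<Sum>x\<in>A. poly_filter R (h x))"
  by (induction A rule: infinite_finite_induct) simp_all

lemma poly_filter_Const_mult [simp]: "poly_filter R (Const c * p) = Const c * poly_filter R p"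
  by (rule poly_mapping_eqI) (simp add: lookup_poly_filter)

lemma poly_filter_single: "poly_filter R (single m c) = (if R m then single m c else 0)"
  by (rule poly_mapping_eqI) (auto simp: lookup_poly_filter lookup_single when_def)

lemma poly_filter_mult:
  assumes "\<And>m0 m. m0 \<in> keys g \<Longrightarrow> R (m0 + m) = R' m"
  shows "poly_filter R (g * p) = g * poly_filter R' p"
proof -
  have "poly_filter R (single m0 c * p) = single m0 c * poly_filter R' p" if "m0 \<in> keys g" for m0 c
    using assms[OF that]
    by (induction p rule: mpoly_induct) (auto simp: mult_single poly_filter_single algebra_simps)
  then have "poly_filter R ((\<Sum>m\<in>keys g. single m (lookup g m)) * p)
      = (\<Sum>m\<in>keys g. single m (lookup g m)) * poly_filter R' p"
    by (simp add: sum_distrib_right poly_filter_sum)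
  then show ?thesis by (simp add: mpoly_sum_monomials)
qed

lemma poly_filter_pderiv:
  assumes "\<And>m. R m = R' (m + single k 1)"
  shows "poly_filter R (pderiv_mp k p) = pderiv_mp k (poly_filter R' p)"
  by (rule poly_mapping_eqI) (simp add: lookup_poly_filter lookup_pderiv assms)

interpretation form_filter: Vector_Spaces.linear cmul cmul "form_filter Q" for Q
  by (rule linear_formI) (auto simp: form_filter_def fun_eq_iff form_apply)

lemma form_filter_supp: "form_supp Q \<eta> \<Longrightarrow> form_filter Q \<eta> = \<eta>"
  by (auto simp: form_filter_def fun_eq_iff form_supp_def poly_supp_def lookup_poly_filter
    intro!: poly_mapping_eqI)
    (metis in_keys_iff)

lemma form_filter_disjoint: "form_supp Q \<eta> \<Longrightarrow> (\<And>m S. Q m S \<Longrightarrow> \<not> Q' m S) \<Longrightarrow> form_filter Q' \<eta> = 0"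
  by (auto simp: form_filter_def fun_eq_iff form_apply form_supp_def poly_supp_def lookup_poly_filter
    intro!: poly_mapping_eqI)
    (metis in_keys_iff)

lemma form_supp_filter: "form_supp Q (form_filter Q \<eta>)"
  by (auto simp: form_supp_def poly_supp_def form_filter_def in_keys_iff lookup_poly_filter
    split: if_splits)

lemma form_supp_mono: "form_supp Q \<eta> \<Longrightarrow> (\<And>m S. Q m S \<Longrightarrow> Q' m S) \<Longrightarrow> form_supp Q' \<eta>"
  by (auto simp: form_supp_def poly_supp_def)

lemma subspace_form_supp: "form.subspace {\<eta>. form_supp Q \<eta>}"
  by (intro form.subspaceI) (auto simp: form_supp_def form_apply intro: poly_supp_add
    poly_supp_Const_mult)

lemma form_supp_dterm: "form_supp Q (dterm S p) \<longleftrightarrow> poly_supp (\<lambda>m. Q m S) p"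
  by (auto simp: form_supp_def dterm_def)

lemma form_supp_wedge:
  assumes "form_supp Q a" "form_supp Q' b"
    and Q'': "\<And>m m' S T. Q m S \<Longrightarrow> Q' m' T \<Longrightarrow> finite S \<Longrightarrow> finite T \<Longrightarrow> S \<inter> T = {} \<Longrightarrow> Q'' (m + m') (S \<union> T)"
  shows "form_supp Q'' (wedge a b)"
  unfolding form_supp_def
proof
  fix U
  show "poly_supp (\<lambda>m. Q'' m U) (wedge a b U)"
  proof (cases "finite U")
    case True
    have "poly_supp (\<lambda>m. Q'' m U) (a S * b (U - S))" if "S \<subseteq> U" for S
    proof (rule poly_supp_mult)
      show "poly_supp (\<lambda>m. Q m S) (a S)" "poly_supp (\<lambda>m. Q' m (U - S)) (b (U - S))"
        using assms by (auto simp: form_supp_def)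
      fix m m' assume "Q m S" "Q' m' (U - S)"
      moreover have "finite S" "finite (U - S)" "S \<union> (U - S) = U"
        using True \<open>S \<subseteq> U\<close> finite_subset by auto
      ultimately show "Q'' (m + m') U"
        using Q''[of m S m' "U - S"] by (simp add: Diff_disjoint)
    qed
    with True show ?thesis
      by (auto simp: wedge_def mult.assoc intro!: poly_supp_sum poly_supp_Const_mult)
  qed simp
qed

text \<open>The terms \<open>m dx\<^sub>S\<close> in \<open>Q q\<close> play the role of the degree-\<open>q\<close> part of a grading in which \<open>x\<^sub>k\<close>
  can be traded for \<open>dx\<^sub>k\<close> at the cost of one degree, and in which the elements of \<open>G\<close> have degree \<open>0\<close>.\<close>

definition grading :: "mpoly set \<Rightarrow> (int \<Rightarrow> term_pred) \<Rightarrow> bool" where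
  "grading G Q \<longleftrightarrow>
     (\<forall>q m S k. finite S \<longrightarrow> k \<notin> S \<longrightarrow> Q q m (insert k S) = Q (q - 1) (m + single k 1) S) \<and>
     (\<forall>g\<in>G. \<forall>m0\<in>keys g. \<forall>q m S. Q q (m0 + m) S = Q q m S)"

lemma grading_remove:
  assumes "grading G Q" "finite U" "k \<in> U"
  shows "Q q m U = Q (q - 1) (m + single k 1) (U - {k})"
proof -
  have "finite (U - {k})" "k \<notin> U - {k}"
    using assms(2) by auto
  then have "Q q m (insert k (U - {k})) = Q (q - 1) (m + single k 1) (U - {k})"
    using assms(1) unfolding grading_def by blast
  then show ?thesis
    using assms(3) by (simp add: insert_absorb)
qed

lemma form_filter_pmult:
  "grading G Q \<Longrightarrow> g \<in> G \<Longrightarrow> form_filter (Q q) (pmult g \<eta>) = pmult g (form_filter (Q q) \<eta>)"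
  by (auto simp: form_filter_def fun_eq_iff form_apply grading_def intro!: poly_filter_mult)

lemma form_filter_dpoly_wedge:
  assumes Q: "grading G Q" "g \<in> G"
  shows "form_filter (Q q) (wedge (dpoly g) b) = wedge (dpoly g) (form_filter (Q (q - 1)) b)"
proof
  fix U
  show "form_filter (Q q) (wedge (dpoly g) b) U = wedge (dpoly g) (form_filter (Q (q - 1)) b) U"
  proof (cases "finite U")
    case True
    have "poly_filter (\<lambda>m. Q q m U) (pderiv_mp k g * b (U - {k}))
        = pderiv_mp k g * poly_filter (\<lambda>m. Q (q - 1) m (U - {k})) (b (U - {k}))" if "k \<in> U" for k
    proof (rule poly_filter_mult)
      fix m0 m assume "m0 \<in> keys (pderiv_mp k g)"
      then have "m0 + single k 1 \<in> keys g"
        by (auto simp: in_keys_iff lookup_pderiv)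
      then have "Q (q - 1) ((m0 + single k 1) + m) (U - {k}) = Q (q - 1) m (U - {k})"
        using Q by (auto simp: grading_def)
      then show "Q q (m0 + m) U = Q (q - 1) m (U - {k})"
        by (simp add: grading_remove[OF Q(1) True that] ac_simps)
    qed
    with True show ?thesis
      by (simp add: form_filter_def wedge_degree_one_left poly_filter_sum mult.assoc)
  qed (simp add: form_filter_def)
qed

lemma form_filter_ext_d:
  assumes "grading G Q"
  shows "form_filter (Q q) (ext_d \<eta>) = ext_d (form_filter (Q (q - 1)) \<eta>)"
proof
  fix U
  show "form_filter (Q q) (ext_d \<eta>) U = ext_d (form_filter (Q (q - 1)) \<eta>) U"
  proof (cases "finite U")
    case True
    then have "poly_filter (\<lambda>m. Q q m U) (pderiv_mp k (\<eta> (U - {k})))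
        = pderiv_mp k (poly_filter (\<lambda>m. Q (q - 1) m (U - {k})) (\<eta> (U - {k})))" if "k \<in> U" for k
      using grading_remove[OF assms _ that] by (intro poly_filter_pderiv)
    with True show ?thesis
      by (simp add: form_filter_def ext_d_def poly_filter_sum)
  qed (simp add: form_filter_def)
qed

lemma form_supp_ext_d:
  assumes "grading G Q" "form_supp (Q (q - 1)) \<eta>"
  shows "form_supp (Q q) (ext_d \<eta>)"
  using form_filter_ext_d[OF assms(1), of q \<eta>] form_supp_filter[of "Q q" "ext_d \<eta>"]
  by (simp add: form_filter_supp assms(2))

lemma rels_form_filter:
  assumes "grading G Q" "\<eta> \<in> rels G"
  shows "form_filter (Q q) \<eta> \<in> rels G"
  using assms(2)
  by (induction rule: rels_induct)
    (auto simp: form_filter.add form_filter_pmult[OF assms(1)] form_filter_dpoly_wedge[OF assms(1)]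
      intro: rels_add pmult_in_rels dpoly_wedge_in_rels)

lemma form_filter_diff_ext_d_in_rels:
  assumes "grading G Q" "\<eta> - ext_d \<theta> \<in> rels G"
  shows "form_filter (Q q) \<eta> - ext_d (form_filter (Q (q - 1)) \<theta>) \<in> rels G"
  using rels_form_filter[OF assms, of q] by (simp add: form_filter.diff form_filter_ext_d[OF assms(1)])

lemma exacts_form_filter:
  assumes "grading G Q" "\<eta> \<in> exacts G"
  shows "form_filter (Q q) \<eta> \<in> exacts G"
  using assms form_filter_diff_ext_d_in_rels unfolding exacts_def by blast

subsection \<open>The grading by degree\<close>

definition degree_term :: "nat set \<Rightarrow> int \<Rightarrow> term_pred" where
  "degree_term V q m S \<longleftrightarrow> finite S \<and> S \<subseteq> V \<and> int (card S) = q \<and> keys m \<subseteq> V"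

lemma is_form_iff_form_supp:
  "finite V \<Longrightarrow> is_form V j \<eta> \<longleftrightarrow> form_supp (degree_term V (int j)) \<eta>"
  unfolding is_form_def form_supp_def poly_supp_def degree_term_def poly_in_def
  by (metis all_not_in_conv finite_subset keys_eq_empty keys_zero of_nat_eq_iff)

lemma is_form_pred:
  assumes "finite V" "form_supp (degree_term V (int j - 1)) \<eta>"
  shows "if j = 0 then \<eta> = 0 else is_form V (j - 1) \<eta>"
proof (cases j)
  case 0
  then have "keys (\<eta> S) = {}" for S
    using assms(2) by (auto simp: form_supp_def poly_supp_def degree_term_def)
  then have "\<eta> = 0"
    by (simp add: fun_eq_iff form_apply)
  with 0 show ?thesis by simp
qed (use assms in \<open>simp add: is_form_iff_form_supp\<close>)

lemma grading_degree_term: "(\<And>g. g \<in> G \<Longrightarrow> poly_in V g) \<Longrightarrow> grading G (degree_term V)"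
  by (auto simp: grading_def degree_term_def keys_add_nat poly_in_def)

lemma subspace_is_form: "finite V \<Longrightarrow> form.subspace {\<eta>. is_form V j \<eta>}"
  by (simp add: is_form_iff_form_supp subspace_form_supp)

lemma is_form_ext_d: "finite V \<Longrightarrow> is_form V j \<eta> \<Longrightarrow> is_form V (Suc j) (ext_d \<eta>)"
  using form_supp_ext_d[OF grading_degree_term[of "{}" V], of "int (Suc j)" \<eta>]
  by (simp add: is_form_iff_form_supp)

lemma rel_forms_rels: "\<eta> \<in> rel_forms V G j \<Longrightarrow> \<eta> \<in> rels G"
  unfolding rel_forms_def by (auto intro!: rels_sum rels_add pmult_in_rels dpoly_wedge_in_rels)

lemma rels_rel_forms:
  assumes V: "finite V" "finite G" "\<And>g. g \<in> G \<Longrightarrow> poly_in V g" and \<eta>: "is_form V j \<eta>" "\<eta> \<in> rels G"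
  shows "\<eta> \<in> rel_forms V G j"
proof -
  obtain a b where ab: "\<eta> = (\<Sum>g\<in>G. pmult g (a g) + wedge (dpoly g) (b g))"
    using rels_finiteE[OF V(2) \<eta>(2)] by blast
  let ?a = "\<lambda>g. form_filter (degree_term V (int j)) (a g)"
  let ?b = "\<lambda>g. form_filter (degree_term V (int j - 1)) (b g)"
  have grading: "grading G (degree_term V)"
    by (rule grading_degree_term) (rule V(3))
  have "\<eta> = form_filter (degree_term V (int j)) \<eta>"
    using \<eta>(1) V(1) by (simp add: is_form_iff_form_supp form_filter_supp)
  also have "\<dots> = (\<Sum>g\<in>G. pmult g (?a g) + wedge (dpoly g) (?b g))"
    unfolding ab form_filter.sum form_filter.add
    by (intro sum.cong) (simp_all add: form_filter_pmult[OF grading]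
      form_filter_dpoly_wedge[OF grading])
  finally have "\<eta> = (\<Sum>g\<in>G. pmult g (?a g) + wedge (dpoly g) (?b g))" .
  moreover have "is_form V j (?a g)" for g
    by (simp add: is_form_iff_form_supp V(1) form_supp_filter)
  moreover have "if j = 0 then ?b g = 0 else is_form V (j - 1) (?b g)" for g
    by (rule is_form_pred[OF V(1) form_supp_filter])
  ultimately show ?thesis
    unfolding rel_forms_def by (intro CollectI exI[of _ ?a] exI[of _ ?b] conjI) blast+
qed

lemma closed_forms_iff:
  assumes "finite V" "finite G" "\<And>g. g \<in> G \<Longrightarrow> poly_in V g"
  shows "\<eta> \<in> closed_forms V G j \<longleftrightarrow> is_form V j \<eta> \<and> ext_d \<eta> \<in> rels G"
  using rels_rel_forms[OF assms, of "Suc j" "ext_d \<eta>"] rel_forms_rels is_form_ext_d[OF assms(1)]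
  by (auto simp: closed_forms_def)

lemma exact_forms_iff:
  assumes "finite V" "finite G" "\<And>g. g \<in> G \<Longrightarrow> poly_in V g"
  shows "\<eta> \<in> exact_forms V G j \<longleftrightarrow> is_form V j \<eta> \<and> \<eta> \<in> exacts G"
proof
  assume "\<eta> \<in> exact_forms V G j"
  then show "is_form V j \<eta> \<and> \<eta> \<in> exacts G"
    using rel_forms_rels by (fastforce simp: exact_forms_def exacts_def)
next
  assume \<eta>: "is_form V j \<eta> \<and> \<eta> \<in> exacts G"
  then obtain \<theta> where \<theta>: "\<eta> - ext_d \<theta> \<in> rels G" by (auto simp: exacts_def)
  let ?\<theta> = "form_filter (degree_term V (int j - 1)) \<theta>"
  have grading: "grading G (degree_term V)"
    by (rule grading_degree_term) (rule assms(3))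
  have supp: "form_supp (degree_term V (int j)) \<eta>"
    using \<eta> assms(1) by (simp add: is_form_iff_form_supp)
  have "\<eta> - ext_d ?\<theta> \<in> rels G"
    using form_filter_diff_ext_d_in_rels[OF grading \<theta>, of "int j"]
    by (simp add: form_filter_supp[OF supp])
  moreover have "form_supp (degree_term V (int j)) (ext_d ?\<theta>)"
    by (rule form_supp_ext_d[OF grading form_supp_filter])
  then have "is_form V j (\<eta> - ext_d ?\<theta>)"
    using supp form.subspace_diff[OF subspace_form_supp] assms(1) by (simp add: is_form_iff_form_supp)
  ultimately have "\<eta> - ext_d ?\<theta> \<in> rel_forms V G j"
    by (intro rels_rel_forms assms)
  then show "\<eta> \<in> exact_forms V G j"
    using \<eta> is_form_pred[OF assms(1) form_supp_filter, of j \<theta>] unfolding exact_forms_def by blast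
qed

lemma subspace_closed_forms:
  assumes "finite V" "finite G" "\<And>g. g \<in> G \<Longrightarrow> poly_in V g"
  shows "form.subspace (closed_forms V G j)"
proof -
  have "closed_forms V G j = {\<eta>. is_form V j \<eta>} \<inter> {\<eta>. ext_d \<eta> \<in> rels G}"
    using closed_forms_iff[OF assms] by blast
  then show ?thesis
    by (simp add: form.subspace_inter subspace_is_form[OF assms(1)] ext_d.subspace_linear_preimage
      subspace_rels)
qed

lemma exact_forms_eq:
  assumes "finite V" "finite G" "\<And>g. g \<in> G \<Longrightarrow> poly_in V g"
  shows "exact_forms V G j = exacts G \<inter> {\<eta>. is_form V j \<eta>}"
  using exact_forms_iff[OF assms] by blast

section \<open>Pullback of forms\<close>

definition wedge_set :: "(nat \<Rightarrow> dform) \<Rightarrow> nat set \<Rightarrow> dform" where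
  "wedge_set w S = wedge_list (map w (sorted_list_of_set S))"

lemma wedge_set_empty [simp]: "wedge_set w {} = one_form"
  by (simp add: wedge_set_def wedge_list_def)

lemma wedge_set_insert_min:
  assumes "finite S" "\<And>s. s \<in> S \<Longrightarrow> b < s"
  shows "wedge_set w (insert b S) = wedge (w b) (wedge_set w S)"
proof -
  have "b \<notin> S" using assms(2) by blast
  then have "sorted_list_of_set (insert b S) = b # sorted_list_of_set S"
    using assms by (auto simp: sorted_list_of_set_insert_remove less_imp_le intro!: insort_is_Cons)
  then show ?thesis by (simp add: wedge_set_def wedge_list_def)
qed

lemma wedge_wedge_set:
  assumes "\<And>v. degree_one (w v)" "finite S"
  shows "wedge (w v) (wedge_set w S)
      = (if v \<in> S then 0 else cmul (sgn_sets {v} S) (wedge_set w (insert v S)))"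
  using assms(2)
proof (induction S rule: finite_linorder_min_induct)
  case empty
  then show ?case using wedge_set_insert_min[of "{}" v w] by (simp add: cmul_simps)
next
  case (insert b A)
  consider (less) "v < b" | (eq) "v = b" | (greater) "b < v" by linarith
  then show ?case
  proof cases
    case less
    then have "\<And>s. s \<in> insert b A \<Longrightarrow> v < s" using insert.hyps by auto
    moreover from this have "sgn_sets {v} (insert b A) = 1" by (intro sgn_sets_less) auto
    ultimately show ?thesis using wedge_set_insert_min[of "insert b A" v w] insert.hyps
      by (auto simp: cmul_simps)
  next
    case eq
    then show ?thesis using insert.hyps assms(1)
      by (simp add: wedge_set_insert_min wedge_degree_one_self wedge_simps flip: wedge_assoc)
  next
    case greater
    have "wedge (w v) (wedge_set w (insert b A)) = - wedge (w b) (wedge (w v) (wedge_set w A))"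
      using insert.hyps assms(1)
      by (simp add: wedge_set_insert_min wedge_degree_one_anticommute[of "w v" "w b"] wedge_simps
        flip: wedge_assoc)
    also have "\<dots> = (if v \<in> A then 0 else
        - cmul (sgn_sets {v} A) (wedge (w b) (wedge_set w (insert v A))))"
      by (simp add: insert.IH wedge_simps)
    also have "v \<notin> A \<Longrightarrow> wedge (w b) (wedge_set w (insert v A)) = wedge_set w (insert b (insert v A))"
      using insert.hyps greater by (subst wedge_set_insert_min) auto
    moreover have "b \<notin> A" using insert.hyps by auto
    then have "sgn_sets {v} (insert b A) = - sgn_sets {v} A"
      using insert.hyps greater by (subst sgn_sets_insert_right) (auto simp: sgn_sets_singletons)
    ultimately show ?thesis using greater by (simp add: insert_commute cmul_simps)
  qed
qed

lemma wedge_set_dterm: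
  assumes "finite S"
  shows "wedge_set (\<lambda>k. dterm {k} (p k)) S = dterm S (\<Prod>k\<in>S. p k)"
  using assms
proof (induction S rule: finite_linorder_min_induct)
  case (insert b A)
  then have "b \<notin> A" "sgn_sets {b} A = 1" by (auto intro: sgn_sets_less)
  then show ?case using insert by (simp add: wedge_set_insert_min wedge_dterm)
qed (simp add: one_form_dterm)

lemma ext_d_wedge_set_dpoly:
  assumes "finite S"
  shows "ext_d (wedge_set (\<lambda>v. dpoly (\<phi> v)) S) = 0"
  using assms
proof (induction S rule: finite_linorder_min_induct)
  case empty then show ?case by (simp add: one_form_dterm)
next
  case (insert b A)
  then show ?case by (simp add: wedge_set_insert_min ext_d_dpoly_wedge wedge_simps)
qed

lemma pullback_wedge_set:
  "pullback W \<phi> \<eta> = (\<Sum>S\<in>Pow W. pmult (subst_mp \<phi> (\<eta> S)) (wedge_set (\<lambda>v. dpoly (\<phi> v)) S))"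
  by (simp add: pullback_def wedge_set_def)

interpretation pullback: Vector_Spaces.linear cmul cmul "pullback W \<phi>" for W \<phi>
  by (rule linear_formI)
    (simp_all add: pullback_wedge_set form_apply pmult_simps sum.distrib cmul_def
      form_module.scale_sum_right)

lemma pullback_pmult: "pullback W \<phi> (pmult p \<eta>) = pmult (subst_mp \<phi> p) (pullback W \<phi> \<eta>)"
  by (simp add: pullback_wedge_set form_apply form_module.scale_sum_right)

lemma pullback_dterm:
  assumes "finite W" "S \<subseteq> W"
  shows "pullback W \<phi> (dterm S p) = pmult (subst_mp \<phi> p) (wedge_set (\<lambda>v. dpoly (\<phi> v)) S)" (is "_ = ?r")
proof -
  have "pullback W \<phi> (dterm S p) = (\<Sum>R\<in>Pow W. if R = S then ?r else 0)"
    unfolding pullback_wedge_set by (intro sum.cong) (auto simp: dterm_def pmult_simps)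
  with assms show ?thesis by simp
qed

lemma pullback_wedge_coefficients:
  assumes W: "finite W"
    and y: "\<And>U. U \<subseteq> W \<Longrightarrow> y U = (\<Sum>k\<in>U. Const (sgn_sets {k} (U - {k})) * a k (U - {k}))"
  shows "pullback W \<phi> y = (\<Sum>S\<in>Pow W. \<Sum>v\<in>W. pmult (subst_mp \<phi> (a v S)) (wedge (dpoly (\<phi> v)) (wedge_set (\<lambda>v. dpoly (\<phi> v)) S)))"
proof -
  let ?w = "\<lambda>v. dpoly (\<phi> v)"
  have fin: "finite S" if "S \<subseteq> W" for S using that W finite_subset by blast
  let ?t = "\<lambda>S v. cmul (sgn_sets {v} S) (pmult (subst_mp \<phi> (a v S)) (wedge_set ?w (insert v S)))"
  have "pullback W \<phi> y = (\<Sum>U\<in>Pow W. \<Sum>k\<in>U. ?t (U - {k}) k)"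
    unfolding pullback_wedge_set
    by (intro sum.cong) (auto simp: y subst_sum form_module.scale_sum_left cmul_def pmult_simps
      insert_absorb)
  also have "\<dots> = (\<Sum>(U,k)\<in>Sigma (Pow W) (\<lambda>U. U). ?t (U - {k}) k)"
    using W fin by (subst sum.Sigma) auto
  also have "\<dots> = (\<Sum>(S,k)\<in>Sigma (Pow W) (\<lambda>S. W - S). ?t S k)"
    by (rule sum.reindex_bij_witness[where i = "\<lambda>(S,k). (insert k S, k)"
      and j = "\<lambda>(U,k). (U - {k}, k)"]) auto
  also have "\<dots> = (\<Sum>S\<in>Pow W. \<Sum>k\<in>W-S. ?t S k)"
    using W by (subst sum.Sigma) auto
  also have "\<dots> = (\<Sum>S\<in>Pow W. \<Sum>v\<in>W. pmult (subst_mp \<phi> (a v S)) (wedge (?w v) (wedge_set ?w S)))"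
  proof (rule sum.cong[OF refl])
    fix S assume "S \<in> Pow W"
    then have "finite S" using fin by auto
    have "(\<Sum>v\<in>W. pmult (subst_mp \<phi> (a v S)) (wedge (?w v) (wedge_set ?w S)))
        = (\<Sum>v\<in>W. if v \<in> S then 0 else ?t S v)"
      by (intro sum.cong refl) (simp add: wedge_wedge_set[of ?w, OF _ \<open>finite S\<close>] pmult_simps cmul_def
        mult.commute)
    also have "\<dots> = (\<Sum>v\<in>W-S. ?t S v)"
      using W by (intro sum.mono_neutral_cong_right) auto
    finally show "(\<Sum>k\<in>W-S. ?t S k) = (\<Sum>v\<in>W. pmult (subst_mp \<phi> (a v S)) (wedge (?w v) (wedge_set ?w S)))" ..
  qed
  finally show ?thesis .
qed

lemma dpoly_subst:
  assumes "finite W" "poly_in W p"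
  shows "dpoly (subst_mp \<phi> p) = (\<Sum>v\<in>W. pmult (subst_mp \<phi> (pderiv_mp v p)) (dpoly (\<phi> v)))"
  by (auto simp: fun_eq_iff form_apply dpoly_def pderiv_subst[OF assms])

lemma pullback_dpoly_wedge:
  assumes "finite W" "poly_in W g"
  shows "pullback W \<phi> (wedge (dpoly g) b) = wedge (dpoly (subst_mp \<phi> g)) (pullback W \<phi> b)"
proof -
  let ?w = "\<lambda>v. dpoly (\<phi> v)"
  have "pullback W \<phi> (wedge (dpoly g) b)
      = (\<Sum>S\<in>Pow W. \<Sum>v\<in>W. pmult (subst_mp \<phi> (pderiv_mp v g * b S)) (wedge (?w v) (wedge_set ?w S)))"
  proof (rule pullback_wedge_coefficients[OF assms(1)])
    fix U assume "U \<subseteq> W"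
    then have "finite U" using assms(1) finite_subset by blast
    then show "wedge (dpoly g) b U
        = (\<Sum>k\<in>U. Const (sgn_sets {k} (U - {k})) * (pderiv_mp k g * b (U - {k})))"
      by (simp add: wedge_degree_one_left mult.assoc)
  qed
  also have "\<dots> = wedge (dpoly (subst_mp \<phi> g)) (pullback W \<phi> b)"
    unfolding dpoly_subst[OF assms] pullback_wedge_set
    by (simp add: wedge_sum_left wedge_sum_right form_module.scale_sum_right pmult_simps mult.commute)
  finally show ?thesis .
qed

lemma pullback_ext_d:
  assumes "finite W" "\<And>S. S \<subseteq> W \<Longrightarrow> poly_in W (\<eta> S)"
  shows "pullback W \<phi> (ext_d \<eta>) = ext_d (pullback W \<phi> \<eta>)"
proof -
  let ?w = "\<lambda>v. dpoly (\<phi> v)"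
  have fin: "finite S" if "S \<subseteq> W" for S using that assms(1) finite_subset by blast
  have "pullback W \<phi> (ext_d \<eta>)
      = (\<Sum>S\<in>Pow W. \<Sum>v\<in>W. pmult (subst_mp \<phi> (pderiv_mp v (\<eta> S))) (wedge (?w v) (wedge_set ?w S)))"
    by (rule pullback_wedge_coefficients) (use assms fin in \<open>auto simp: ext_d_def\<close>)
  also have "\<dots> = (\<Sum>S\<in>Pow W. wedge (dpoly (subst_mp \<phi> (\<eta> S))) (wedge_set ?w S))"
    using assms by (intro sum.cong) (auto simp: dpoly_subst wedge_sum_left)
  also have "\<dots> = ext_d (pullback W \<phi> \<eta>)"
    unfolding pullback_wedge_set ext_d.sum
    by (intro sum.cong) (auto simp: ext_d_pmult ext_d_wedge_set_dpoly fin pmult_simps)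
  finally show ?thesis .
qed

lemma pullback_rels:
  assumes "finite W" "\<And>g. g \<in> G \<Longrightarrow> poly_in W g" "\<And>g. g \<in> G \<Longrightarrow> subst_mp \<phi> g \<in> ideal H" "\<eta> \<in> rels G"
  shows "pullback W \<phi> \<eta> \<in> rels H"
  using assms(4)
proof (induction rule: rels_induct)
  case (dpoly_wedge g \<theta>)
  then show ?case
    using assms(1-3) by (simp add: pullback_dpoly_wedge rels_wedge_right rels_dpoly_ideal)
qed (auto simp: pullback.add pullback_pmult assms(3) intro: rels_add rels_ideal)

section \<open>Laurent monomials in one variable\<close>

definition unit_power :: "'a::comm_ring_1 \<Rightarrow> 'a \<Rightarrow> int \<Rightarrow> 'a" where
  "unit_power u w m = (if 0 \<le> m then u ^ nat m else w ^ nat (- m))"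

lemma unit_power_0 [simp]: "unit_power u w 0 = 1"
  and unit_power_minus_1 [simp]: "unit_power u w (- 1) = w"
  by (simp_all add: unit_power_def)

lemma unit_power_inverse: "unit_power u (inverse u) m = (u :: complex) powi m"
  by (simp add: unit_power_def power_int_def)

lemma unit_power_mult_unit:
  assumes "u * w - 1 \<in> ideal G"
  shows "u * unit_power u w m - unit_power u w (m + 1) \<in> ideal G"
proof (cases "0 \<le> m")
  case True
  then show ?thesis
    by (simp add: unit_power_def nat_add_distrib mpoly_ring.span_zero)
next
  case False
  define k where "k = nat (- m - 1)"
  have m: "m = - int k - 1"
    using False by (simp add: k_def)
  have "u * unit_power u w m - unit_power u w (m + 1) = w ^ k * (u * w - 1)"
    by (cases "k = 0") (simp_all add: m unit_power_def nat_add_distrib algebra_simps)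
  then show ?thesis
    using assms by (simp add: mpoly_ring.span_scale)
qed

lemma unit_power_mult_inverse:
  assumes "u * w - 1 \<in> ideal G"
  shows "w * unit_power u w m - unit_power u w (m - 1) \<in> ideal G"
proof -
  have "w * (u * unit_power u w (m - 1) - unit_power u w m) \<in> ideal G"
    using unit_power_mult_unit[OF assms, of "m - 1"] by (simp add: mpoly_ring.span_scale)
  moreover have "(u * w - 1) * unit_power u w (m - 1) \<in> ideal G"
    using assms by (rule ideal_mult_right)
  ultimately have "(u * w - 1) * unit_power u w (m - 1)
      - w * (u * unit_power u w (m - 1) - unit_power u w m) \<in> ideal G"
    by (intro mpoly_ring.span_diff)
  then show ?thesis
    by (simp add: algebra_simps)
qed

lemma dpoly_inverse:
  assumes "u * w - 1 \<in> ideal G"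
  shows "dpoly w + pmult (w * w) (dpoly u) \<in> rels G"
proof -
  have "pmult w (dpoly (u * w - 1)) - pmult (u * w - 1) (dpoly w) \<in> rels G"
    using assms by (intro rels_diff rels_pmult rels_dpoly_ideal rels_ideal)
  then show ?thesis
    by (simp add: dpoly_simps pmult_simps algebra_simps)
qed

lemma dpoly_unit_power:
  assumes "u * w - 1 \<in> ideal G"
  shows "dpoly (unit_power u w m) - pmult (of_int m * unit_power u w (m - 1)) (dpoly u) \<in> rels G"
proof (cases "0 \<le> m")
  case True
  then obtain k where m: "m = int k"
    using nonneg_int_cases by blast
  have "unit_power u w m = u ^ k"
    by (simp add: m unit_power_def)
  moreover have "of_int m * unit_power u w (m - 1) = of_nat k * u ^ (k - 1)"
    by (cases k) (simp_all add: m unit_power_def)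
  ultimately show ?thesis
    by (simp only: dpoly_power) simp
next
  case False
  define k where "k = nat (- m)"
  have k: "m = - int k" "0 < k"
    using False by (simp_all add: k_def)
  have power: "unit_power u w m = w ^ k" "unit_power u w (m - 1) = w ^ (k - 1) * (w * w)"
    using k by (simp_all add: unit_power_def nat_add_distrib flip: power_add power2_eq_square)
  have "pmult (of_nat k * w ^ (k - 1)) (dpoly w + pmult (w * w) (dpoly u)) \<in> rels G"
    by (intro rels_pmult dpoly_inverse assms)
  moreover have "dpoly (unit_power u w m) - pmult (of_int m * unit_power u w (m - 1)) (dpoly u)
      = pmult (of_nat k * w ^ (k - 1)) (dpoly w + pmult (w * w) (dpoly u))"
    unfolding power dpoly_power by (simp add: k(1) pmult_simps mult.assoc)
  ultimately show ?thesis by simp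
qed

section \<open>Bases of the two-term complexes\<close>

text \<open>For \<open>u = x\<^sup>N - 1\<close> with inverse \<open>w\<close>, \<open>factor N e False\<close> and \<open>factor N e True\<close> form bases of
  \<open>x\<^sup>e \<complex>[u, w]\<close> and of the coefficients of \<open>dx\<close> of the same weight. The differential maps
  \<open>factor N e False (Some m)\<close> to \<open>factor N e True (Some m)\<close>, and the index \<open>None\<close> stands for the
  remaining basis elements, which represent the cohomology.\<close>

definition base_exp :: "nat \<Rightarrow> nat \<Rightarrow> bool \<Rightarrow> nat" where
  "base_exp N e \<sigma> = (if \<sigma> then (if e = 0 then N else e) - 1 else e)"

definition factor :: "nat \<Rightarrow> nat \<Rightarrow> bool \<Rightarrow> int option \<Rightarrow> 'a \<Rightarrow> 'a \<Rightarrow> 'a \<Rightarrow> 'a::comm_ring_1" where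
  "factor N e \<sigma> \<rho> x u w = x ^ base_exp N e \<sigma> * (case \<rho> of
       None \<Rightarrow> if \<sigma> then w else if e = 0 then 1 else 0
     | Some m \<Rightarrow>
         if \<sigma> then of_int (if e = 0 then 0 else int e + m * int N) * unit_power u w m
                 + of_int (m * int N) * unit_power u w (m - 1)
         else unit_power u w m)"

lemma factor_ring_hom:
  fixes h :: "'a::comm_ring_1 \<Rightarrow> 'b::comm_ring_1"
  assumes add: "\<And>p q. h (p + q) = h p + h q" and mult: "\<And>p q. h (p * q) = h p * h q" and one: "h 1 = 1"
  shows "h (factor N e \<sigma> \<rho> x u w) = factor N e \<sigma> \<rho> (h x) (h u) (h w)"
proof -
  have zero: "h 0 = 0"
    using add[of 0 0] by simp
  have diff: "h (p - q) = h p - h q" for p q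
    using add[of "p - q" q] by simp
  have "h (of_nat k) = of_nat k" for k
    by (induction k) (simp_all add: zero add one)
  then have of_int: "h (of_int k) = of_int k" for k
    by (cases k rule: int_diff_cases) (simp add: diff)
  have power: "h (p ^ k) = h p ^ k" for p k
    by (induction k) (simp_all add: one mult)
  have "h (unit_power u w m) = unit_power (h u) (h w) m" for m
    by (simp add: unit_power_def power)
  then show ?thesis
    by (cases \<rho>) (simp_all add: factor_def add mult one zero of_int power del: of_int_add of_int_mult)
qed

definition factor_index :: "nat \<Rightarrow> bool \<Rightarrow> int option set" where
  "factor_index e \<sigma> = {\<rho>. (e = 0 \<longrightarrow> \<rho> \<noteq> Some 0) \<and> (0 < e \<and> \<rho> = None \<longrightarrow> \<sigma>)}"

text \<open>With respect to this ranking of the exponents the factors are triangular in the Laurent monomials.\<close>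

definition exp_rank :: "int \<Rightarrow> nat" where
  "exp_rank k = nat (if 0 \<le> k then k else - 1 - k)"

definition lead_exp :: "nat \<Rightarrow> bool \<Rightarrow> int option \<Rightarrow> int" where
  "lead_exp e \<sigma> \<rho> = (case \<rho> of None \<Rightarrow> if \<sigma> then - 1 else 0
     | Some m \<Rightarrow> if \<sigma> \<and> (e = 0 \<or> m < 0) then m - 1 else m)"

definition lead_scalar :: "nat \<Rightarrow> nat \<Rightarrow> bool \<Rightarrow> int option \<Rightarrow> int" where
  "lead_scalar N e \<sigma> \<rho> = (case \<rho> of None \<Rightarrow> 1
     | Some m \<Rightarrow> if \<not> \<sigma> then 1 else if e = 0 \<or> m < 0 then m * int N else int e + m * int N)"

lemma bij_betw_lead_exp: "bij_betw (lead_exp e \<sigma>) (factor_index e \<sigma>) UNIV"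
proof (rule bij_betw_byWitness)
  let ?inv = "\<lambda>k. if k = (if \<sigma> then - 1 else 0) \<and> (e = 0 \<or> \<sigma>) then None
    else Some (if \<sigma> \<and> (e = 0 \<or> k < 0) then k + 1 else k)"
  show "\<forall>\<rho>\<in>factor_index e \<sigma>. ?inv (lead_exp e \<sigma> \<rho>) = \<rho>"
    by (auto simp: factor_index_def lead_exp_def split: option.splits)
  show "\<forall>k\<in>UNIV. lead_exp e \<sigma> (?inv k) = k"
    by (auto simp: lead_exp_def)
  show "?inv ` UNIV \<subseteq> factor_index e \<sigma>"
    by (auto simp: factor_index_def)
qed simp

lemma lead_scalar_nonzero: "0 < N \<Longrightarrow> \<rho> \<in> factor_index e \<sigma> \<Longrightarrow> lead_scalar N e \<sigma> \<rho> \<noteq> 0"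
proof -
  assume "0 < N" "\<rho> \<in> factor_index e \<sigma>"
  moreover have "int e + m * int N \<noteq> 0" if "e \<noteq> 0" "\<not> m < 0" for m
    using that by (intro less_imp_neq[symmetric] add_pos_nonneg) auto
  ultimately show ?thesis
    by (auto simp: lead_scalar_def factor_index_def split: option.splits)
qed

lemma lead_exp_surjE:
  obtains \<rho> where "\<rho> \<in> factor_index e \<sigma>" "lead_exp e \<sigma> \<rho> = k"
proof -
  have "k \<in> lead_exp e \<sigma> ` factor_index e \<sigma>"
    by (simp add: bij_betw_imp_surj_on[OF bij_betw_lead_exp])
  with that show thesis by blast
qed

lemma factor_triangular:
  assumes "\<rho> \<in> factor_index e \<sigma>"
  obtains c k where "c = 0 \<or> exp_rank k < exp_rank (lead_exp e \<sigma> \<rho>)"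
    and "\<And>x u w :: 'a::comm_ring_1. factor N e \<sigma> \<rho> x u w = x ^ base_exp N e \<sigma> *
      (of_int (lead_scalar N e \<sigma> \<rho>) * unit_power u w (lead_exp e \<sigma> \<rho>) + of_int c * unit_power u w k)"
proof (cases \<rho>)
  case None
  with assms show ?thesis
    by (intro that[of 0 0]) (auto simp: factor_def lead_exp_def lead_scalar_def factor_index_def)
next
  case (Some m)
  show ?thesis
  proof (cases "\<sigma> \<and> 0 < e")
    case False
    with Some show ?thesis
      by (intro that[of 0 0]) (auto simp: factor_def lead_exp_def lead_scalar_def)
  next
    case True
    with Some show ?thesis
      by (intro that[of "if m < 0 then int e + m * int N else m * int N" "if m < 0 then m else m - 1"])
        (auto simp: factor_def lead_exp_def lead_scalar_def exp_rank_def add.commute)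
  qed
qed

lemma laurent_monomial_in_span_factor:
  fixes x u w :: mpoly
  assumes "0 < N"
  shows "x ^ base_exp N e \<sigma> * unit_power u w k
      \<in> mpoly.span ((\<lambda>\<rho>. factor N e \<sigma> \<rho> x u w) ` factor_index e \<sigma>)"
proof -
  let ?e = "\<lambda>\<rho>. x ^ base_exp N e \<sigma> * unit_power u w (lead_exp e \<sigma> \<rho>)"
  let ?b = "\<lambda>\<rho>. factor N e \<sigma> \<rho> x u w"
  have "?e ` factor_index e \<sigma> \<subseteq> mpoly.span (?b ` factor_index e \<sigma>)"
  proof (rule mpoly.span_triangular[where \<kappa> = "\<lambda>\<rho>. of_int (lead_scalar N e \<sigma> \<rho>)"
    and rank = "\<lambda>\<rho>. exp_rank (lead_exp e \<sigma> \<rho>)"])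
    fix \<rho> assume \<rho>: "\<rho> \<in> factor_index e \<sigma>"
    show "of_int (lead_scalar N e \<sigma> \<rho>) \<noteq> (0::complex)"
      using lead_scalar_nonzero[OF assms \<rho>] by simp
    obtain c k where ck: "c = 0 \<or> exp_rank k < exp_rank (lead_exp e \<sigma> \<rho>)"
      "?b \<rho> = x ^ base_exp N e \<sigma> *
        (of_int (lead_scalar N e \<sigma> \<rho>) * unit_power u w (lead_exp e \<sigma> \<rho>) + of_int c * unit_power u w k)"
      using factor_triangular[OF \<rho>, where 'a = mpoly] by metis
    obtain \<rho>' where \<rho>': "\<rho>' \<in> factor_index e \<sigma>" "lead_exp e \<sigma> \<rho>' = k"
      by (rule lead_exp_surjE)
    let ?lower = "?e ` {\<rho>' \<in> factor_index e \<sigma>. exp_rank (lead_exp e \<sigma> \<rho>') < exp_rank (lead_exp e \<sigma> \<rho>)}"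
    have "?b \<rho> - Const (of_int (lead_scalar N e \<sigma> \<rho>)) * ?e \<rho> = Const (of_int c) * ?e \<rho>'"
      by (simp add: ck(2) \<rho>'(2) Const_of_int algebra_simps)
    moreover have "?e \<rho>' \<in> ?lower" if "c \<noteq> 0"
      using ck(1) \<rho>' that by auto
    ultimately show "?b \<rho> - Const (of_int (lead_scalar N e \<sigma> \<rho>)) * ?e \<rho>
        \<in> mpoly.span ?lower"
      by (cases "c = 0") (simp_all add: mpoly.span_zero mpoly.span_scale mpoly.span_base)
  qed
  moreover obtain \<rho> where "\<rho> \<in> factor_index e \<sigma>" "lead_exp e \<sigma> \<rho> = k"
    by (rule lead_exp_surjE)
  ultimately show ?thesis by auto
qed

lemma dpoly_factor_Some:
  assumes unit: "u * w - 1 \<in> ideal G" and u: "u = Var k ^ N - 1" and N: "0 < N"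
  shows "dpoly (factor N e False (Some m) (Var k) u w)
      - dterm {k} (factor N e True (Some m) (Var k) u w) \<in> rels G"
proof -
  let ?U = "unit_power u w" and ?x = "Var k"
  define q where "q = ?x ^ e * (of_int m * ?U (m - 1) * (of_nat N * ?x ^ (N - 1)))
      + ?U m * (of_nat e * ?x ^ (e - 1))"
  have du: "dpoly u = dterm {k} (of_nat N * ?x ^ (N - 1))"
    by (simp add: u dpoly_simps dpoly_Var_power)
  have "pmult (?x ^ e) (dpoly (?U m) - pmult (of_int m * ?U (m - 1)) (dpoly u)) \<in> rels G"
    by (intro rels_pmult dpoly_unit_power unit)
  also have "pmult (?x ^ e) (dpoly (?U m) - pmult (of_int m * ?U (m - 1)) (dpoly u))
      = dpoly (?x ^ e * ?U m) - dterm {k} q"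
    by (simp add: q_def du dpoly_simps dpoly_Var_power pmult_simps dterm.add)
  finally have leibniz: "dpoly (?x ^ e * ?U m) - dterm {k} q \<in> rels G" .
  have "q - factor N e True (Some m) ?x u w \<in> ideal G"
  proof (cases "e = 0")
    case True
    then have "q = factor N e True (Some m) ?x u w"
      by (simp add: q_def factor_def base_exp_def)
    then show ?thesis
      by (simp add: mpoly_ring.span_zero)
  next
    case False
    have "?x ^ e * ?x ^ (N - 1) = ?x ^ (e - 1) * ?x ^ N"
      using False N by (simp flip: power_add)
    then have "?x ^ e * ?x ^ (N - 1) = ?x ^ (e - 1) * (u + 1)"
      by (simp add: u)
    moreover have "q = of_int m * of_nat N * ?U (m - 1) * (?x ^ e * ?x ^ (N - 1))
        + of_nat e * ?x ^ (e - 1) * ?U m"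
      by (simp add: q_def ac_simps)
    ultimately have "q - factor N e True (Some m) ?x u w
        = (of_int m * of_nat N * ?x ^ (e - 1)) * (u * ?U (m - 1) - ?U (m - 1 + 1))"
      using False by (simp add: factor_def base_exp_def algebra_simps)
    then show ?thesis
      using unit_power_mult_unit[OF unit, of "m - 1"] by (simp only: mpoly_ring.span_scale)
  qed
  then have "dterm {k} q - dterm {k} (factor N e True (Some m) ?x u w) \<in> rels G"
    by (rule rels_dterm_ideal)
  from rels_add[OF leibniz this] show ?thesis
    by (simp add: factor_def base_exp_def)
qed

lemma dpoly_factor_None: "dpoly (factor N e False None (Var k) u w) = 0"
  by (simp add: factor_def base_exp_def dpoly_simps)

lemma ext_d_factor_True:
  assumes unit: "u * w - 1 \<in> ideal G" and u: "u = Var k ^ N - 1" and N: "0 < N"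
  shows "ext_d (dterm {k} (factor N e True \<rho> (Var k) u w)) \<in> rels G"
proof (cases \<rho>)
  case None
  let ?q = "Var k ^ base_exp N e True"
  have "wedge (pmult ?q (dpoly w + pmult (w * w) (dpoly u))) (dterm {k} 1) \<in> rels G"
    by (intro rels_wedge_right rels_pmult dpoly_inverse unit)
  also have "wedge (pmult ?q (dpoly w + pmult (w * w) (dpoly u))) (dterm {k} 1)
      = ext_d (dterm {k} (?q * w))"
    by (simp add: u ext_d_dterm dpoly_simps dpoly_Var_power pmult_simps wedge_simps
      wedge_dterm_not_disjoint)
  finally show ?thesis
    by (simp add: None factor_def)
next
  case (Some m)
  have "- ext_d (dpoly (factor N e False (Some m) (Var k) u w)
      - dterm {k} (factor N e True (Some m) (Var k) u w)) \<in> rels G"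
    by (intro rels_neg rels_ext_d dpoly_factor_Some assms)
  then show ?thesis
    by (simp add: Some ext_d.diff ext_d_dpoly)
qed

section \<open>Independence of functions\<close>

definition fun_scale :: "complex \<Rightarrow> ('p \<Rightarrow> complex) \<Rightarrow> 'p \<Rightarrow> complex" where
  "fun_scale c f = (\<lambda>t. c * f t)"

interpretation cfun: vector_space_modulo fun_scale
  by unfold_locales (auto simp: fun_scale_def fun_eq_iff algebra_simps plus_fun_apply)

definition vanishing_on :: "'p set \<Rightarrow> ('p \<Rightarrow> complex) set" where
  "vanishing_on A = {f. \<forall>t\<in>A. f t = 0}"

lemma sum_fun_scale_vanishing_iff:
  "(\<Sum>j\<in>F. fun_scale (c j) (f j)) \<in> vanishing_on A \<longleftrightarrow> (\<forall>t\<in>A. (\<Sum>j\<in>F. c j * f j t) = 0)"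
  by (simp add: vanishing_on_def fun_scale_def sum_fun_apply)

lemma laurent_monomials_independent:
  fixes u y :: "'p \<Rightarrow> complex"
  assumes "infinite (u ` A)" and u: "\<And>t. t \<in> A \<Longrightarrow> u t \<noteq> 0" and y: "\<And>t. t \<in> A \<Longrightarrow> y t \<noteq> 0"
  shows "cfun.independent_modulo (vanishing_on A) (\<lambda>k t. y t * u t powi k) UNIV"
  unfolding cfun.independent_modulo_def
proof (intro allI impI ballI)
  fix F :: "int set" and c k
  assume F: "finite F" and vanish: "(\<Sum>k\<in>F. fun_scale (c k) (\<lambda>t. y t * u t powi k)) \<in> vanishing_on A"
    and k: "k \<in> F"
  define K where "K = nat (- Min F)"
  have K: "0 \<le> k + int K" if "k \<in> F" for k
    using Min_le[OF F that] by (simp add: K_def)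
  define p where "p = (\<Sum>k\<in>F. monom (c k) (nat (k + int K)))"
  have "poly p (u t) = 0" if t: "t \<in> A" for t
  proof -
    have "u t ^ nat (k + int K) = u t powi k * u t ^ K" if "k \<in> F" for k
      using K[OF that] u[OF t] by (simp add: power_int_add flip: power_int_of_nat)
    then have "poly p (u t) = (\<Sum>k\<in>F. c k * (u t powi k * u t ^ K))"
      unfolding p_def by (simp add: poly_sum poly_monom)
    then have "y t * poly p (u t) = u t ^ K * (\<Sum>k\<in>F. c k * (y t * u t powi k))"
      by (simp add: sum_distrib_left ac_simps)
    also have "(\<Sum>k\<in>F. c k * (y t * u t powi k)) = 0"
      using vanish t by (simp add: sum_fun_scale_vanishing_iff)
    finally show ?thesis
      using y[OF t] by simp
  qed
  then have "u ` A \<subseteq> {z. poly p z = 0}" by auto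
  then have "p = 0"
    using assms(1) poly_roots_finite finite_subset by blast
  have "coeff p (nat (k + int K)) = (\<Sum>k'\<in>F. if k' = k then c k else 0)"
    unfolding p_def coeff_sum using K k by (intro sum.cong) (auto simp: eq_nat_nat_iff)
  with \<open>p = 0\<close> F k show "c k = 0" by simp
qed

lemma factors_independent:
  fixes x :: "'p \<Rightarrow> complex" and u :: "'p \<Rightarrow> complex"
  assumes "0 < N" "infinite (u ` A)" "\<And>t. t \<in> A \<Longrightarrow> u t \<noteq> 0" "\<And>t. t \<in> A \<Longrightarrow> x t \<noteq> 0"
  shows "cfun.independent_modulo (vanishing_on A)
    (\<lambda>\<rho> t. factor N e \<sigma> \<rho> (x t) (u t) (inverse (u t))) (factor_index e \<sigma>)"
proof (rule cfun.independent_modulo_triangular)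
  let ?e = "\<lambda>\<rho> t. x t ^ base_exp N e \<sigma> * u t powi lead_exp e \<sigma> \<rho>"
  let ?b = "\<lambda>\<rho> t. factor N e \<sigma> \<rho> (x t) (u t) (inverse (u t))"
  have "cfun.independent_modulo (vanishing_on A) (\<lambda>k t. x t ^ base_exp N e \<sigma> * u t powi k) UNIV"
    using assms by (intro laurent_monomials_independent) auto
  then show "cfun.independent_modulo (vanishing_on A) ?e (factor_index e \<sigma>)"
    by (rule cfun.independent_modulo_reindex[where h = "lead_exp e \<sigma>" and \<kappa> = "\<lambda>_. 1"])
      (use bij_betw_lead_exp[of e \<sigma>] in \<open>auto simp: bij_betw_def\<close>)
  fix \<rho> assume \<rho>: "\<rho> \<in> factor_index e \<sigma>"
  show "of_int (lead_scalar N e \<sigma> \<rho>) \<noteq> (0::complex)"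
    using lead_scalar_nonzero[OF assms(1) \<rho>] by simp
  obtain c k where c: "c = 0 \<or> exp_rank k < exp_rank (lead_exp e \<sigma> \<rho>)"
    and factor: "\<And>x u w :: complex. factor N e \<sigma> \<rho> x u w = x ^ base_exp N e \<sigma> *
      (of_int (lead_scalar N e \<sigma> \<rho>) * unit_power u w (lead_exp e \<sigma> \<rho>) + of_int c * unit_power u w k)"
    using factor_triangular[OF \<rho>] by metis
  obtain \<rho>' where \<rho>': "\<rho>' \<in> factor_index e \<sigma>" "lead_exp e \<sigma> \<rho>' = k"
    by (rule lead_exp_surjE)
  let ?lower = "?e ` {\<rho>' \<in> factor_index e \<sigma>. exp_rank (lead_exp e \<sigma> \<rho>') < exp_rank (lead_exp e \<sigma> \<rho>)}"
  have "?b \<rho> - fun_scale (of_int (lead_scalar N e \<sigma> \<rho>)) (?e \<rho>) = fun_scale (of_int c) (?e \<rho>')"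
    by (simp add: fun_eq_iff minus_apply fun_scale_def factor \<rho>'(2) unit_power_inverse algebra_simps)
  moreover have "?e \<rho>' \<in> ?lower" if "c \<noteq> 0"
    using c \<rho>' that by auto
  ultimately show "?b \<rho> - fun_scale (of_int (lead_scalar N e \<sigma> \<rho>)) (?e \<rho>) \<in> cfun.span ?lower"
    by (cases "c = 0") (simp_all add: cfun.span_zero cfun.span_scale cfun.span_base)
qed

lemma tensor_slice_vanishing:
  fixes \<phi> :: "'l \<Rightarrow> 'i \<Rightarrow> 'p \<Rightarrow> complex"
  assumes L: "finite L" "a \<notin> L" and \<phi>: "cfun.independent_modulo (vanishing_on (A a)) (\<phi> a) (J a)"
    and F: "finite F" "\<And>r. r \<in> F \<Longrightarrow> r a \<in> J a" "r0 \<in> F"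
    and vanish: "(\<Sum>r\<in>F. fun_scale (c r) (\<lambda>t. \<Prod>l\<in>insert a L. \<phi> l (r l) (t l)))
        \<in> vanishing_on (Pi (insert a L) A)"
  shows "(\<Sum>r\<in>{r \<in> F. r a = r0 a}. fun_scale (c r) (\<lambda>t. \<Prod>l\<in>L. \<phi> l (r l) (t l))) \<in> vanishing_on (Pi L A)"
  unfolding sum_fun_scale_vanishing_iff
proof
  fix t assume t: "t \<in> Pi L A"
  define e where "e \<rho> = (\<Sum>r\<in>{r \<in> F. r a = \<rho>}. c r * (\<Prod>l\<in>L. \<phi> l (r l) (t l)))" for \<rho>
  have "(\<Sum>\<rho>\<in>(\<lambda>r. r a) ` F. e \<rho> * \<phi> a \<rho> s) = 0" if s: "s \<in> A a" for s
  proof -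
    have split: "(\<Prod>l\<in>insert a L. \<phi> l (r l) ((t(a := s)) l)) = (\<Prod>l\<in>L. \<phi> l (r l) (t l)) * \<phi> a (r a) s"
      for r
    proof -
      have "(\<Prod>l\<in>L. \<phi> l (r l) ((t(a := s)) l)) = (\<Prod>l\<in>L. \<phi> l (r l) (t l))"
        using L(2) by (intro prod.cong) auto
      then show ?thesis
        using L by simp
    qed
    have "t(a := s) \<in> Pi (insert a L) A"
      using t s by auto
    then have "(\<Sum>r\<in>F. c r * (\<Prod>l\<in>insert a L. \<phi> l (r l) ((t(a := s)) l))) = 0"
      using vanish unfolding sum_fun_scale_vanishing_iff by blast
    then have sum_F: "(\<Sum>r\<in>F. c r * (\<Prod>l\<in>L. \<phi> l (r l) (t l)) * \<phi> a (r a) s) = 0"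
      by (simp only: split mult.assoc)
    have "(\<Sum>\<rho>\<in>(\<lambda>r. r a) ` F. e \<rho> * \<phi> a \<rho> s)
        = (\<Sum>\<rho>\<in>(\<lambda>r. r a) ` F. \<Sum>r\<in>{r \<in> F. r a = \<rho>}. c r * (\<Prod>l\<in>L. \<phi> l (r l) (t l)) * \<phi> a (r a) s)"
      by (intro sum.cong) (auto simp: e_def sum_distrib_right)
    also have "\<dots> = 0"
      unfolding sum.image_gen[OF F(1), symmetric] by (rule sum_F)
    finally show ?thesis .
  qed
  then have "(\<Sum>\<rho>\<in>(\<lambda>r. r a) ` F. fun_scale (e \<rho>) (\<phi> a \<rho>)) \<in> vanishing_on (A a)"
    by (simp add: sum_fun_scale_vanishing_iff)
  then have "e (r0 a) = 0"
    by (rule cfun.independent_moduloD[OF \<phi>, rotated 2]) (use F in auto)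
  then show "(\<Sum>r\<in>{r \<in> F. r a = r0 a}. c r * (\<Prod>l\<in>L. \<phi> l (r l) (t l))) = 0"
    by (simp add: e_def)
qed

lemma independent_tensor:
  fixes \<phi> :: "'l \<Rightarrow> 'i \<Rightarrow> 'p \<Rightarrow> complex"
  assumes "finite L" "\<And>l. l \<in> L \<Longrightarrow> cfun.independent_modulo (vanishing_on (A l)) (\<phi> l) (J l)"
    and "\<And>r l. r \<in> R \<Longrightarrow> l \<in> L \<Longrightarrow> r l \<in> J l"
    and "\<And>r r'. r \<in> R \<Longrightarrow> r' \<in> R \<Longrightarrow> (\<And>l. l \<in> L \<Longrightarrow> r l = r' l) \<Longrightarrow> r = r'"
  shows "cfun.independent_modulo (vanishing_on (Pi L A)) (\<lambda>r t. \<Prod>l\<in>L. \<phi> l (r l) (t l)) R"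
  using assms
proof (induction L arbitrary: R rule: finite_induct)
  case empty
  show ?case
    unfolding cfun.independent_modulo_def
  proof (intro allI impI ballI)
    fix F :: "('l \<Rightarrow> 'i) set" and c r
    assume F: "F \<subseteq> R" "r \<in> F"
      and vanish: "(\<Sum>r\<in>F. fun_scale (c r) (\<lambda>t :: 'l \<Rightarrow> 'p. \<Prod>l\<in>{}. \<phi> l (r l) (t l)))
          \<in> vanishing_on (Pi {} A)"
    have "F = {r}"
      using F empty.prems(3) by blast
    with vanish show "c r = 0"
      by (simp add: vanishing_on_def fun_scale_def)
  qed
next
  case (insert a L)
  show ?case
    unfolding cfun.independent_modulo_def
  proof (intro allI impI ballI)
    fix F c r0
    assume F: "finite F" "F \<subseteq> R" and r0: "r0 \<in> F"
      and vanish: "(\<Sum>r\<in>F. fun_scale (c r) (\<lambda>t. \<Prod>l\<in>insert a L. \<phi> l (r l) (t l)))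
          \<in> vanishing_on (Pi (insert a L) A)"
    let ?E = "{r \<in> F. r a = r0 a}"
    have "(\<Sum>r\<in>?E. fun_scale (c r) (\<lambda>t. \<Prod>l\<in>L. \<phi> l (r l) (t l))) \<in> vanishing_on (Pi L A)"
      using tensor_slice_vanishing[OF insert.hyps _ F(1) _ r0 vanish] insert.prems(1,2) F(2) by blast
    moreover have "cfun.independent_modulo (vanishing_on (Pi L A)) (\<lambda>r t. \<Prod>l\<in>L. \<phi> l (r l) (t l)) ?E"
    proof (rule insert.IH)
      fix r r' assume "r \<in> ?E" "r' \<in> ?E" "\<And>l. l \<in> L \<Longrightarrow> r l = r' l"
      then show "r = r'"
        using F(2) by (intro insert.prems(3)) auto
    qed (use insert.prems(1,2) F(2) in auto)
    ultimately show "c r0 = 0"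
      using cfun.independent_moduloD[of _ _ ?E ?E c r0] F(1) r0 by auto
  qed
qed

section \<open>A product of two-term complexes\<close>

lemma prod_split_subset:
  assumes "finite L" "S \<subseteq> L"
  shows "(\<Prod>l\<in>L. h l (l \<in> S)) = (\<Prod>l\<in>L - S. h l False) * (\<Prod>l\<in>S. h l True)"
  using prod.subset_diff[OF assms(2,1), of "\<lambda>l. h l (l \<in> S)"] by simp

locale product_model =
  fixes G :: "mpoly set" and L :: "nat set" and v :: "nat \<Rightarrow> nat" and w :: "nat \<Rightarrow> mpoly"
    and n i :: "nat \<Rightarrow> nat"
  assumes finite_L: "finite L" and strict_mono_v: "strict_mono v" and n_pos: "l \<in> L \<Longrightarrow> 0 < n l"
    and unit: "l \<in> L \<Longrightarrow> (Var (v l) ^ n l - 1) * w l - 1 \<in> ideal G"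
begin

definition u :: "nat \<Rightarrow> mpoly" where
  "u l = Var (v l) ^ n l - 1"

definition laurent_factor :: "nat \<Rightarrow> bool \<Rightarrow> int \<Rightarrow> mpoly" where
  "laurent_factor l \<sigma> k = Var (v l) ^ base_exp (n l) (i l) \<sigma> * unit_power (u l) (w l) k"

definition laurent_form :: "(nat \<Rightarrow> int) \<Rightarrow> nat set \<Rightarrow> dform" where
  "laurent_form m S = dterm (v ` S) (\<Prod>l\<in>L. laurent_factor l (l \<in> S) (m l))"

definition laurent_span :: "dform set" where
  "laurent_span = form.span (rels G \<union> {laurent_form m S |m S. S \<subseteq> L})"

definition basis_factor :: "nat \<Rightarrow> bool \<Rightarrow> int option \<Rightarrow> mpoly" where
  "basis_factor l \<sigma> \<rho> = factor (n l) (i l) \<sigma> \<rho> (Var (v l)) (u l) (w l)"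

definition basis_form :: "(nat \<Rightarrow> int option) \<Rightarrow> nat set \<Rightarrow> dform" where
  "basis_form r S = dterm (v ` S) (\<Prod>l\<in>L. basis_factor l (l \<in> S) (r l))"

definition basis_index :: "((nat \<Rightarrow> int option) \<times> nat set) set" where
  "basis_index = {(r, S). S \<subseteq> L \<and> (\<forall>l. l \<notin> L \<longrightarrow> r l = None) \<and> (\<forall>l\<in>L. r l \<in> factor_index (i l) (l \<in> S))}"

abbreviation harmonic :: "nat set \<Rightarrow> dform" where
  "harmonic \<equiv> basis_form (\<lambda>_. None)"

definition harmonic_sets :: "nat set set" where
  "harmonic_sets = {S. {l \<in> L. 0 < i l} \<subseteq> S \<and> S \<subseteq> L}"

lemma finite_subset_L: "S \<subseteq> L \<Longrightarrow> finite S"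
  using finite_L finite_subset by blast

lemma inj_v: "inj v"
  using strict_mono_v by (simp add: strict_mono_eq inj_def)

lemma sgn_sets_v: "sgn_sets {v l} (v ` S) = sgn_sets {l} S"
  using sgn_sets_image[OF strict_mono_v, of "{l}" S] by simp

lemma wedge_dterm_v:
  assumes "finite S" "l \<notin> S"
  shows "wedge (dterm {v l} p) (dterm (v ` S) q)
      = cmul (sgn_sets {l} S) (dterm (v ` insert l S) (p * q))"
proof -
  have "{v l} \<inter> v ` S = {}"
    using assms(2) inj_v by (auto simp: inj_eq)
  with assms(1) show ?thesis
    by (simp add: wedge_dterm sgn_sets_v mult.assoc)
qed

lemma unit_u: "l \<in> L \<Longrightarrow> u l * w l - 1 \<in> ideal G"
  by (simp add: u_def unit)

lemma harmonic_sets_index: "(\<lambda>_. None, S) \<in> basis_index \<longleftrightarrow> S \<in> harmonic_sets"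
  by (auto simp: basis_index_def harmonic_sets_def factor_index_def)

subsection \<open>Laurent forms\<close>

lemma laurent_form_spanned: "S \<subseteq> L \<Longrightarrow> laurent_form m S \<in> laurent_span"
  unfolding laurent_span_def by (rule form.span_base) blast

lemma rels_laurent_span: "\<eta> \<in> rels G \<Longrightarrow> \<eta> \<in> laurent_span"
  unfolding laurent_span_def by (rule form.span_base) blast

lemma subspace_laurent_span: "form.subspace laurent_span"
  by (simp add: laurent_span_def)

lemmas laurent_span_add = form.subspace_add[OF subspace_laurent_span]
lemmas laurent_span_cmul = form.subspace_scale[OF subspace_laurent_span]
lemmas laurent_span_sum = form.subspace_sum[OF subspace_laurent_span]

lemma laurent_span_linear:
  assumes "Vector_Spaces.linear cmul cmul T" "\<And>\<eta>. \<eta> \<in> rels G \<Longrightarrow> T \<eta> \<in> rels G"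
    and "\<And>m S. S \<subseteq> L \<Longrightarrow> T (laurent_form m S) \<in> laurent_span" "\<eta> \<in> laurent_span"
  shows "T \<eta> \<in> laurent_span"
  using assms(4) unfolding laurent_span_def
  by (rule form_pair.linear_span_into[OF assms(1), rotated 2])
    (use assms(2,3) rels_laurent_span in
      \<open>auto simp flip: laurent_span_def intro: subspace_laurent_span\<close>)

lemma laurent_span_cong: "\<eta> - \<theta> \<in> rels G \<Longrightarrow> \<theta> \<in> laurent_span \<Longrightarrow> \<eta> \<in> laurent_span"
  using laurent_span_add[OF rels_laurent_span] by fastforce

lemma pmult_laurent_form_diff:
  assumes l: "l \<in> L" and q: "q * laurent_factor l (l \<in> S) (m l) - laurent_factor l (l \<in> S) k \<in> ideal G"
  shows "pmult q (laurent_form m S) - laurent_form (m(l := k)) S \<in> rels G"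
proof -
  let ?h = "\<lambda>m l. laurent_factor l (l \<in> S) (m l)"
  let ?rest = "\<Prod>j\<in>L - {l}. ?h m j"
  have "(\<Prod>j\<in>L. ?h m j) = ?h m l * ?rest"
    using finite_L l by (rule prod.remove)
  moreover have "(\<Prod>j\<in>L. ?h (m(l := k)) j) = laurent_factor l (l \<in> S) k * (\<Prod>j\<in>L - {l}. ?h (m(l := k)) j)"
    using finite_L l by (subst prod.remove[of L l]) auto
  moreover have "(\<Prod>j\<in>L - {l}. ?h (m(l := k)) j) = ?rest"
    by (intro prod.cong) auto
  ultimately have "q * (\<Prod>j\<in>L. ?h m j) - (\<Prod>j\<in>L. ?h (m(l := k)) j)
      = (q * laurent_factor l (l \<in> S) (m l) - laurent_factor l (l \<in> S) k) * ?rest"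
    by (simp add: algebra_simps)
  then have "q * (\<Prod>j\<in>L. ?h m j) - (\<Prod>j\<in>L. ?h (m(l := k)) j) \<in> ideal G"
    using q by (simp only: ideal_mult_right)
  then show ?thesis
    by (simp add: laurent_form_def rels_dterm_ideal)
qed

lemma linear_pmult: "Vector_Spaces.linear cmul cmul (pmult p)"
  by (rule linear_formI) (simp_all add: pmult_simps cmul_def mult.commute)

lemma linear_wedge: "Vector_Spaces.linear cmul cmul (wedge \<omega>)"
  by (rule linear_formI) (simp_all add: wedge_simps)

lemma laurent_span_pmult:
  assumes l: "l \<in> L" and q: "\<And>\<sigma> k. q * laurent_factor l \<sigma> k - laurent_factor l \<sigma> (f k) \<in> ideal G"
    and \<eta>: "\<eta> \<in> laurent_span"
  shows "pmult q \<eta> \<in> laurent_span"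
proof (rule laurent_span_linear[OF linear_pmult rels_pmult _ \<eta>])
  fix m S assume "S \<subseteq> L"
  then show "pmult q (laurent_form m S) \<in> laurent_span"
    by (rule laurent_span_cong[OF pmult_laurent_form_diff[OF l q] laurent_form_spanned])
qed

lemma laurent_span_pmult_u:
  assumes "l \<in> L" "\<eta> \<in> laurent_span"
  shows "pmult (u l) \<eta> \<in> laurent_span"
proof (rule laurent_span_pmult[OF assms(1) _ assms(2), where f = "\<lambda>k. k + 1"])
  fix \<sigma> k
  have "u l * laurent_factor l \<sigma> k - laurent_factor l \<sigma> (k + 1) = Var (v l) ^ base_exp (n l) (i l) \<sigma> *
      (u l * unit_power (u l) (w l) k - unit_power (u l) (w l) (k + 1))"
    by (simp add: laurent_factor_def algebra_simps)
  then show "u l * laurent_factor l \<sigma> k - laurent_factor l \<sigma> (k + 1) \<in> ideal G"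
    using unit_power_mult_unit[OF unit_u[OF assms(1)]] by (simp only: mpoly_ring.span_scale)
qed

lemma laurent_span_pmult_w:
  assumes "l \<in> L" "\<eta> \<in> laurent_span"
  shows "pmult (w l) \<eta> \<in> laurent_span"
proof (rule laurent_span_pmult[OF assms(1) _ assms(2), where f = "\<lambda>k. k - 1"])
  fix \<sigma> k
  have "w l * laurent_factor l \<sigma> k - laurent_factor l \<sigma> (k - 1) = Var (v l) ^ base_exp (n l) (i l) \<sigma> *
      (w l * unit_power (u l) (w l) k - unit_power (u l) (w l) (k - 1))"
    by (simp add: laurent_factor_def algebra_simps)
  then show "w l * laurent_factor l \<sigma> k - laurent_factor l \<sigma> (k - 1) \<in> ideal G"
    using unit_power_mult_inverse[OF unit_u[OF assms(1)]] by (simp only: mpoly_ring.span_scale)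
qed

lemma laurent_span_pmult_Var_power:
  assumes "l \<in> L" "\<eta> \<in> laurent_span"
  shows "pmult (Var (v l) ^ n l) \<eta> \<in> laurent_span"
  using laurent_span_add[OF laurent_span_pmult_u[OF assms] assms(2)] by (simp add: u_def pmult_simps)

lemma Var_power_laurent_factor:
  assumes "l \<in> L"
  shows "Var (v l) ^ (n l - 1) * laurent_factor l False k
    = (if i l = 0 then 1 else Var (v l) ^ n l) * laurent_factor l True k"
proof -
  have "n l - 1 + i l = n l + (i l - 1)" if "i l \<noteq> 0"
    using that n_pos[OF assms] by simp
  then show ?thesis
    by (auto simp: laurent_factor_def base_exp_def simp flip: power_add mult.assoc)
qed

lemma laurent_span_wedge_dVar:
  assumes l: "l \<in> L" and \<eta>: "\<eta> \<in> laurent_span"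
  shows "wedge (dterm {v l} (Var (v l) ^ (n l - 1))) \<eta> \<in> laurent_span"
proof (rule laurent_span_linear[OF linear_wedge rels_wedge_left _ \<eta>])
  fix m S assume S: "S \<subseteq> L"
  let ?x = "Var (v l)"
  show "wedge (dterm {v l} (?x ^ (n l - 1))) (laurent_form m S) \<in> laurent_span"
  proof (cases "l \<in> S")
    case True
    then show ?thesis
      by (simp add: laurent_form_def wedge_dterm_not_disjoint rels_laurent_span)
  next
    case False
    let ?h = "\<lambda>S j. laurent_factor j (j \<in> S) (m j)"
    let ?c = "if i l = 0 then 1 else ?x ^ n l"
    have "(\<Prod>j\<in>L - {l}. ?h (insert l S) j) = (\<Prod>j\<in>L - {l}. ?h S j)"
      by (intro prod.cong) auto
    then have "?x ^ (n l - 1) * (\<Prod>j\<in>L. ?h S j) = ?c * (\<Prod>j\<in>L. ?h (insert l S) j)"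
      using finite_L l False Var_power_laurent_factor[OF l, of "m l"]
      by (simp add: prod.remove[of L l] flip: mult.assoc)
    then have "wedge (dterm {v l} (?x ^ (n l - 1))) (laurent_form m S)
        = cmul (sgn_sets {l} S) (pmult ?c (laurent_form m (insert l S)))"
      unfolding laurent_form_def wedge_dterm_v[OF finite_subset_L[OF S] False] pmult_dterm
      by (simp only:)
    moreover have "laurent_form m (insert l S) \<in> laurent_span"
      using l S by (intro laurent_form_spanned) simp
    then have "pmult ?c (laurent_form m (insert l S)) \<in> laurent_span"
      using l laurent_span_pmult_Var_power by simp
    ultimately show ?thesis
      by (simp only: laurent_span_cmul)
  qed
qed

definition basis_span :: "dform set" where
  "basis_span = form.span (rels G \<union> (\<lambda>(r, S). basis_form r S) ` basis_index)"

lemma laurent_form_in_basis_span: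
  assumes S: "S \<subseteq> L"
  shows "laurent_form m S \<in> basis_span"
proof -
  let ?W = "{p. dterm (v ` S) p \<in> basis_span}"
  have "(\<Prod>l\<in>L. laurent_factor l (l \<in> S) (m l)) \<in> ?W"
  proof (rule prod_in_subspace[OF finite_L])
    show "mpoly.subspace ?W"
      by (simp add: basis_span_def dterm.subspace_linear_preimage)
    fix l assume "l \<in> L"
    then show "laurent_factor l (l \<in> S) (m l)
        \<in> mpoly.span (basis_factor l (l \<in> S) ` factor_index (i l) (l \<in> S))"
      unfolding laurent_factor_def basis_factor_def by (intro laurent_monomial_in_span_factor n_pos)
  next
    fix x assume "\<And>l. l \<in> L \<Longrightarrow> x l \<in> basis_factor l (l \<in> S) ` factor_index (i l) (l \<in> S)"
    then have "\<forall>l\<in>L. \<exists>\<rho>. \<rho> \<in> factor_index (i l) (l \<in> S) \<and> x l = basis_factor l (l \<in> S) \<rho>"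
      by blast
    then obtain r where r: "\<forall>l\<in>L. r l \<in> factor_index (i l) (l \<in> S) \<and> x l = basis_factor l (l \<in> S) (r l)"
      unfolding bchoice_iff by blast
    let ?r = "\<lambda>l. if l \<in> L then r l else None"
    have "(?r, S) \<in> basis_index"
      using r S by (auto simp: basis_index_def)
    then have "(\<lambda>(r, S). basis_form r S) (?r, S) \<in> basis_span"
      unfolding basis_span_def by (intro form.span_base UnI2 imageI)
    moreover have "(\<Prod>l\<in>L. x l) = (\<Prod>l\<in>L. basis_factor l (l \<in> S) (?r l))"
      using r by (intro prod.cong) auto
    ultimately show "(\<Prod>l\<in>L. x l) \<in> ?W"
      by (simp add: basis_form_def)
  qed
  then show ?thesis
    by (simp add: laurent_form_def)
qed

lemma laurent_span_subset_basis_span: "laurent_span \<subseteq> basis_span"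
  unfolding laurent_span_def
proof (rule form.span_minimal)
  show "form.subspace basis_span"
    by (simp add: basis_span_def)
  have "rels G \<subseteq> basis_span"
    unfolding basis_span_def using form.span_superset by blast
  then show "rels G \<union> {laurent_form m S |m S. S \<subseteq> L} \<subseteq> basis_span"
    using laurent_form_in_basis_span by blast
qed

subsection \<open>The differential on the basis\<close>

lemma basis_form_eq:
  "S \<subseteq> L \<Longrightarrow> basis_form r S
    = pmult (\<Prod>l\<in>L - S. basis_factor l False (r l)) (dterm (v ` S) (\<Prod>l\<in>S. basis_factor l True (r l)))"
  using prod_split_subset[OF finite_L, of S "\<lambda>l \<sigma>. basis_factor l \<sigma> (r l)"]
  by (simp add: basis_form_def)

lemma ext_d_dterm_prod_basis_factor:
  assumes "finite S" "S \<subseteq> L"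
  shows "ext_d (dterm (v ` S) (\<Prod>l\<in>S. basis_factor l True (r l))) \<in> rels G"
  using assms
proof (induction S rule: finite_linorder_min_induct)
  case (insert b A)
  have "sgn_sets {b} A = 1"
    using insert.hyps by (intro sgn_sets_less) auto
  moreover have "b \<notin> A"
    using insert.hyps by auto
  ultimately have "dterm (v ` insert b A) (\<Prod>l\<in>insert b A. basis_factor l True (r l))
      = wedge (dterm {v b} (basis_factor b True (r b)))
        (dterm (v ` A) (\<Prod>l\<in>A. basis_factor l True (r l)))"
    using insert.hyps by (simp add: wedge_dterm_v)
  moreover have "ext_d (dterm {v b} (basis_factor b True (r b))) \<in> rels G"
    unfolding basis_factor_def using insert.prems unit_u n_pos by (intro ext_d_factor_True u_def) auto
  ultimately show ?case
    using insert by (simp add: ext_d_wedge rels_add rels_wedge_right rels_wedge_left)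
qed simp

lemma dpoly_prod_basis_factor:
  assumes A: "finite A" "A \<subseteq> L"
  shows "dpoly (\<Prod>l\<in>A. basis_factor l False (r l))
    - (\<Sum>l\<in>{l \<in> A. r l \<noteq> None}. pmult (\<Prod>k\<in>A - {l}. basis_factor k False (r k))
      (dterm {v l} (basis_factor l True (r l)))) \<in> rels G"
proof -
  let ?f = "\<lambda>l. basis_factor l False (r l)" and ?g = "\<lambda>l. basis_factor l True (r l)"
  have "dpoly (?f l) = 0" if "r l = None" for l
    using that by (simp add: basis_factor_def dpoly_factor_None)
  then have "dpoly (\<Prod>l\<in>A. ?f l) = (\<Sum>l\<in>{l \<in> A. r l \<noteq> None}. pmult (\<Prod>k\<in>A - {l}. ?f k) (dpoly (?f l)))"
    unfolding dpoly_prod[OF A(1)] using A(1) by (intro sum.mono_neutral_right) auto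
  then have "dpoly (\<Prod>l\<in>A. ?f l)
      - (\<Sum>l\<in>{l \<in> A. r l \<noteq> None}. pmult (\<Prod>k\<in>A - {l}. ?f k) (dterm {v l} (?g l)))
      = (\<Sum>l\<in>{l \<in> A. r l \<noteq> None}. pmult (\<Prod>k\<in>A - {l}. ?f k) (dpoly (?f l) - dterm {v l} (?g l)))"
    by (simp add: sum_subtractf pmult_simps)
  also have "\<dots> \<in> rels G"
  proof (intro rels_sum rels_pmult)
    fix l assume "l \<in> {l \<in> A. r l \<noteq> None}"
    then obtain m where "l \<in> L" "r l = Some m"
      using A(2) by auto
    then show "dpoly (?f l) - dterm {v l} (?g l) \<in> rels G"
      using dpoly_factor_Some[OF unit_u u_def n_pos] by (simp add: basis_factor_def)
  qed
  finally show ?thesis .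
qed

lemma ext_d_basis_form:
  assumes S: "S \<subseteq> L"
  shows "ext_d (basis_form r S)
      - (\<Sum>l\<in>{l \<in> L - S. r l \<noteq> None}. cmul (sgn_sets {l} S) (basis_form r (insert l S))) \<in> rels G"
proof -
  let ?f = "\<lambda>l. basis_factor l False (r l)" and ?g = "\<lambda>l. basis_factor l True (r l)"
  let ?q = "dterm (v ` S) (\<Prod>l\<in>S. ?g l)"
  let ?D = "\<Sum>l\<in>{l \<in> L - S. r l \<noteq> None}. pmult (\<Prod>k\<in>L - S - {l}. ?f k) (dterm {v l} (?g l))"
  have "wedge (dpoly (\<Prod>l\<in>L - S. ?f l) - ?D) ?q + pmult (\<Prod>l\<in>L - S. ?f l) (ext_d ?q) \<in> rels G"
    using finite_L finite_subset_L[OF S] S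
    by (intro rels_add rels_wedge_right rels_pmult dpoly_prod_basis_factor
      ext_d_dterm_prod_basis_factor) auto
  then have "ext_d (basis_form r S) - wedge ?D ?q \<in> rels G"
    by (simp add: basis_form_eq[OF S] ext_d_pmult wedge_simps algebra_simps del: pmult_dterm)
  moreover have "wedge ?D ?q
      = (\<Sum>l\<in>{l \<in> L - S. r l \<noteq> None}. cmul (sgn_sets {l} S) (basis_form r (insert l S)))"
    unfolding wedge_sum_left
  proof (rule sum.cong[OF refl])
    fix l assume "l \<in> {l \<in> L - S. r l \<noteq> None}"
    then have l: "l \<in> L" "l \<notin> S" by auto
    have "L - S - {l} = L - insert l S" by auto
    then show "wedge (pmult (\<Prod>k\<in>L - S - {l}. ?f k) (dterm {v l} (?g l))) ?q
        = cmul (sgn_sets {l} S) (basis_form r (insert l S))"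
      using l S finite_subset_L[OF S]
      by (simp add: basis_form_eq wedge_dterm_v ac_simps)
  qed
  ultimately show ?thesis by simp
qed

end

section \<open>Acyclicity away from the harmonic forms\<close>

lemma sgn_sets_insert_insert:
  assumes "finite T" "k \<noteq> l" "k \<notin> T" "l \<notin> T"
  shows "sgn_sets {k} (insert l T) * sgn_sets {l} (insert k T) = - (sgn_sets {l} T * sgn_sets {k} T)"
proof -
  have "sgn_sets {k} {l} * sgn_sets {l} {k} = -1"
    using assms(2) by (auto simp: sgn_sets_singletons)
  moreover have "sgn_sets {k} (insert l T) * sgn_sets {l} (insert k T)
      = (sgn_sets {k} {l} * sgn_sets {l} {k}) * (sgn_sets {l} T * sgn_sets {k} T)"
    using assms by (simp add: sgn_sets_insert_right[of T "{k}" l] sgn_sets_insert_right[of T "{l}" k]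
      ac_simps)
  ultimately show ?thesis by simp
qed

locale koszul_model = product_model +
  assumes independent_basis: "form.independent_modulo (rels G) (\<lambda>(r, S). basis_form r S) basis_index"
begin

definition pivot :: "(nat \<Rightarrow> int option) \<Rightarrow> nat" where
  "pivot r = (SOME l. r l \<noteq> None)"

definition homotopy_value :: "(nat \<Rightarrow> int option) \<Rightarrow> nat set \<Rightarrow> dform" where
  "homotopy_value r S = (if r \<noteq> (\<lambda>_. None) \<and> pivot r \<in> S
     then cmul (sgn_sets {pivot r} (S - {pivot r})) (basis_form r (S - {pivot r})) else 0)"

lemma pivot_not_None: "r \<noteq> (\<lambda>_. None) \<Longrightarrow> r (pivot r) \<noteq> None"
  using someI_ex[of "\<lambda>l. r l \<noteq> None"] by (simp add: pivot_def fun_eq_iff)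

lemma pivot_in_L: "(r, S) \<in> basis_index \<Longrightarrow> r \<noteq> (\<lambda>_. None) \<Longrightarrow> pivot r \<in> L"
  using pivot_not_None unfolding basis_index_def by blast

lemma basis_index_insert:
  assumes "(r, S) \<in> basis_index" "l \<in> L"
  shows "(r, insert l S) \<in> basis_index"
  using assms by (auto simp: basis_index_def factor_index_def)

lemma harmonic_in_span: "S \<in> H \<Longrightarrow> harmonic S \<in> form.span (harmonic ` H)"
  by (intro form.span_base imageI)

definition basis_operator :: "((nat \<Rightarrow> int option) \<Rightarrow> nat set \<Rightarrow> dform) \<Rightarrow> dform \<Rightarrow> dform" where
  "basis_operator y = (SOME T. Vector_Spaces.linear cmul cmul T \<and> (\<forall>\<eta>\<in>rels G. T \<eta> = 0) \<and>
     (\<forall>(r, S)\<in>basis_index. T (basis_form r S) = y r S))"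

lemma
  shows linear_basis_operator: "Vector_Spaces.linear cmul cmul (basis_operator y)"
    and basis_operator_rels: "\<And>\<eta>. \<eta> \<in> rels G \<Longrightarrow> basis_operator y \<eta> = 0"
    and basis_operator_basis: "\<And>r S. (r, S) \<in> basis_index \<Longrightarrow> basis_operator y (basis_form r S) = y r S"
proof -
  let ?P = "\<lambda>T. Vector_Spaces.linear cmul cmul T \<and> (\<forall>\<eta>\<in>rels G. T \<eta> = 0) \<and>
    (\<forall>(r, S)\<in>basis_index. T (basis_form r S) = y r S)"
  obtain T where T: "Vector_Spaces.linear cmul cmul T" "\<And>\<eta>. \<eta> \<in> rels G \<Longrightarrow> T \<eta> = 0"
    "\<And>j. j \<in> basis_index \<Longrightarrow> T ((\<lambda>(r, S). basis_form r S) j) = (\<lambda>(r, S). y r S) j"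
    by (rule form_pair.exists_linear_modulo[OF subspace_rels independent_basis,
      where y = "\<lambda>(r, S). y r S"]) blast
  have "?P T"
    using T(1,2) T(3)[of "(_, _)"] by auto
  then have "?P (basis_operator y)"
    unfolding basis_operator_def by (rule someI[of ?P])
  then show "Vector_Spaces.linear cmul cmul (basis_operator y)"
    "\<And>\<eta>. \<eta> \<in> rels G \<Longrightarrow> basis_operator y \<eta> = 0"
    "\<And>r S. (r, S) \<in> basis_index \<Longrightarrow> basis_operator y (basis_form r S) = y r S"
    by auto
qed

definition homotopy :: "dform \<Rightarrow> dform" where
  "homotopy = basis_operator homotopy_value"

definition projection :: "dform \<Rightarrow> dform" where
  "projection = basis_operator (\<lambda>r S. if r = (\<lambda>_. None) then basis_form r S else 0)"

lemma linear_homotopy: "Vector_Spaces.linear cmul cmul homotopy"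
  and homotopy_rels: "\<eta> \<in> rels G \<Longrightarrow> homotopy \<eta> = 0"
  and homotopy_basis: "(r, S) \<in> basis_index \<Longrightarrow> homotopy (basis_form r S) = homotopy_value r S"
  by (simp_all add: homotopy_def linear_basis_operator basis_operator_rels basis_operator_basis)

lemma linear_projection: "Vector_Spaces.linear cmul cmul projection"
  and projection_rels: "\<eta> \<in> rels G \<Longrightarrow> projection \<eta> = 0"
  and projection_basis: "(r, S) \<in> basis_index \<Longrightarrow>
    projection (basis_form r S) = (if r = (\<lambda>_. None) then basis_form r S else 0)"
  by (simp_all add: projection_def linear_basis_operator basis_operator_rels basis_operator_basis)

interpretation homotopy: Vector_Spaces.linear cmul cmul homotopy by (rule linear_homotopy)
interpretation projection: Vector_Spaces.linear cmul cmul projection by (rule linear_projection)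

lemma operator_ext_d_basis:
  assumes T: "Vector_Spaces.linear cmul cmul T" "\<And>\<eta>. \<eta> \<in> rels G \<Longrightarrow> T \<eta> = 0" and S: "S \<subseteq> L"
  shows "T (ext_d (basis_form r S))
      = (\<Sum>l\<in>{l \<in> L - S. r l \<noteq> None}. cmul (sgn_sets {l} S) (T (basis_form r (insert l S))))"
proof -
  interpret T: Vector_Spaces.linear cmul cmul T by fact
  show ?thesis
    using T(2)[OF ext_d_basis_form[OF S, of r]] by (simp add: T.diff T.sum T.scale)
qed

lemma homotopy_ext_d_basis:
  assumes rS: "(r, S) \<in> basis_index"
  shows "homotopy (ext_d (basis_form r S))
    = (\<Sum>k\<in>{k \<in> L - S. r k \<noteq> None}. cmul (sgn_sets {k} S) (homotopy_value r (insert k S)))"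
proof -
  have "S \<subseteq> L"
    using rS by (simp add: basis_index_def)
  then have "homotopy (ext_d (basis_form r S))
      = (\<Sum>k\<in>{k \<in> L - S. r k \<noteq> None}. cmul (sgn_sets {k} S) (homotopy (basis_form r (insert k S))))"
    by (intro operator_ext_d_basis linear_homotopy homotopy_rels)
  then show ?thesis
    using homotopy_basis[OF basis_index_insert[OF rS]] by simp
qed

lemma homotopy_identity_pivot_notin:
  assumes rS: "(r, S) \<in> basis_index" and r: "r \<noteq> (\<lambda>_. None)" and pivot: "pivot r \<notin> S"
  shows "homotopy (basis_form r S) = 0" "homotopy (ext_d (basis_form r S)) = basis_form r S"
proof -
  show "homotopy (basis_form r S) = 0"
    using homotopy_basis[OF rS] pivot by (simp add: homotopy_value_def)
  have "homotopy (ext_d (basis_form r S))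
      = (\<Sum>k\<in>{k \<in> L - S. r k \<noteq> None}. if k = pivot r then basis_form r S else 0)"
    unfolding homotopy_ext_d_basis[OF rS] using pivot r
    by (intro sum.cong) (auto simp: homotopy_value_def)
  moreover have "pivot r \<in> {k \<in> L - S. r k \<noteq> None}" "finite {k \<in> L - S. r k \<noteq> None}"
    using pivot_in_L[OF rS r] pivot_not_None[OF r] pivot finite_L by simp_all
  ultimately show "homotopy (ext_d (basis_form r S)) = basis_form r S"
    by simp
qed

lemma homotopy_identity_pivot_in:
  assumes rS: "(r, insert l S) \<in> basis_index" and r: "r \<noteq> (\<lambda>_. None)" and l: "l = pivot r" "l \<notin> S"
  shows "ext_d (homotopy (basis_form r (insert l S))) + homotopy (ext_d (basis_form r (insert l S)))
    - basis_form r (insert l S) \<in> rels G"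
proof -
  define K where "K = {k \<in> L - insert l S. r k \<noteq> None}"
  have S: "S \<subseteq> L" "finite S"
    using rS finite_subset_L by (auto simp: basis_index_def)
  have K: "{k \<in> L - S. r k \<noteq> None} = insert l K" "l \<notin> K" "finite K"
    using pivot_in_L[OF rS r] pivot_not_None[OF r] l finite_L by (auto simp: K_def)
  let ?b = "\<lambda>k. basis_form r (insert k S)"
  have h_b: "homotopy (?b l) = cmul (sgn_sets {l} S) (basis_form r S)"
    using homotopy_basis[OF rS] l r by (simp add: homotopy_value_def)
  have "homotopy (ext_d (?b l))
      = (\<Sum>k\<in>K. cmul (sgn_sets {k} (insert l S) * sgn_sets {l} (insert k S)) (?b k))"
    unfolding homotopy_ext_d_basis[OF rS] K_def
  proof (rule sum.cong[OF refl])
    fix k assume "k \<in> {k \<in> L - insert l S. r k \<noteq> None}"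
    then have "insert k (insert l S) - {l} = insert k S"
      using l(2) by auto
    then show "cmul (sgn_sets {k} (insert l S)) (homotopy_value r (insert k (insert l S)))
        = cmul (sgn_sets {k} (insert l S) * sgn_sets {l} (insert k S)) (?b k)"
      using l(1) r by (simp add: homotopy_value_def)
  qed
  also have "\<dots> = - (\<Sum>k\<in>K. cmul (sgn_sets {l} S * sgn_sets {k} S) (?b k))"
    unfolding sum_negf[symmetric] using S(2) l(2)
    by (intro sum.cong refl) (auto simp: K_def sgn_sets_insert_insert)
  finally have h_ext_d_b: "homotopy (ext_d (?b l))
      = - (\<Sum>k\<in>K. cmul (sgn_sets {l} S * sgn_sets {k} S) (?b k))" .
  have "cmul (sgn_sets {l} S) (ext_d (basis_form r S) - (\<Sum>k\<in>insert l K. cmul (sgn_sets {k} S) (?b k)))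
      \<in> rels G"
    using ext_d_basis_form[OF S(1), of r] by (simp only: K(1) rels_cmul)
  then show ?thesis
    using K by (simp add: h_b h_ext_d_b ext_d.scale cmul_simps form.scale_sum_right diff_diff_eq2
      algebra_simps)
qed

lemma homotopy_identity_basis:
  assumes rS: "(r, S) \<in> basis_index" and r: "r \<noteq> (\<lambda>_. None)"
  shows "ext_d (homotopy (basis_form r S)) + homotopy (ext_d (basis_form r S)) - basis_form r S
      \<in> rels G"
proof (cases "pivot r \<in> S")
  case True
  then show ?thesis
    using homotopy_identity_pivot_in[of r "pivot r" "S - {pivot r}"] rS r by (simp add: insert_absorb)
next
  case False
  then show ?thesis
    by (simp add: homotopy_identity_pivot_notin[OF rS r])
qed

lemma projection_ext_d:
  assumes "\<theta> \<in> basis_span"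
  shows "projection (ext_d \<theta>) = 0"
proof -
  have "projection (ext_d \<theta>) \<in> {0}"
  proof (rule form_pair.linear_span_into[OF _ form.subspace_single_0 _ assms[unfolded basis_span_def]])
    show "Vector_Spaces.linear cmul cmul (\<lambda>\<theta>. projection (ext_d \<theta>))"
      by (rule linear_formI) (simp_all add: ext_d.add ext_d.scale projection.add projection.scale)
    have "projection (ext_d (basis_form r S)) = 0" if "(r, S) \<in> basis_index" for r S
    proof -
      have "S \<subseteq> L"
        using that by (simp add: basis_index_def)
      then have "projection (ext_d (basis_form r S))
          = (\<Sum>l\<in>{l \<in> L - S. r l \<noteq> None}. cmul (sgn_sets {l} S)
            (projection (basis_form r (insert l S))))"
        by (intro operator_ext_d_basis linear_projection projection_rels)
      also have "\<dots> = 0"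
        using that by (intro sum.neutral) (auto simp: projection_basis basis_index_insert)
      finally show ?thesis .
    qed
    then show "projection (ext_d \<eta>) \<in> {0}" if "\<eta> \<in> rels G \<union> (\<lambda>(r, S). basis_form r S) ` basis_index"
      for \<eta>
      using that by (auto simp: projection_rels rels_ext_d)
  qed
  then show ?thesis by simp
qed

lemma homotopy_identity:
  assumes "\<eta> \<in> basis_span"
  shows "ext_d (homotopy \<eta>) + homotopy (ext_d \<eta>) - \<eta> + projection \<eta> \<in> rels G"
proof (rule form_pair.linear_span_into[OF _ subspace_rels _ assms[unfolded basis_span_def]])
  show "Vector_Spaces.linear cmul cmul (\<lambda>\<eta>. ext_d (homotopy \<eta>) + homotopy (ext_d \<eta>) - \<eta> + projection \<eta>)"
    by (rule linear_formI) (simp_all add: ext_d.add ext_d.scale homotopy.add homotopy.scale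
      projection.add projection.scale cmul_simps algebra_simps)
  fix \<eta> assume "\<eta> \<in> rels G \<union> (\<lambda>(r, S). basis_form r S) ` basis_index"
  then consider (rels) "\<eta> \<in> rels G" | (basis) r S where "\<eta> = basis_form r S" "(r, S) \<in> basis_index"
    by auto
  then show "ext_d (homotopy \<eta>) + homotopy (ext_d \<eta>) - \<eta> + projection \<eta> \<in> rels G"
  proof cases
    case rels
    then show ?thesis
      by (simp add: homotopy_rels projection_rels rels_ext_d rels_neg)
  next
    case basis
    show ?thesis
    proof (cases "r = (\<lambda>_. None)")
      case True
      then have "S \<subseteq> L"
        using basis(2) by (simp add: basis_index_def)
      then have "homotopy (ext_d \<eta>) = 0" "homotopy \<eta> = 0"
        using True basis by (simp_all add: operator_ext_d_basis[OF linear_homotopy homotopy_rels]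
          homotopy_basis homotopy_value_def)
      then show ?thesis
        using True basis by (simp add: projection_basis)
    next
      case False
      then show ?thesis
        using homotopy_identity_basis[OF basis(2)] basis by (simp add: projection_basis)
    qed
  qed
qed

lemma projection_in_span_harmonic:
  assumes "\<eta> \<in> basis_span"
  shows "projection \<eta> \<in> form.span (harmonic ` harmonic_sets)"
proof (rule form_pair.linear_span_into[OF linear_projection _ _ assms[unfolded basis_span_def]])
  show "projection \<eta> \<in> form.span (harmonic ` harmonic_sets)"
    if "\<eta> \<in> rels G \<union> (\<lambda>(r, S). basis_form r S) ` basis_index" for \<eta>
    using that by (auto simp: projection_rels projection_basis form.span_zero harmonic_sets_index
      harmonic_in_span)
qed simp

lemma projection_span_harmonic:
  assumes "\<eta> \<in> form.span (harmonic ` harmonic_sets)"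
  shows "projection \<eta> = \<eta>"
proof -
  have "projection \<eta> - \<eta> \<in> {0}"
  proof (rule form_pair.linear_span_into[OF _ form.subspace_single_0 _ assms])
    show "Vector_Spaces.linear cmul cmul (\<lambda>\<eta>. projection \<eta> - \<eta>)"
      by (rule linear_formI) (simp_all add: projection.add projection.scale cmul_simps)
  qed (auto simp: projection_basis harmonic_sets_index zero_fun_def)
  then show ?thesis by simp
qed

lemma closed_cohomologous_to_harmonic:
  assumes "\<eta> \<in> basis_span" "ext_d \<eta> \<in> rels G"
  obtains \<theta> where "\<theta> \<in> form.span (harmonic ` harmonic_sets)" "\<eta> - \<theta> \<in> exacts G"
proof -
  have "- (ext_d (homotopy \<eta>) + homotopy (ext_d \<eta>) - \<eta> + projection \<eta>) \<in> rels G"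
    by (rule rels_neg[OF homotopy_identity[OF assms(1)]])
  then have "\<eta> - projection \<eta> - ext_d (homotopy \<eta>) \<in> rels G"
    using homotopy_rels[OF assms(2)] by (simp add: algebra_simps)
  then show thesis
    using projection_in_span_harmonic[OF assms(1)] exactsI that by blast
qed

lemma harmonic_exact_imp_zero:
  assumes "\<eta> \<in> form.span (harmonic ` harmonic_sets)" "\<theta> \<in> basis_span" "\<eta> - ext_d \<theta> \<in> rels G"
  shows "\<eta> = 0"
proof -
  have "projection \<eta> - projection (ext_d \<theta>) = 0"
    using projection_rels[OF assms(3)] by (simp add: projection.diff)
  then show ?thesis
    by (simp add: projection_ext_d[OF assms(2)] projection_span_harmonic[OF assms(1)])
qed

lemma harmonic_closed: "S \<subseteq> L \<Longrightarrow> ext_d (harmonic S) \<in> rels G"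
  using ext_d_basis_form[of S "\<lambda>_. None"] by simp

lemma independent_harmonic: "form.independent_modulo (rels G) harmonic harmonic_sets"
  by (rule form.independent_modulo_reindex[OF independent_basis, where h = "\<lambda>S. (\<lambda>_. None, S)"
    and \<kappa> = "\<lambda>_. 1"])
    (auto simp: inj_on_def harmonic_sets_index)

context
  fixes Q :: "int \<Rightarrow> term_pred"
  assumes grading: "grading G Q"
    and Q_degree: "\<And>q m S. Q q m S \<Longrightarrow> int (card S) = q"
    and Q_spanned: "\<And>q \<eta>. form_supp (Q q) \<eta> \<Longrightarrow> \<eta> \<in> basis_span"
    and harmonic_supp: "\<And>S. S \<in> harmonic_sets \<Longrightarrow> form_supp (Q (int (card S))) (harmonic S)"
begin

lemma form_filter_harmonic:
  assumes "S \<in> harmonic_sets"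
  shows "form_filter (Q (int j)) (harmonic S) = (if card S = j then harmonic S else 0)"
proof (cases "card S = j")
  case True
  then show ?thesis
    using form_filter_supp[OF harmonic_supp[OF assms]] by simp
next
  case False
  then have "form_filter (Q (int j)) (harmonic S) = 0"
    by (intro form_filter_disjoint[OF harmonic_supp[OF assms]]) (metis Q_degree of_nat_eq_iff)
  with False show ?thesis by simp
qed

lemma independent_harmonic_modulo_exacts:
  "form.independent_modulo (exacts G) harmonic {S \<in> harmonic_sets. card S = j}"
  unfolding form.independent_modulo_def
proof (intro allI impI)
  fix F c
  assume F: "finite F" "F \<subseteq> {S \<in> harmonic_sets. card S = j}"
    and exact: "(\<Sum>S\<in>F. cmul (c S) (harmonic S)) \<in> exacts G"
  let ?\<eta> = "\<Sum>S\<in>F. cmul (c S) (harmonic S)"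
  obtain \<theta> where \<theta>: "?\<eta> - ext_d \<theta> \<in> rels G"
    using exact by (auto simp: exacts_def)
  have "form_filter (Q (int j)) ?\<eta> = ?\<eta>"
    unfolding form_filter.sum form_filter.scale
    using F(2) form_filter_harmonic by (intro sum.cong) (simp_all add: subset_iff)
  then have "?\<eta> - ext_d (form_filter (Q (int j - 1)) \<theta>) \<in> rels G"
    using form_filter_diff_ext_d_in_rels[OF grading \<theta>, of "int j"] by simp
  moreover have "?\<eta> \<in> form.span (harmonic ` harmonic_sets)"
    using F(2) by (intro form.span_sum form.span_scale form.span_base) auto
  ultimately have "?\<eta> = 0"
    using harmonic_exact_imp_zero Q_spanned[OF form_supp_filter] by blast
  then show "\<forall>S\<in>F. c S = 0"
    using form.independent_moduloD[OF independent_harmonic F(1), of c] F(2) by (auto simp: subset_iff)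
qed

lemma closed_in_span_harmonic_modulo_exacts:
  assumes "form_supp (Q (int j)) \<eta>" "ext_d \<eta> \<in> rels G"
  shows "\<exists>\<theta>\<in>form.span (harmonic ` {S \<in> harmonic_sets. card S = j}). \<eta> - \<theta> \<in> exacts G"
proof -
  let ?F = "form_filter (Q (int j))" and ?H = "harmonic ` {S \<in> harmonic_sets. card S = j}"
  obtain \<theta> where \<theta>: "\<theta> \<in> form.span (harmonic ` harmonic_sets)" "\<eta> - \<theta> \<in> exacts G"
    using closed_cohomologous_to_harmonic[OF Q_spanned] assms by blast
  have "?F \<theta> \<in> form.span ?H"
  proof (rule form_pair.linear_span_into[OF _ _ _ \<theta>(1)])
    show "Vector_Spaces.linear cmul cmul ?F" ..
    show "?F \<eta> \<in> form.span ?H" if "\<eta> \<in> harmonic ` harmonic_sets" for \<eta>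
      using that by (auto simp: form_filter_harmonic form.span_zero harmonic_in_span)
  qed simp
  moreover have "\<eta> - ?F \<theta> \<in> exacts G"
    using exacts_form_filter[OF grading \<theta>(2), of "int j"] assms(1)
    by (simp add: form_filter.diff form_filter_supp)
  ultimately show ?thesis by blast
qed

theorem harmonic_basis_modulo_exacts:
  "form.basis_modulo (exacts G) {\<eta>. form_supp (Q (int j)) \<eta> \<and> ext_d \<eta> \<in> rels G}
     harmonic {S \<in> harmonic_sets. card S = j}"
  unfolding form.basis_modulo_def
proof (intro conjI ballI image_subsetI)
  fix S assume "S \<in> {S \<in> harmonic_sets. card S = j}"
  then show "harmonic S \<in> {\<eta>. form_supp (Q (int j)) \<eta> \<and> ext_d \<eta> \<in> rels G}"
    using harmonic_supp[of S] harmonic_closed[of S] by (auto simp: harmonic_sets_def)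
qed (use independent_harmonic_modulo_exacts closed_in_span_harmonic_modulo_exacts in auto)

end

end

section \<open>Weights\<close>

text \<open>The forms supported in \<open>weight_term d n a q\<close> are the forms of degree \<open>q\<close> on which
  \<open>\<mu>\<^bsub>n 0\<^esub> \<times> \<dots> \<times> \<mu>\<^bsub>n d\<^esub>\<close> acts through the character of exponent \<open>a\<close>.\<close>

definition weight_term :: "nat \<Rightarrow> (nat \<Rightarrow> nat) \<Rightarrow> (nat \<Rightarrow> nat) \<Rightarrow> int \<Rightarrow> term_pred" where
  "weight_term d n a q m S \<longleftrightarrow> degree_term {..d} q m S \<and>
     (\<forall>k\<le>d. (lookup m k + of_bool (k \<in> S)) mod n k = a k mod n k)"

definition invariant_poly :: "nat \<Rightarrow> (nat \<Rightarrow> nat) \<Rightarrow> mpoly \<Rightarrow> bool" where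
  "invariant_poly d n p \<longleftrightarrow> poly_supp (\<lambda>m. keys m \<subseteq> {..d} \<and> (\<forall>k\<le>d. n k dvd lookup m k)) p"

lemma invariant_poly_Const [simp]: "invariant_poly d n (Const c)"
  by (auto simp: invariant_poly_def poly_supp_def Const_def split: if_splits)

lemma invariant_poly_1 [simp]: "invariant_poly d n 1"
  using invariant_poly_Const[of d n 1] by simp

lemma invariant_poly_add: "invariant_poly d n p \<Longrightarrow> invariant_poly d n q \<Longrightarrow> invariant_poly d n (p + q)"
  unfolding invariant_poly_def by (rule poly_supp_add)

lemma invariant_poly_diff: "invariant_poly d n p \<Longrightarrow> invariant_poly d n q \<Longrightarrow> invariant_poly d n (p - q)"
  unfolding invariant_poly_def by (rule poly_supp_diff)

lemma invariant_poly_mult: "invariant_poly d n p \<Longrightarrow> invariant_poly d n q \<Longrightarrow> invariant_poly d n (p * q)"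
  unfolding invariant_poly_def by (erule (1) poly_supp_mult) (auto simp: keys_add_nat lookup_add)

lemma invariant_poly_prod: "(\<And>x. x \<in> A \<Longrightarrow> invariant_poly d n (h x)) \<Longrightarrow> invariant_poly d n (\<Prod>x\<in>A. h x)"
  by (induction A rule: infinite_finite_induct) (auto intro: invariant_poly_mult)

lemma invariant_poly_Var_power: "k \<le> d \<Longrightarrow> invariant_poly d n (Var k ^ n k)"
  by (simp add: Var_power invariant_poly_def poly_supp_def lookup_single when_def)

lemma invariant_poly_uinv: "invariant_poly d n (uinv d n \<alpha> l)"
proof -
  have "uinv d n \<alpha> l = Const (- 1) * (\<Prod>k\<in>{..d} - {l}. 1 - Var k ^ n k) * Const (1 / \<alpha>)"
    by (simp add: uinv_def Const_uminus)
  then show ?thesis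
    by (simp only:) (intro invariant_poly_mult invariant_poly_prod invariant_poly_diff invariant_poly_1
        invariant_poly_Const invariant_poly_Var_power, simp)
qed

lemma invariant_poly_Ueq: "invariant_poly d n (Ueq d n \<alpha>)"
  unfolding Ueq_def
  by (intro invariant_poly_prod invariant_poly_diff invariant_poly_1 invariant_poly_Const
    invariant_poly_Var_power) simp

lemma poly_in_Ueq: "poly_in {..d} (Ueq d n \<alpha>)"
  using invariant_poly_Ueq[of d n \<alpha>] by (simp add: invariant_poly_def poly_in_def poly_supp_def)

lemma invariant_poly_subst:
  assumes "\<And>v. v \<in> W \<Longrightarrow> invariant_poly d n (\<phi> v)" "poly_in W p"
  shows "invariant_poly d n (subst_mp \<phi> p)"
  using assms(2) by (induction p rule: poly_in_induct)
    (auto intro: assms(1) invariant_poly_add invariant_poly_mult)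

lemma grading_weight_term:
  assumes "\<And>g. g \<in> G \<Longrightarrow> invariant_poly d n g"
  shows "grading G (weight_term d n a)"
  unfolding grading_def
proof (intro conjI allI impI ballI)
  fix q and m :: "nat \<Rightarrow>\<^sub>0 nat" and S and k :: nat assume S: "finite S" "k \<notin> S"
  have "lookup (m + single k 1) j + of_bool (j \<in> S) = lookup m j + of_bool (j \<in> insert k S)" for j
    using S(2) by (auto simp: lookup_add lookup_single when_def)
  moreover have "degree_term {..d} q m (insert k S) = degree_term {..d} (q - 1) (m + single k 1) S"
    using grading_degree_term[of "{}" "{..d}"] S by (simp add: grading_def)
  ultimately show "weight_term d n a q m (insert k S) = weight_term d n a (q - 1) (m + single k 1) S"
    by (simp add: weight_term_def)
next
  fix g m0 q m S assume "g \<in> G" "m0 \<in> keys g"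
  then have m0: "keys m0 \<subseteq> {..d}" "\<And>k. k \<le> d \<Longrightarrow> n k dvd lookup m0 k"
    using assms by (auto simp: invariant_poly_def poly_supp_def)
  have "(lookup (m0 + m) k + of_bool (k \<in> S)) mod n k = (lookup m k + of_bool (k \<in> S)) mod n k"
    if "k \<le> d" for k
    using m0(2)[OF that] by (auto simp: lookup_add add.assoc elim!: dvdE)
  with m0(1) show "weight_term d n a q (m0 + m) S = weight_term d n a q m S"
    by (auto simp: weight_term_def degree_term_def keys_add_nat)
qed

lemma weight_form_wedge:
  assumes "form_supp (weight_term d n a q) \<eta>" "form_supp (weight_term d n b r) \<theta>"
  shows "form_supp (weight_term d n (\<lambda>k. a k + b k) (q + r)) (wedge \<eta> \<theta>)"
proof (rule form_supp_wedge[OF assms])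
  fix m m' S T
  assume Q: "weight_term d n a q m S" "weight_term d n b r m' T"
    and ST: "finite S" "finite T" "S \<inter> T = {}"
  have "(lookup (m + m') k + of_bool (k \<in> S \<union> T)) mod n k = (a k + b k) mod n k" if "k \<le> d" for k
  proof -
    have "lookup (m + m') k + of_bool (k \<in> S \<union> T)
        = (lookup m k + of_bool (k \<in> S)) + (lookup m' k + of_bool (k \<in> T))"
      using ST(3) by (auto simp: lookup_add)
    moreover have "\<dots> mod n k = (a k + b k) mod n k"
      using Q that by (intro mod_add_cong) (simp_all add: weight_term_def)
    ultimately show ?thesis by (simp only:)
  qed
  moreover have "degree_term {..d} (q + r) (m + m') (S \<union> T)"
    using Q ST by (simp add: weight_term_def degree_term_def keys_add_nat card_Un_disjoint)
  ultimately show "weight_term d n (\<lambda>k. a k + b k) (q + r) (m + m') (S \<union> T)"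
    by (simp only: weight_term_def) blast
qed

lemma weight_form_pmult:
  assumes "invariant_poly d n p" "form_supp (weight_term d n a q) \<eta>"
  shows "form_supp (weight_term d n a q) (pmult p \<eta>)"
  using form_filter_pmult[OF grading_weight_term[of "{p}" d n a], of p q \<eta>] assms form_supp_filter
  by (metis empty_iff form_filter_supp insert_iff)

lemma weight_form_dpoly:
  assumes "invariant_poly d n p"
  shows "form_supp (weight_term d n (\<lambda>_. 0) 1) (dpoly p)"
proof -
  have "form_supp (weight_term d n (\<lambda>_. 0) (1 - 1)) (dterm {} p)"
    using assms by (simp add: form_supp_dterm invariant_poly_def poly_supp_def weight_term_def
      degree_term_def mod_eq_0_iff_dvd)
  then show ?thesis
    unfolding dpoly_ext_d by (rule form_supp_ext_d[OF grading_weight_term[of "{}"], rotated]) simp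
qed

lemma weight_form_wedge_set:
  assumes "finite S" "\<And>v. v \<in> S \<Longrightarrow> form_supp (weight_term d n (\<lambda>_. 0) 1) (w v)"
  shows "form_supp (weight_term d n (\<lambda>_. 0) (int (card S))) (wedge_set w S)"
  using assms
proof (induction S rule: finite_linorder_min_induct)
  case empty
  show ?case
    by (simp add: one_form_dterm form_supp_dterm poly_supp_def weight_term_def degree_term_def)
next
  case (insert b A)
  have "form_supp (weight_term d n (\<lambda>_. 0 + 0) (1 + int (card A))) (wedge (w b) (wedge_set w A))"
    using insert by (intro weight_form_wedge) auto
  moreover have "b \<notin> A"
    using insert.hyps by auto
  ultimately show ?case
    using insert.hyps by (simp add: wedge_set_insert_min)
qed

lemma weight_form_pullback:
  assumes "finite W" "\<And>v. v \<in> W \<Longrightarrow> invariant_poly d n (\<phi> v)" "is_form W j \<eta>"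
  shows "form_supp (weight_term d n (\<lambda>_. 0) (int j)) (pullback W \<phi> \<eta>)"
proof -
  have "pmult (subst_mp \<phi> (\<eta> S)) (wedge_set (\<lambda>v. dpoly (\<phi> v)) S)
      \<in> {\<eta>. form_supp (weight_term d n (\<lambda>_. 0) (int j)) \<eta>}"
    if "S \<subseteq> W" for S
  proof (cases "\<eta> S = 0")
    case True
    then show ?thesis
      using form.subspace_0[OF subspace_form_supp] by simp
  next
    case False
    then have "poly_in W (\<eta> S)" "j = card S" "finite S"
      using assms(3) finite_subset[OF that assms(1)] by (auto simp: is_form_def)
    then show ?thesis
      using that assms(2) by (auto intro!: weight_form_pmult invariant_poly_subst[of W]
        weight_form_wedge_set weight_form_dpoly)
  qed
  then have "pullback W \<phi> \<eta> \<in> {\<eta>. form_supp (weight_term d n (\<lambda>_. 0) (int j)) \<eta>}"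
    unfolding pullback_wedge_set by (intro form.subspace_sum subspace_form_supp) auto
  then show ?thesis by simp
qed

lemma weight_form_dterm_monomial:
  assumes "S \<subseteq> {..d}" "\<And>k. k \<le> d \<Longrightarrow> (if k \<in> S then Suc (e k) else 0) mod n k = a k mod n k"
  shows "form_supp (weight_term d n a (int (card S))) (dterm S (\<Prod>k\<in>S. Var k ^ e k))"
proof -
  have "finite S"
    using assms(1) finite_subset by blast
  then have lookup: "lookup (\<Sum>k\<in>S. single k (e k)) k = (if k \<in> S then e k else 0)" for k
    by (simp add: lookup_sum lookup_single when_def)
  then have "keys (\<Sum>k\<in>S. single k (e k)) \<subseteq> S"
    by (auto simp: in_keys_iff split: if_splits)
  moreover have "(lookup (\<Sum>k\<in>S. single k (e k)) k + of_bool (k \<in> S)) mod n k = a k mod n k"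
    if "k \<le> d" for k
    using assms(2)[OF that] lookup[of k] by (cases "k \<in> S") simp_all
  ultimately show ?thesis
    using assms(1) \<open>finite S\<close>
    by (auto simp: form_supp_dterm prod_Var_power poly_supp_def weight_term_def degree_term_def)
qed

section \<open>The variety\<close>

lemma Const_mult_Const_inverse: "a \<noteq> 0 \<Longrightarrow> Const a * Const (1 / a) = 1"
  by (simp flip: Const_mult)

lemma Ueq_in_ideal: "Ueq d n \<alpha> \<in> ideal {Ueq d n \<alpha>}"
  by (rule mpoly_ring.span_base) simp

lemma mult_uinv:
  assumes "\<alpha> \<noteq> 0" "l \<le> d"
  shows "(Var l ^ n l - 1) * uinv d n \<alpha> l = 1 + Ueq d n \<alpha> * Const (1 / \<alpha>)"
proof -
  have "(\<Prod>k\<le>d. 1 - Var k ^ n k) = (1 - Var l ^ n l) * (\<Prod>k\<in>{..d} - {l}. 1 - Var k ^ n k)"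
    using assms(2) by (intro prod.remove) auto
  then have "(Var l ^ n l - 1) * uinv d n \<alpha> l = (\<Prod>k\<le>d. 1 - Var k ^ n k) * Const (1 / \<alpha>)"
    unfolding uinv_def by (simp only:) (simp add: algebra_simps)
  then show ?thesis
    using Const_mult_Const_inverse[OF assms(1)] by (simp add: Ueq_def algebra_simps)
qed

lemma uinv_unit:
  assumes "\<alpha> \<noteq> 0" "l \<le> d"
  shows "(Var l ^ n l - 1) * uinv d n \<alpha> l - 1 \<in> ideal {Ueq d n \<alpha>}"
  by (simp add: mult_uinv[OF assms] ideal_mult_right Ueq_in_ideal)

definition dpower :: "(nat \<Rightarrow> nat) \<Rightarrow> nat \<Rightarrow> dform" where
  "dpower n k = dterm {k} (Var k ^ (n k - 1))"

lemma dpoly_Var_power_dpower: "dpoly (Var k ^ n k) = cmul (of_nat (n k)) (dpower n k)"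
  by (simp add: dpower_def dpoly_Var_power Const_of_nat)

lemma dpoly_Ueq:
  assumes "\<alpha> \<noteq> 0"
  shows "dpoly (Ueq d n \<alpha>) = cmul \<alpha> (\<Sum>k\<le>d. cmul (of_nat (n k)) (pmult (uinv d n \<alpha> k) (dpower n k)))"
proof -
  have "dpoly (Ueq d n \<alpha>) = (\<Sum>k\<le>d. pmult (\<Prod>l\<in>{..d} - {k}. 1 - Var l ^ n l) (dpoly (1 - Var k ^ n k)))"
    by (simp add: Ueq_def dpoly_simps dpoly_prod)
  also have "\<dots> = (\<Sum>k\<le>d. cmul \<alpha> (cmul (of_nat (n k)) (pmult (uinv d n \<alpha> k) (dpower n k))))"
  proof (rule sum.cong[OF refl])
    fix k
    have "(\<Prod>l\<in>{..d} - {k}. 1 - Var l ^ n l) = - (Const \<alpha> * uinv d n \<alpha> k)"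
      using Const_mult_Const_inverse[OF assms] by (simp add: uinv_def algebra_simps)
    moreover have "dpoly (1 - Var k ^ n k) = - cmul (of_nat (n k)) (dpower n k)"
      by (simp add: dpoly_simps dpoly_Var_power_dpower)
    ultimately show "pmult (\<Prod>l\<in>{..d} - {k}. 1 - Var l ^ n l) (dpoly (1 - Var k ^ n k))
        = cmul \<alpha> (cmul (of_nat (n k)) (pmult (uinv d n \<alpha> k) (dpower n k)))"
      by (simp add: dpower_def ac_simps dterm.neg)
  qed
  finally show ?thesis
    by (simp add: form.scale_sum_right)
qed

text \<open>Wedging with \<open>dg\<close> kills the relations \<open>dg \<and> \<theta>\<close>, and the coefficient of \<open>dg \<and> \<eta>\<close> at
  \<open>insert k S\<close> recovers \<open>\<eta> S\<close> at the points where \<open>\<partial>g/\<partial>x\<^sub>k \<noteq> 0\<close>.\<close>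

lemma rels_singleton_vanishing:
  assumes "\<eta> \<in> rels {g}" and k: "\<And>U. k \<in> U \<Longrightarrow> \<eta> U = 0" and S: "finite S" "k \<notin> S"
    and x: "eval_mp x g = 0" "eval_mp x (pderiv_mp k g) \<noteq> 0"
  shows "eval_mp x (\<eta> S) = 0"
proof -
  have "\<exists>a. wedge (dpoly g) \<eta> = pmult g a"
    using assms(1)
  proof (induction rule: rels_induct)
    case zero
    show ?case
      by (intro exI[of _ 0]) (simp add: wedge_simps)
  next
    case (dpoly_wedge h \<theta>)
    then show ?case
      by (intro exI[of _ 0]) (simp add: wedge_degree_one_self wedge_simps flip: wedge_assoc)
  next
    case (add \<eta> \<theta>)
    then obtain a b where "wedge (dpoly g) \<eta> = pmult g a" "wedge (dpoly g) \<theta> = pmult g b" by blast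
    then show ?case
      by (intro exI[of _ "a + b"]) (simp add: wedge_simps pmult_simps)
  qed auto
  then obtain a where a: "wedge (dpoly g) \<eta> = pmult g a" by blast
  have "wedge (dpoly g) \<eta> (insert k S)
      = (\<Sum>l\<in>insert k S. Const (sgn_sets {l} (insert k S - {l})) * pderiv_mp l g * \<eta> (insert k S - {l}))"
    using S(1) by (simp add: wedge_degree_one_left)
  also have "\<dots> = (\<Sum>l\<in>insert k S. if l = k then Const (sgn_sets {k} S) * pderiv_mp k g * \<eta> S else 0)"
    using S(2) by (intro sum.cong) (auto simp: k)
  also have "\<dots> = Const (sgn_sets {k} S) * pderiv_mp k g * \<eta> S"
    using S(1) by simp
  finally have "g * a (insert k S) = Const (sgn_sets {k} S) * pderiv_mp k g * \<eta> S"
    by (simp add: a pmult_apply)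
  from arg_cong[OF this, of "eval_mp x"] show ?thesis
    using x by simp
qed

lemma eval_mp_factor:
  "eval_mp x (factor N e \<sigma> \<rho> p u w) = factor N e \<sigma> \<rho> (eval_mp x p) (eval_mp x u) (eval_mp x w)"
  by (rule factor_ring_hom) simp_all

lemma base_exp_mod:
  assumes "e < N" and eq: "(a + of_bool \<sigma>) mod N = e mod N"
  obtains q where "a = N * q + base_exp N e \<sigma>"
proof (cases "\<sigma> \<and> e = 0")
  case True
  then have "N dvd a + 1"
    using eq by (simp add: mod_eq_0_iff_dvd)
  then obtain q where q: "a + 1 = N * q" ..
  then obtain q' where "q = Suc q'"
    by (cases q) auto
  with q True assms(1) show thesis
    by (intro that[of q']) (simp add: base_exp_def)
next
  case False
  have "N * ((a + of_bool \<sigma>) div N) + e = a + of_bool \<sigma>"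
    using mult_div_mod_eq[of N "a + of_bool \<sigma>"] eq assms(1) by simp
  with False show thesis
    by (intro that[of "(a + of_bool \<sigma>) div N"]) (auto simp: base_exp_def)
qed

lemma exists_complex_nth_root:
  assumes "0 < N"
  obtains z :: complex where "z ^ N = c"
proof (cases "c = 0")
  case True
  with assms show thesis
    by (intro that[of 0]) simp
next
  case False
  then have "card {z. z ^ N = c} \<noteq> 0"
    using assms by (simp add: card_nth_roots)
  with that show thesis
    by (auto simp: card_eq_0_iff)
qed

lemma infinite_complex_norm_ge: "infinite {z :: complex. r \<le> cmod z}"
proof -
  have "infinite (range (\<lambda>k. complex_of_real (\<bar>r\<bar> + real k)))"
    by (intro range_inj_infinite injI) simp
  moreover have "range (\<lambda>k. complex_of_real (\<bar>r\<bar> + real k)) \<subseteq> {z. r \<le> cmod z}"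
    by (auto simp: norm_of_real simp del: of_real_add)
  ultimately show ?thesis
    using infinite_super by blast
qed

locale eigenspace =
  fixes d :: nat and n :: "nat \<Rightarrow> nat" and \<alpha> :: complex and i :: "nat \<Rightarrow> nat" and k0 :: nat
  assumes d: "1 \<le> d" and n: "\<forall>k\<le>d. 1 \<le> n k" and \<alpha>: "\<alpha> \<noteq> 0"
    and i: "i \<in> Qset d n" and k0: "k0 \<le> d" "i k0 = 0"
begin

abbreviation G :: "mpoly set" where "G \<equiv> {Ueq d n \<alpha>}"
abbreviation L :: "nat set" where "L \<equiv> {..d} - {k0}"
abbreviation I :: "nat set" where "I \<equiv> Iset d i"
abbreviation w :: "nat \<Rightarrow> mpoly" where "w \<equiv> uinv d n \<alpha>"

lemma n_pos_le: "k \<le> d \<Longrightarrow> 0 < n k"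
  using n by fastforce

lemma Iset_eq: "I = {l \<in> L. 0 < i l}"
  using k0 by (auto simp: Iset_def)

sublocale product_model G L "\<lambda>l. l" w n i
  using \<alpha> n_pos_le by unfold_locales (auto simp: strict_mono_def uinv_unit)

lemma u_eq: "u k = Var k ^ n k - 1"
  by (simp add: u_def)

lemma Var_k0_power:
  defines "c \<equiv> \<alpha> * (- 1) ^ card L"
  shows "Var k0 ^ n k0 - (1 - Const c * (\<Prod>l\<in>L. w l)) \<in> ideal G"
proof -
  let ?y = "\<lambda>l. 1 - Var l ^ n l"
  define s :: mpoly where "s = (- 1) ^ card L"
  have s: "s * s = 1"
    by (simp add: s_def flip: power_mult_distrib)
  have Const_c: "Const (\<alpha> * (- 1) ^ card L) = s * Const \<alpha>"
    by (simp add: s_def Const_mult Const_power Const_uminus mult.commute)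
  have "(\<Prod>l\<in>L. ?y l) = (\<Prod>l\<in>L. - 1) * (\<Prod>l\<in>L. u l)"
    unfolding prod.distrib[symmetric] by (intro prod.cong) (simp_all add: u_eq)
  then have "(\<Prod>k\<le>d. ?y k) = ?y k0 * (s * (\<Prod>l\<in>L. u l))"
    using k0 by (simp add: prod.remove[of "{..d}" k0] s_def)
  then have Ueq: "Ueq d n \<alpha> + Const \<alpha> = ?y k0 * (s * (\<Prod>l\<in>L. u l))"
    by (simp add: Ueq_def)
  have "s * (\<Prod>l\<in>L. w l) * (Ueq d n \<alpha> + Const \<alpha>) = (s * s) * (?y k0 * (\<Prod>l\<in>L. u l * w l))"
    unfolding Ueq prod.distrib by (simp only: ac_simps)
  then have eq: "?y k0 * (\<Prod>l\<in>L. u l * w l) = s * (\<Prod>l\<in>L. w l) * (Ueq d n \<alpha> + Const \<alpha>)"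
    by (simp only: s mult_1)
  have "(\<Prod>l\<in>L. u l * w l) - (\<Prod>l\<in>L. 1) \<in> ideal G"
    by (intro ideal_diff_prod unit_u)
  then have "?y k0 * ((\<Prod>l\<in>L. u l * w l) - 1) \<in> ideal G"
    by (simp only: prod.neutral_const mpoly_ring.span_scale)
  moreover have "s * (\<Prod>l\<in>L. w l) * Ueq d n \<alpha> \<in> ideal G"
    by (intro mpoly_ring.span_scale Ueq_in_ideal)
  ultimately have "?y k0 * ((\<Prod>l\<in>L. u l * w l) - 1) - s * (\<Prod>l\<in>L. w l) * Ueq d n \<alpha> \<in> ideal G"
    by (intro mpoly_ring.span_diff)
  also have "?y k0 * ((\<Prod>l\<in>L. u l * w l) - 1) - s * (\<Prod>l\<in>L. w l) * Ueq d n \<alpha>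
      = Var k0 ^ n k0 - (1 - Const c * (\<Prod>l\<in>L. w l))"
    unfolding right_diff_distrib[of "?y k0"] eq by (simp add: c_def Const_c algebra_simps)
  finally show ?thesis .
qed

subsection \<open>Spanning by Laurent forms\<close>

lemma laurent_span_pmult_prod_w:
  assumes "finite A" "A \<subseteq> L" "\<eta> \<in> laurent_span"
  shows "pmult (\<Prod>l\<in>A. w l) \<eta> \<in> laurent_span"
  using assms(1,2)
proof (induction A rule: finite_induct)
  case (insert a A)
  then have "pmult (w a) (pmult (\<Prod>l\<in>A. w l) \<eta>) \<in> laurent_span"
    by (intro laurent_span_pmult_w) auto
  with insert.hyps show ?case by simp
qed (simp add: assms(3))

lemma laurent_span_pmult_Var_k0_power:
  assumes "\<eta> \<in> laurent_span"
  shows "pmult (Var k0 ^ n k0) \<eta> \<in> laurent_span"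
proof (rule laurent_span_cong)
  let ?c = "\<alpha> * (- 1) ^ card L"
  show "pmult (Var k0 ^ n k0) \<eta> - pmult (1 - Const ?c * (\<Prod>l\<in>L. w l)) \<eta> \<in> rels G"
    using rels_ideal[OF Var_k0_power, of \<eta>] by (simp add: pmult_simps)
  have "\<eta> + cmul (- ?c) (pmult (\<Prod>l\<in>L. w l) \<eta>) \<in> laurent_span"
    using assms by (intro laurent_span_add laurent_span_cmul laurent_span_pmult_prod_w) auto
  then show "pmult (1 - Const ?c * (\<Prod>l\<in>L. w l)) \<eta> \<in> laurent_span"
    by (simp add: pmult_simps cmul_def)
qed

lemma laurent_span_pmult_Var_power_le:
  "k \<le> d \<Longrightarrow> \<eta> \<in> laurent_span \<Longrightarrow> pmult (Var k ^ n k) \<eta> \<in> laurent_span"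
  using laurent_span_pmult_Var_power[of k \<eta>] laurent_span_pmult_Var_k0_power[of \<eta>]
  by (cases "k = k0") auto

lemma sum_dlog_in_rels: "(\<Sum>k\<le>d. cmul (of_nat (n k)) (pmult (w k) (dpower n k))) \<in> rels G"
proof -
  have "cmul (1 / \<alpha>) (dpoly (Ueq d n \<alpha>)) \<in> rels G"
    by (intro rels_cmul rels_dpoly_ideal Ueq_in_ideal)
  then show ?thesis
    using \<alpha> by (simp add: dpoly_Ueq)
qed

lemma laurent_span_wedge_dpower_k0:
  assumes "\<eta> \<in> laurent_span"
  shows "wedge (dpower n k0) \<eta> \<in> laurent_span"
proof -
  let ?dlog = "\<lambda>k. cmul (of_nat (n k)) (pmult (w k) (dpower n k))"
  define D where "D = (\<Sum>l\<in>L. pmult (u k0) (?dlog l))"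
  have "(\<Sum>k\<le>d. ?dlog k) = ?dlog k0 + (\<Sum>l\<in>L. ?dlog l)"
    using k0 by (intro sum.remove) auto
  then have "pmult (u k0) (?dlog k0) + D \<in> rels G"
    using rels_pmult[OF sum_dlog_in_rels, of "u k0"]
    by (simp add: D_def pmult_simps form_module.scale_sum_right)
  moreover have "pmult (u k0 * w k0 - 1) (cmul (of_nat (n k0)) (dpower n k0)) \<in> rels G"
    using uinv_unit[OF \<alpha> k0(1)] by (intro rels_ideal) (simp add: u_eq)
  ultimately have "(pmult (u k0) (?dlog k0) + D)
      - pmult (u k0 * w k0 - 1) (cmul (of_nat (n k0)) (dpower n k0)) \<in> rels G"
    by (rule rels_diff)
  also have "(pmult (u k0) (?dlog k0) + D)
      - pmult (u k0 * w k0 - 1) (cmul (of_nat (n k0)) (dpower n k0))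
      = cmul (of_nat (n k0)) (dpower n k0) + D"
    by (simp add: cmul_def pmult_simps algebra_simps)
  finally have "wedge (cmul (of_nat (n k0)) (dpower n k0) + D) \<eta> \<in> laurent_span"
    by (intro rels_laurent_span rels_wedge_right)
  moreover have "wedge D \<eta> \<in> laurent_span"
    unfolding D_def wedge_sum_left
  proof (rule laurent_span_sum)
    fix l assume l: "l \<in> L"
    define \<theta> where "\<theta> = cmul (of_nat (n l)) (pmult (w l) (wedge (dpower n l) \<eta>))"
    have "\<theta> \<in> laurent_span"
      unfolding \<theta>_def dpower_def
      by (intro laurent_span_cmul laurent_span_pmult_w l laurent_span_wedge_dVar[OF l assms])
    then have "pmult (Var k0 ^ n k0) \<theta> + cmul (- 1) \<theta> \<in> laurent_span"
      by (intro laurent_span_add laurent_span_cmul laurent_span_pmult_Var_k0_power)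
    also have "pmult (Var k0 ^ n k0) \<theta> + cmul (- 1) \<theta> = wedge (pmult (u k0) (?dlog l)) \<eta>"
      by (simp add: \<theta>_def u_eq pmult_simps wedge_simps)
    finally show "wedge (pmult (u k0) (?dlog l)) \<eta> \<in> laurent_span" .
  qed
  ultimately have "cmul (1 / of_nat (n k0)) (wedge (cmul (of_nat (n k0)) (dpower n k0) + D) \<eta>
      - wedge D \<eta>) \<in> laurent_span"
    by (intro laurent_span_cmul form.subspace_diff[OF subspace_laurent_span])
  then show ?thesis
    using n_pos_le[OF k0(1)] by (simp add: wedge_simps)
qed

lemma dterm_base_exp_in_laurent_span:
  assumes S: "S \<subseteq> {..d}"
  shows "dterm S (\<Prod>k\<le>d. Var k ^ base_exp (n k) (i k) (k \<in> S)) \<in> laurent_span"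
proof -
  let ?x = "\<lambda>k. Var k ^ base_exp (n k) (i k) (k \<in> S)" and ?S = "S - {k0}"
  have L_prod: "laurent_form (\<lambda>_. 0) ?S = dterm ?S (\<Prod>k\<in>L. ?x k)"
    unfolding laurent_form_def laurent_factor_def by (intro arg_cong2[where f = dterm] prod.cong) auto
  have prod: "(\<Prod>k\<le>d. ?x k) = ?x k0 * (\<Prod>k\<in>L. ?x k)"
    using k0 by (intro prod.remove) auto
  have span: "laurent_form (\<lambda>_. 0) ?S \<in> laurent_span"
    using S by (intro laurent_form_spanned) auto
  show ?thesis
  proof (cases "k0 \<in> S")
    case False
    then show ?thesis
      using span k0 unfolding L_prod prod by (simp add: base_exp_def)
  next
    case True
    have "finite ?S"
      using S finite_subset by blast
    then have wedge: "wedge (dpower n k0) (laurent_form (\<lambda>_. 0) ?S)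
        = cmul (sgn_sets {k0} ?S) (dterm S (Var k0 ^ (n k0 - 1) * (\<Prod>k\<in>L. ?x k)))"
      unfolding L_prod dpower_def using True
      by (simp add: wedge_dterm insert_absorb mult.assoc)
    have "dterm S (\<Prod>k\<le>d. ?x k)
        = cmul (sgn_sets {k0} ?S) (wedge (dpower n k0) (laurent_form (\<lambda>_. 0) ?S))"
      unfolding prod wedge form.scale_scale sgn_sets_square using True k0 by (simp add: base_exp_def)
    then show ?thesis
      by (simp only: laurent_span_cmul laurent_span_wedge_dpower_k0[OF span])
  qed
qed

lemma laurent_span_pmult_prod_Var_power:
  assumes "finite A" "A \<subseteq> {..d}" "\<eta> \<in> laurent_span"
  shows "pmult (\<Prod>k\<in>A. (Var k ^ n k) ^ q k) \<eta> \<in> laurent_span"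
  using assms(1,2)
proof (induction A rule: finite_induct)
  case (insert a A)
  have power: "pmult ((Var a ^ n a) ^ m) \<theta> \<in> laurent_span" if "\<theta> \<in> laurent_span" for m \<theta>
  proof (induction m)
    case (Suc m)
    then have "pmult (Var a ^ n a) (pmult ((Var a ^ n a) ^ m) \<theta>) \<in> laurent_span"
      using insert.prems by (intro laurent_span_pmult_Var_power_le) auto
    then show ?case by simp
  qed (simp add: that)
  have "pmult ((Var a ^ n a) ^ q a) (pmult (\<Prod>k\<in>A. (Var k ^ n k) ^ q k) \<eta>) \<in> laurent_span"
    using insert by (intro power) auto
  with insert.hyps show ?case by simp
qed (simp add: assms(3))

lemma dterm_monomial_in_laurent_span:
  assumes "weight_term d n i q m S"
  shows "dterm S (single m 1) \<in> laurent_span"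
proof -
  have m: "keys m \<subseteq> {..d}" and S: "S \<subseteq> {..d}"
    and mod: "\<forall>k\<le>d. (lookup m k + of_bool (k \<in> S)) mod n k = i k mod n k"
    using assms by (auto simp: weight_term_def degree_term_def)
  have "\<forall>k\<in>{..d}. \<exists>q. lookup m k = n k * q + base_exp (n k) (i k) (k \<in> S)"
  proof
    fix k assume "k \<in> {..d}"
    then have "i k < n k" "(lookup m k + of_bool (k \<in> S)) mod n k = i k mod n k"
      using i mod by (simp_all add: Qset_def)
    then show "\<exists>q. lookup m k = n k * q + base_exp (n k) (i k) (k \<in> S)"
      by (rule base_exp_mod) (rule exI)
  qed
  then obtain q where q: "\<forall>k\<in>{..d}. lookup m k = n k * q k + base_exp (n k) (i k) (k \<in> S)"
    unfolding bchoice_iff by blast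
  have "single m 1 = (\<Prod>k\<le>d. Var k ^ lookup m k)"
    using m by (intro monomial_eq_prod_Var) auto
  also have "\<dots> = (\<Prod>k\<le>d. (Var k ^ n k) ^ q k * Var k ^ base_exp (n k) (i k) (k \<in> S))"
    using q by (intro prod.cong) (simp_all add: power_add power_mult)
  finally have "dterm S (single m 1)
      = pmult (\<Prod>k\<le>d. (Var k ^ n k) ^ q k) (dterm S (\<Prod>k\<le>d. Var k ^ base_exp (n k) (i k) (k \<in> S)))"
    by (simp add: prod.distrib)
  then show ?thesis
    by (simp only: laurent_span_pmult_prod_Var_power dterm_base_exp_in_laurent_span[OF S] finite_atMost
      subset_refl)
qed

lemma weight_forms_spanned:
  assumes "form_supp (weight_term d n i q) \<eta>"
  shows "\<eta> \<in> basis_span"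
proof -
  have "\<eta> S = 0" if "\<not> S \<subseteq> {..d}" for S
  proof -
    have "S \<subseteq> {..d}" if "m \<in> keys (\<eta> S)" for m
      using assms that by (simp add: form_supp_def poly_supp_def weight_term_def degree_term_def)
    with that show ?thesis
      by (metis all_not_in_conv keys_eq_empty)
  qed
  then have "\<eta> = (\<Sum>S\<in>Pow {..d}. dterm S (\<eta> S))"
    by (intro dform_eq_sum_dterm) auto
  also have "\<dots> = (\<Sum>S\<in>Pow {..d}. \<Sum>m\<in>keys (\<eta> S). cmul (lookup (\<eta> S) m) (dterm S (single m 1)))"
  proof (rule sum.cong[OF refl])
    fix S
    have "\<eta> S = (\<Sum>m\<in>keys (\<eta> S). Const (lookup (\<eta> S) m) * single m 1)"
      using mpoly_sum_monomials[of "\<eta> S"] by (simp only: flip: single_eq_Const_mult)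
    then have "dterm S (\<eta> S) = dterm S (\<Sum>m\<in>keys (\<eta> S). Const (lookup (\<eta> S) m) * single m 1)"
      by (rule arg_cong)
    then show "dterm S (\<eta> S) = (\<Sum>m\<in>keys (\<eta> S). cmul (lookup (\<eta> S) m) (dterm S (single m 1)))"
      by (simp only: dterm.sum dterm.scale)
  qed
  also have "\<dots> \<in> laurent_span"
    using assms by (intro laurent_span_sum laurent_span_cmul
      dterm_monomial_in_laurent_span[where q = q])
      (auto simp: form_supp_def poly_supp_def)
  finally show ?thesis
    using laurent_span_subset_basis_span by blast
qed

subsection \<open>Independence by evaluation at points\<close>

text \<open>At large points the product of the factors \<open>1 - x\<^sub>l\<^sup>n\<close> exceeds \<open>\<alpha>\<close> in norm, so the equation has a
  solution with \<open>x\<^sub>k\<^sub>0 \<noteq> 0\<close>.\<close>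

definition large_points :: "nat \<Rightarrow> complex set" where
  "large_points l = {t. 1 + cmod \<alpha> \<le> cmod (t ^ n l - 1)}"

lemma large_points_nonzero:
  assumes "l \<in> L" "t \<in> large_points l"
  shows "t \<noteq> 0" "t ^ n l - 1 \<noteq> 0"
  using assms \<alpha> n_pos[of l] norm_ge_zero[of \<alpha>]
  by (auto simp: large_points_def zero_power simp del: norm_ge_zero)

lemma infinite_large_points:
  assumes "l \<in> L"
  shows "infinite ((\<lambda>t. t ^ n l - 1) ` large_points l)"
proof (rule infinite_super[OF _ infinite_complex_norm_ge])
  show "{z. 1 + cmod \<alpha> \<le> cmod z} \<subseteq> (\<lambda>t. t ^ n l - 1) ` large_points l"
  proof
    fix z assume "z \<in> {z. 1 + cmod \<alpha> \<le> cmod z}"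
    moreover obtain t where "t ^ n l = z + 1"
      using n_pos[OF assms] by (rule exists_complex_nth_root)
    ultimately show "z \<in> (\<lambda>t. t ^ n l - 1) ` large_points l"
      by (intro image_eqI[of _ _ t]) (simp_all add: large_points_def)
  qed
qed

lemma L_nonempty: "L \<noteq> {}"
proof -
  have "(if k0 = 0 then 1 else 0) \<in> L"
    using d by auto
  then show ?thesis by blast
qed

lemma norm_prod_large_points:
  assumes t: "t \<in> Pi L large_points"
  shows "cmod \<alpha> < cmod (\<Prod>l\<in>L. 1 - t l ^ n l)"
proof -
  have large: "1 + cmod \<alpha> \<le> cmod (1 - t l ^ n l)" if "l \<in> L" for l
    using t that by (auto simp: large_points_def norm_minus_commute)
  obtain a where a: "a \<in> L"
    using L_nonempty by blast
  have "1 \<le> (\<Prod>l\<in>L - {a}. cmod (1 - t l ^ n l))"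
  proof (rule prod_ge_1)
    fix l assume "l \<in> L - {a}"
    then have "1 + cmod \<alpha> \<le> cmod (1 - t l ^ n l)"
      by (intro large) simp
    then show "1 \<le> cmod (1 - t l ^ n l)"
      using norm_ge_zero[of \<alpha>] by linarith
  qed
  with large[OF a] have "(1 + cmod \<alpha>) * 1 \<le> cmod (1 - t a ^ n a) * (\<Prod>l\<in>L - {a}. cmod (1 - t l ^ n l))"
    by (intro mult_mono) simp_all
  also have "\<dots> = cmod (\<Prod>l\<in>L. 1 - t l ^ n l)"
    using finite_L a by (simp add: prod.remove[of L a] norm_mult prod_norm)
  finally show ?thesis by simp
qed

lemma variety_point_extends:
  assumes t: "t \<in> Pi L large_points"
  obtains x where "\<And>l. l \<in> L \<Longrightarrow> x l = t l" "eval_mp x (Ueq d n \<alpha>) = 0" "x k0 \<noteq> 0"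
proof -
  define p where "p = (\<Prod>l\<in>L. 1 - t l ^ n l)"
  have "cmod \<alpha> < cmod p"
    unfolding p_def by (rule norm_prod_large_points[OF t])
  then have p: "p \<noteq> 0" "\<alpha> \<noteq> p"
    by auto
  obtain z where z: "z ^ n k0 = 1 - \<alpha> / p"
    using n_pos_le[OF k0(1)] by (rule exists_complex_nth_root)
  let ?x = "t(k0 := z)"
  have "eval_mp ?x (Ueq d n \<alpha>) = (\<Prod>k\<le>d. 1 - ?x k ^ n k) - \<alpha>"
    by (simp add: Ueq_def eval_mp_prod)
  also have "(\<Prod>k\<le>d. 1 - ?x k ^ n k) = (1 - z ^ n k0) * (\<Prod>k\<in>L. 1 - ?x k ^ n k)"
    using k0 by (subst prod.remove[of _ k0]) auto
  also have "(\<Prod>k\<in>L. 1 - ?x k ^ n k) = p"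
    unfolding p_def by (intro prod.cong) auto
  also have "(1 - z ^ n k0) * p - \<alpha> = 0"
    using p z by simp
  finally have "eval_mp ?x (Ueq d n \<alpha>) = 0" .
  moreover have "z \<noteq> 0"
    using z p n_pos_le[OF k0(1)] by (auto simp: zero_power field_simps)
  ultimately show thesis
    by (intro that[of ?x]) auto
qed

lemma eval_mp_uinv:
  assumes "eval_mp x (Ueq d n \<alpha>) = 0" "l \<le> d"
  shows "eval_mp x (w l) = inverse (x l ^ n l - 1)"
proof -
  have "(x l ^ n l - 1) * eval_mp x (w l) = 1"
    using arg_cong[OF mult_uinv[OF \<alpha> assms(2), of n], of "eval_mp x"] assms(1) by simp
  then show ?thesis
    by (metis inverse_unique)
qed

lemma smooth_at_point:
  assumes "eval_mp x (Ueq d n \<alpha>) = 0" "x k0 \<noteq> 0"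
  shows "eval_mp x (pderiv_mp k0 (Ueq d n \<alpha>)) \<noteq> 0"
proof -
  have "pderiv_mp k0 (Ueq d n \<alpha>) = dpoly (Ueq d n \<alpha>) {k0}"
    by (simp add: dpoly_def)
  also have "\<dots> = Const \<alpha> * (\<Sum>k\<le>d. Const (of_nat (n k)) * (w k * dpower n k {k0}))"
    by (simp add: dpoly_Ueq[OF \<alpha>] form_apply)
  also have "(\<Sum>k\<le>d. Const (of_nat (n k)) * (w k * dpower n k {k0}))
      = (\<Sum>k\<le>d. if k = k0 then Const (of_nat (n k0)) * (w k0 * Var k0 ^ (n k0 - 1)) else 0)"
    by (intro sum.cong) (auto simp: dpower_def dterm_def)
  finally have "pderiv_mp k0 (Ueq d n \<alpha>) = Const (\<alpha> * of_nat (n k0)) * (w k0 * Var k0 ^ (n k0 - 1))"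
    using k0 by (simp add: Const_mult)
  moreover have "(x k0 ^ n k0 - 1) * eval_mp x (w k0) = 1"
    using arg_cong[OF mult_uinv[OF \<alpha> k0(1), of n], of "eval_mp x"] assms(1) by simp
  then have "eval_mp x (w k0) \<noteq> 0" by auto
  ultimately show ?thesis
    using \<alpha> assms(2) n_pos_le[OF k0(1)] by simp
qed

lemma basis_form_apply: "basis_form r T S = (if S = T then \<Prod>l\<in>L. basis_factor l (l \<in> S) (r l) else 0)"
  by (simp add: basis_form_def dterm_def)

lemma independent_basis_factors:
  assumes "S \<subseteq> L"
  shows "cfun.independent_modulo (vanishing_on (Pi L large_points))
    (\<lambda>r t. \<Prod>l\<in>L. factor (n l) (i l) (l \<in> S) (r l) (t l) (t l ^ n l - 1) (inverse (t l ^ n l - 1)))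
    {r. (r, S) \<in> basis_index}"
proof (rule independent_tensor[OF finite_L, where J = "\<lambda>l. factor_index (i l) (l \<in> S)"
      and \<phi> = "\<lambda>l \<rho> t. factor (n l) (i l) (l \<in> S) \<rho> t (t ^ n l - 1) (inverse (t ^ n l - 1))"])
  fix l assume l: "l \<in> L"
  show "cfun.independent_modulo (vanishing_on (large_points l))
      (\<lambda>\<rho> t. factor (n l) (i l) (l \<in> S) \<rho> t (t ^ n l - 1) (inverse (t ^ n l - 1)))
        (factor_index (i l) (l \<in> S))"
    using large_points_nonzero[OF l] by (intro factors_independent n_pos infinite_large_points l) auto
next
  fix r r' :: "nat \<Rightarrow> int option"
  assume r: "r \<in> {r. (r, S) \<in> basis_index}" "r' \<in> {r. (r, S) \<in> basis_index}" "\<And>l. l \<in> L \<Longrightarrow> r l = r' l"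
  show "r = r'"
  proof
    fix l
    show "r l = r' l"
      using r by (cases "l \<in> L") (auto simp: basis_index_def)
  qed
qed (auto simp: basis_index_def)

lemma rels_sum_basis_coefficient:
  assumes F: "finite F" "F \<subseteq> basis_index"
    and rel: "(\<Sum>j\<in>F. cmul (c j) ((\<lambda>(r, S). basis_form r S) j)) \<in> rels G"
    and S: "S \<subseteq> L"
  shows "(\<Sum>r\<in>{r. (r, S) \<in> F}. fun_scale (c (r, S))
      (\<lambda>t. \<Prod>l\<in>L. factor (n l) (i l) (l \<in> S) (r l) (t l) (t l ^ n l - 1) (inverse (t l ^ n l - 1))))
    \<in> vanishing_on (Pi L large_points)"
  unfolding sum_fun_scale_vanishing_iff
proof
  fix t assume t: "t \<in> Pi L large_points"
  let ?\<eta> = "\<Sum>j\<in>F. cmul (c j) ((\<lambda>(r, S). basis_form r S) j)"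
  obtain x where x: "\<And>l. l \<in> L \<Longrightarrow> x l = t l" "eval_mp x (Ueq d n \<alpha>) = 0" "x k0 \<noteq> 0"
    using variety_point_extends[OF t] by blast
  have coeff: "?\<eta> U = (\<Sum>(r, T)\<in>F. Const (c (r, T))
      * (if U = T then \<Prod>l\<in>L. basis_factor l (l \<in> U) (r l) else 0))" for U
    unfolding form_apply by (intro sum.cong) (auto simp: cmul_def pmult_def basis_form_apply)
  have "?\<eta> U = 0" if "k0 \<in> U" for U
    unfolding coeff using that F(2) by (intro sum.neutral) (auto simp: basis_index_def)
  then have "eval_mp x (?\<eta> S) = 0"
    using x smooth_at_point[OF x(2,3)] S finite_subset_L
    by (intro rels_singleton_vanishing[OF rel]) auto
  moreover have "?\<eta> S = (\<Sum>r\<in>{r. (r, S) \<in> F}. Const (c (r, S)) * (\<Prod>l\<in>L. basis_factor l (l \<in> S) (r l)))"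
  proof -
    have "?\<eta> S = (\<Sum>(r, T)\<in>(\<lambda>r. (r, S)) ` {r. (r, S) \<in> F}. Const (c (r, T))
        * (\<Prod>l\<in>L. basis_factor l (l \<in> S) (r l)))"
      unfolding coeff using F(1) by (intro sum.mono_neutral_cong_right) auto
    then show ?thesis
      by (simp add: sum.reindex inj_on_def)
  qed
  moreover have "eval_mp x (basis_factor l \<sigma> \<rho>)
      = factor (n l) (i l) \<sigma> \<rho> (t l) (t l ^ n l - 1) (inverse (t l ^ n l - 1))"
    if "l \<in> L" for l \<sigma> \<rho>
    using that x eval_mp_uinv[OF x(2), of l] by (simp add: basis_factor_def eval_mp_factor u_eq)
  ultimately show "(\<Sum>r\<in>{r. (r, S) \<in> F}. c (r, S) *
      (\<Prod>l\<in>L. factor (n l) (i l) (l \<in> S) (r l) (t l) (t l ^ n l - 1) (inverse (t l ^ n l - 1)))) = 0"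
    by (simp add: eval_mp_sum eval_mp_prod)
qed

lemma independent_basis_forms: "form.independent_modulo (rels G) (\<lambda>(r, S). basis_form r S) basis_index"
  unfolding form.independent_modulo_def
proof (intro allI impI ballI)
  fix F c j
  assume F: "finite F" "F \<subseteq> basis_index" "(\<Sum>j\<in>F. cmul (c j) ((\<lambda>(r, S). basis_form r S) j)) \<in> rels G"
    and "j \<in> F"
  obtain r S where j: "j = (r, S)" by (cases j)
  have S: "S \<subseteq> L"
    using F(2) \<open>j \<in> F\<close> by (auto simp: j basis_index_def)
  have "finite {r. (r, S) \<in> F}"
    using finite_vimageI[OF F(1), of "\<lambda>r. (r, S)"] by (simp add: vimage_def inj_on_def)
  then show "c j = 0"
    using cfun.independent_moduloD[OF independent_basis_factors[OF S] _ _
      rels_sum_basis_coefficient[OF F S], of r]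
      F(2) \<open>j \<in> F\<close> by (auto simp: j)
qed

sublocale koszul_model G L "\<lambda>l. l" w n i
  by unfold_locales (rule independent_basis_forms)

end

section \<open>The torus\<close>

locale split_torus =
  fixes T :: "nat set"
  assumes finite_T: "finite T"
begin

lemma Tgens_inverse: "l \<in> T \<Longrightarrow> (Var (2 * l) ^ 1 - 1) * Var (2 * l + 1) - 1 \<in> ideal (Tgens T)"
  by (rule mpoly_ring.span_base) (auto simp: Tgens_def mult.commute)

sublocale product_model "Tgens T" T "(*) 2" "\<lambda>l. Var (Suc (2 * l))" "\<lambda>_. Suc 0" "\<lambda>_. 0"
  using finite_T Tgens_inverse by unfold_locales (auto simp: strict_mono_def)

lemma finite_Tvars: "finite (Tvars T)"
  using finite_T by (simp add: Tvars_def)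

lemma finite_Tgens: "finite (Tgens T)"
  using finite_T by (simp add: Tgens_def)

lemma poly_in_Tgens: "g \<in> Tgens T \<Longrightarrow> poly_in (Tvars T) g"
  by (auto simp: Tgens_def Tvars_def intro!: poly_in_diff poly_in_mult)

lemma u_eq: "u l = Var (2 * l) - 1"
  by (simp add: u_def)

lemma laurent_span_pmult_poly:
  assumes "poly_in (Tvars T) p" "\<eta> \<in> laurent_span"
  shows "pmult p \<eta> \<in> laurent_span"
  using assms
proof (induction p arbitrary: \<eta> rule: poly_in_induct)
  case (Const c)
  then show ?case
    by (simp add: laurent_span_cmul flip: cmul_def)
next
  case (Var v)
  then consider l where "l \<in> T" "v = 2 * l" | l where "l \<in> T" "v = 2 * l + 1"
    by (auto simp: Tvars_def)
  then show ?case
    using laurent_span_pmult_Var_power[of _ \<eta>] laurent_span_pmult_w[of _ \<eta>] Var(2) by cases auto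
next
  case (add p q)
  then show ?case
    by (simp add: pmult_simps laurent_span_add)
next
  case (mult p q)
  then have "pmult p (pmult q \<eta>) \<in> laurent_span"
    by blast
  then show ?case by simp
qed

lemma laurent_span_wedge_dVar_Tvars:
  assumes v: "v \<in> Tvars T" and \<eta>: "\<eta> \<in> laurent_span"
  shows "wedge (dterm {v} 1) \<eta> \<in> laurent_span"
proof -
  obtain l where l: "l \<in> T" "v = 2 * l \<or> v = 2 * l + 1"
    using v by (auto simp: Tvars_def)
  have even: "wedge (dterm {2 * l} 1) \<eta> \<in> laurent_span"
    using laurent_span_wedge_dVar[OF l(1) \<eta>] by simp
  show ?thesis
  proof (cases "v = 2 * l")
    case False
    let ?\<theta> = "pmult (Var v * Var v) (wedge (dterm {2 * l} 1) \<eta>)"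
    have "dpoly (Var v) + pmult (Var v * Var v) (dpoly (Var (2 * l) - 1)) \<in> rels (Tgens T)"
      using False l unit_u[OF l(1)] by (intro dpoly_inverse) (simp add: u_eq)
    from rels_wedge_right[OF this, of \<eta>]
    have "wedge (dterm {v} 1) \<eta> + ?\<theta> \<in> laurent_span"
      by (intro rels_laurent_span) (simp add: dpoly_simps dpoly_Var wedge_simps del: pmult_dterm)
    moreover have "?\<theta> \<in> laurent_span"
      using v even by (intro laurent_span_pmult_poly poly_in_mult) simp_all
    ultimately have "wedge (dterm {v} 1) \<eta> + ?\<theta> - ?\<theta> \<in> laurent_span"
      by (rule form.subspace_diff[OF subspace_laurent_span])
    then show ?thesis by simp
  qed (simp add: even)
qed

lemma dterm_in_laurent_span:
  assumes "S \<subseteq> Tvars T"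
  shows "dterm S 1 \<in> laurent_span"
proof -
  have "finite S"
    using assms finite_Tvars finite_subset by blast
  then show ?thesis
    using assms
  proof (induction S rule: finite_linorder_min_induct)
    case empty
    have "laurent_form (\<lambda>_. 0) {} = dterm {} 1"
      by (simp add: laurent_form_def laurent_factor_def base_exp_def)
    then show ?case
      using laurent_form_spanned[of "{}" "\<lambda>_. 0"] by simp
  next
    case (insert b A)
    have "wedge (dterm {b} 1) (dterm A 1) \<in> laurent_span"
      using insert by (intro laurent_span_wedge_dVar_Tvars) auto
    moreover have "b \<notin> A" "sgn_sets {b} A = 1"
      using insert.hyps by (auto intro: sgn_sets_less)
    then have "wedge (dterm {b} 1) (dterm A 1) = dterm (insert b A) 1"
      using insert.hyps by (simp add: wedge_dterm)
    ultimately show ?case by simp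
  qed
qed

lemma forms_spanned:
  assumes "form_supp (degree_term (Tvars T) q) \<eta>"
  shows "\<eta> \<in> basis_span"
proof -
  have S: "S \<subseteq> Tvars T" if "\<eta> S \<noteq> 0" for S
    using assms that unfolding form_supp_def poly_supp_def degree_term_def
    by (metis all_not_in_conv keys_eq_empty)
  have "poly_in (Tvars T) (\<eta> S)" for S
    using assms by (simp add: form_supp_def poly_supp_def degree_term_def poly_in_def)
  then have "pmult (\<eta> S) (dterm S 1) \<in> laurent_span" if "S \<subseteq> Tvars T" for S
    using that by (intro laurent_span_pmult_poly dterm_in_laurent_span)
  then have "(\<Sum>S\<in>Pow (Tvars T). pmult (\<eta> S) (dterm S 1)) \<in> laurent_span"
    by (intro laurent_span_sum) simp
  also have "(\<Sum>S\<in>Pow (Tvars T). pmult (\<eta> S) (dterm S 1)) = \<eta>"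
    unfolding pmult_dterm mult_1_right using S
    by (intro dform_eq_sum_dterm[symmetric] finite_Tvars) auto
  finally show ?thesis
    using laurent_span_subset_basis_span by blast
qed

lemma harmonic_sets_eq: "harmonic_sets = Pow T"
  by (auto simp: harmonic_sets_def)

lemma form_supp_harmonic:
  assumes "S \<subseteq> T"
  shows "form_supp (degree_term (Tvars T) (int (card S))) (harmonic S)"
proof -
  have "poly_in (Tvars T) (\<Prod>l\<in>T. basis_factor l (l \<in> S) None)"
    by (intro poly_in_prod) (auto simp: basis_factor_def factor_def base_exp_def Tvars_def)
  moreover have "finite S" "card ((*) 2 ` S) = card S"
    using assms finite_T finite_subset by (auto simp: card_image inj_on_def)
  ultimately show ?thesis
    using assms by (auto simp: basis_form_def form_supp_dterm poly_supp_def poly_in_def degree_term_def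
      Tvars_def)
qed

end

section \<open>Comparison of the torus with the variety\<close>

lemma wedge_set_image:
  assumes "strict_mono v" "finite S"
  shows "wedge_set w (v ` S) = wedge_set (\<lambda>l. w (v l)) S"
  using assms(2)
proof (induction S rule: finite_linorder_min_induct)
  case (insert b A)
  have "wedge_set w (insert (v b) (v ` A)) = wedge (w (v b)) (wedge_set w (v ` A))"
    using insert.hyps by (intro wedge_set_insert_min) (auto simp: strict_mono_less[OF assms(1)])
  with insert show ?case
    by (simp add: wedge_set_insert_min)
qed simp

lemma subst_factor:
  "subst_mp \<phi> (factor N e \<sigma> \<rho> p u w) = factor N e \<sigma> \<rho> (subst_mp \<phi> p) (subst_mp \<phi> u) (subst_mp \<phi> w)"
  by (rule factor_ring_hom) simp_all

lemma factor_power_base: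
  "factor (Suc 0) 0 False \<rho> (x ^ N) u w = factor N 0 False \<rho> x u w"
  "of_nat N * x ^ (N - 1) * factor (Suc 0) 0 True \<rho> (x ^ N) u w
      = of_nat (if \<rho> = None then N else 1) * factor N 0 True \<rho> x u w"
  by (auto simp: factor_def base_exp_def split: option.splits)

context eigenspace
begin

lemma harmonic_sets_iff: "S \<in> harmonic_sets \<longleftrightarrow> I \<subseteq> S \<and> S \<subseteq> L"
  by (simp add: harmonic_sets_def Iset_eq)

lemma I_harmonic_set: "I \<in> harmonic_sets"
  by (auto simp: harmonic_sets_iff Iset_eq)

lemma harmonic_eq:
  assumes "S \<in> harmonic_sets"
  shows "harmonic S = dterm S (\<Prod>l\<in>S. Var l ^ base_exp (n l) (i l) True * w l)"
proof -
  have "(\<Prod>l\<in>L - S. basis_factor l False None) = 1"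
    using assms by (intro prod.neutral)
      (auto simp: harmonic_sets_def basis_factor_def factor_def base_exp_def)
  then show ?thesis
    using assms prod_split_subset[OF finite_L, of S "\<lambda>l \<sigma>. basis_factor l \<sigma> None"]
    by (simp add: harmonic_sets_def basis_form_def) (simp add: basis_factor_def factor_def)
qed

lemma form_supp_harmonic:
  assumes "S \<in> harmonic_sets"
  shows "form_supp (weight_term d n i (int (card S))) (harmonic S)"
proof -
  have "(if k \<in> S then Suc (base_exp (n k) (i k) True) else 0) mod n k = i k mod n k" if "k \<le> d" for k
    using assms that n_pos_le[OF that] by (auto simp: harmonic_sets_iff Iset_def base_exp_def)
  moreover have "S \<subseteq> {..d}"
    using assms by (auto simp: harmonic_sets_iff)
  ultimately have "form_supp (weight_term d n i (int (card S))) (dterm S (\<Prod>l\<in>S. Var l ^ base_exp (n l) (i l) True))"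
    by (intro weight_form_dterm_monomial)
  then have "form_supp (weight_term d n i (int (card S)))
      (pmult (\<Prod>l\<in>S. w l) (dterm S (\<Prod>l\<in>S. Var l ^ base_exp (n l) (i l) True)))"
    by (intro weight_form_pmult invariant_poly_prod invariant_poly_uinv)
  then show ?thesis
    by (simp add: harmonic_eq[OF assms] prod.distrib mult.commute)
qed

lemma omega_eq_harmonic: "omega d n \<alpha> i = harmonic I"
proof -
  have "finite I"
    by (simp add: Iset_eq)
  have "omega d n \<alpha> i = wedge_set (\<lambda>k. dterm {k} (Var k ^ (i k - 1) * w k)) I"
    by (simp only: omega_def wedge_set_def dterm_def)
  also have "\<dots> = dterm I (\<Prod>k\<in>I. Var k ^ (i k - 1) * w k)"
    using \<open>finite I\<close> by (rule wedge_set_dterm)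
  also have "(\<Prod>k\<in>I. Var k ^ (i k - 1) * w k) = (\<Prod>k\<in>I. Var k ^ base_exp (n k) (i k) True * w k)"
    by (intro prod.cong) (auto simp: Iset_eq base_exp_def)
  finally show ?thesis
    by (simp add: harmonic_eq[OF I_harmonic_set])
qed

abbreviation T :: "nat set" where "T \<equiv> Lset d i k0"
abbreviation p_map :: "nat \<Rightarrow> mpoly" where "p_map \<equiv> pmap d n \<alpha>"
abbreviation comparison :: "dform \<Rightarrow> dform" where "comparison \<equiv> omega_pull d n \<alpha> i k0"

lemma Lset_eq: "T = {l \<in> L. i l = 0}"
  by (auto simp: Lset_def Iset_def)

sublocale torus: split_torus T
  by unfold_locales (simp add: Lset_def)

lemma pmap_simps [simp]: "p_map (2 * l) = Var l ^ n l" "p_map (Suc (2 * l)) = w l"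
  by (simp_all add: pmap_def)

lemma invariant_poly_pmap: "v \<in> Tvars T \<Longrightarrow> invariant_poly d n (p_map v)"
  by (auto simp: Tvars_def Lset_eq invariant_poly_uinv intro!: invariant_poly_Var_power)

lemma subst_Tgens: "g \<in> Tgens T \<Longrightarrow> subst_mp p_map g \<in> ideal G"
  using unit_u by (auto simp: Tgens_def Lset_eq u_eq mult.commute[of "w _"])

lemma linear_comparison: "Vector_Spaces.linear cmul cmul comparison"
  by (rule linear_formI) (simp_all add: omega_pull_def pullback.add pullback.scale wedge_simps)

interpretation comparison: Vector_Spaces.linear cmul cmul comparison
  by (rule linear_comparison)

lemma comparison_rels:
  assumes "\<eta> \<in> rels (Tgens T)"
  shows "comparison \<eta> \<in> rels G"
  unfolding omega_pull_def
  by (intro rels_wedge_left pullback_rels[OF torus.finite_Tvars torus.poly_in_Tgens subst_Tgens assms])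

lemma form_supp_comparison:
  assumes "is_form (Tvars T) j \<eta>"
  shows "form_supp (weight_term d n i (int (card I + j))) (comparison \<eta>)"
proof -
  have "form_supp (weight_term d n (\<lambda>k. i k + 0) (int (card I) + int j)) (comparison \<eta>)"
    unfolding omega_pull_def omega_eq_harmonic
    by (intro weight_form_wedge form_supp_harmonic I_harmonic_set weight_form_pullback
        torus.finite_Tvars invariant_poly_pmap assms)
  then show ?thesis by simp
qed

lemma ext_d_comparison:
  assumes "is_form (Tvars T) j \<eta>"
  shows "ext_d (comparison \<eta>) - cmul ((- 1) ^ card I) (comparison (ext_d \<eta>)) \<in> rels G"
proof -
  have "poly_in (Tvars T) (\<eta> S)" for S
    using assms by (cases "\<eta> S = 0") (auto simp: is_form_def poly_in_def)
  then have pullback: "pullback (Tvars T) p_map (ext_d \<eta>) = ext_d (pullback (Tvars T) p_map \<eta>)"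
    by (intro pullback_ext_d torus.finite_Tvars)
  have "grade_involution (harmonic I) = cmul ((- 1) ^ card I) (harmonic I)"
    by (auto simp: fun_eq_iff grade_involution_def basis_form_apply form_apply Const_power Const_uminus)
  moreover have "wedge (ext_d (harmonic I)) (pullback (Tvars T) p_map \<eta>) \<in> rels G"
    using I_harmonic_set by (intro rels_wedge_right harmonic_closed) (simp add: harmonic_sets_iff)
  ultimately show ?thesis
    by (simp add: omega_pull_def omega_eq_harmonic pullback ext_d_wedge)
qed

lemma comparison_closed:
  assumes "is_form (Tvars T) j \<eta>" "ext_d \<eta> \<in> rels (Tgens T)"
  shows "ext_d (comparison \<eta>) \<in> rels G"
  using rels_add[OF ext_d_comparison[OF assms(1)]
    rels_cmul[OF comparison_rels[OF assms(2)], of "(- 1) ^ card I"]] by simp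

lemma comparison_exact:
  assumes "\<eta> - ext_d \<theta> \<in> rels (Tgens T)" "is_form (Tvars T) j \<theta>"
  shows "comparison \<eta> \<in> exacts G"
proof -
  let ?s = "(- 1) ^ card I :: complex"
  have "cmul ?s (cmul ?s \<xi>) = \<xi>" for \<xi>
    by (simp flip: power_mult_distrib)
  moreover have "comparison (\<eta> - ext_d \<theta>)
      - cmul ?s (ext_d (comparison \<theta>) - cmul ?s (comparison (ext_d \<theta>))) \<in> rels G"
    by (rule rels_diff[OF comparison_rels[OF assms(1)] rels_cmul[OF ext_d_comparison[OF assms(2)]]])
  ultimately show ?thesis
    by (intro exactsI[of _ "cmul ?s (comparison \<theta>)"])
      (simp add: ext_d.scale cmul_simps comparison.diff del: form.scale_scale)
qed

subsection \<open>The comparison on the bases\<close>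

lemma pullback_torus_basis_form:
  assumes M: "M \<subseteq> T"
  shows "pullback (Tvars T) p_map (torus.basis_form r M)
    = dterm M ((\<Prod>l\<in>M. of_nat (n l) * Var l ^ (n l - 1)) *
      (\<Prod>l\<in>T. factor (Suc 0) 0 (l \<in> M) (r l) (Var l ^ n l) (u l) (w l)))"
proof -
  have finM: "finite M"
    using M torus.finite_T finite_subset by blast
  have "(*) 2 ` M \<subseteq> Tvars T"
    using M by (auto simp: Tvars_def)
  then have "pullback (Tvars T) p_map (torus.basis_form r M)
      = pmult (subst_mp p_map (\<Prod>l\<in>T. torus.basis_factor l (l \<in> M) (r l)))
        (wedge_set (\<lambda>v. dpoly (p_map v)) ((*) 2 ` M))"
    unfolding torus.basis_form_def by (rule pullback_dterm[OF torus.finite_Tvars])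
  moreover have "wedge_set (\<lambda>v. dpoly (p_map v)) ((*) 2 ` M)
      = dterm M (\<Prod>l\<in>M. of_nat (n l) * Var l ^ (n l - 1))"
    by (simp add: wedge_set_image[OF torus.strict_mono_v finM] dpoly_Var_power wedge_set_dterm[OF finM])
  moreover have "subst_mp p_map (torus.basis_factor l \<sigma> \<rho>)
      = factor (Suc 0) 0 \<sigma> \<rho> (Var l ^ n l) (u l) (w l)" for l \<sigma> \<rho>
    by (simp add: torus.basis_factor_def subst_factor torus.u_eq u_eq)
  ultimately show ?thesis
    by (simp add: subst_prod mult.commute)
qed

definition comparison_scalar :: "(nat \<Rightarrow> int option) \<Rightarrow> nat set \<Rightarrow> complex" where
  "comparison_scalar r M = sgn_sets I M * (\<Prod>l\<in>M. of_nat (if r l = None then n l else 1))"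

lemma comparison_scalar_nonzero:
  assumes "M \<subseteq> T"
  shows "comparison_scalar r M \<noteq> 0"
proof -
  have "finite M" "\<And>l. l \<in> M \<Longrightarrow> 0 < n l"
    using assms n_pos finite_subset[OF _ torus.finite_T] by (auto simp: Lset_eq)
  then show ?thesis
    by (auto simp: comparison_scalar_def)
qed

lemma torus_basis_indexD:
  assumes "(r, M) \<in> torus.basis_index"
  shows "M \<subseteq> T" "\<And>l. l \<notin> T \<Longrightarrow> r l = None" "finite M" "finite I" "I \<inter> M = {}" "I \<inter> T = {}"
proof -
  show "M \<subseteq> T" "\<And>l. l \<notin> T \<Longrightarrow> r l = None"
    using assms by (auto simp: torus.basis_index_def)
  then show "finite M" "finite I" "I \<inter> M = {}" "I \<inter> T = {}"
    using finite_subset[OF _ torus.finite_T] by (auto simp: Iset_eq Lset_eq)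
qed

lemma prod_torus_factors:
  assumes rM: "(r, M) \<in> torus.basis_index"
  shows "(\<Prod>l\<in>M. of_nat (n l) * Var l ^ (n l - 1)) *
      (\<Prod>l\<in>T. factor (Suc 0) 0 (l \<in> M) (r l) (Var l ^ n l) (u l) (w l))
    = (\<Prod>l\<in>M. of_nat (if r l = None then n l else 1)) * (\<Prod>l\<in>T. basis_factor l (l \<in> I \<union> M) (r l))"
proof -
  note M = torus_basis_indexD(1)[OF rM] and disj = torus_basis_indexD(6)[OF rM]
  let ?f = "\<lambda>l. basis_factor l (l \<in> I \<union> M) (r l)"
  let ?g = "\<lambda>l. factor (Suc 0) 0 (l \<in> M) (r l) (Var l ^ n l) (u l) (w l)"
  let ?c = "\<lambda>l. of_nat (if r l = None then n l else 1) :: mpoly"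
  have f_M: "of_nat (n l) * Var l ^ (n l - 1) * ?g l = ?c l * ?f l" if "l \<in> M" for l
    using that M factor_power_base(2)[of "n l" "Var l" "r l" "u l" "w l"]
    by (auto simp: Lset_eq basis_factor_def)
  have f_T: "?g l = ?f l" if "l \<in> T - M" for l
  proof -
    have "i l = 0" "l \<notin> I \<union> M" "l \<notin> M"
      using that disj by (auto simp: Lset_eq)
    then show ?thesis
      using factor_power_base(1)[of "r l" "Var l" "n l" "u l" "w l"] by (simp add: basis_factor_def)
  qed
  have "(\<Prod>l\<in>M. of_nat (n l) * Var l ^ (n l - 1)) * (\<Prod>l\<in>T. ?g l)
      = (\<Prod>l\<in>M. of_nat (n l) * Var l ^ (n l - 1) * ?g l) * (\<Prod>l\<in>T - M. ?g l)"
    using prod.subset_diff[OF M torus.finite_T, of ?g] by (simp add: prod.distrib ac_simps)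
  also have "\<dots> = (\<Prod>l\<in>M. ?c l * ?f l) * (\<Prod>l\<in>T - M. ?f l)"
    by (simp only: prod.cong[OF refl f_M] prod.cong[OF refl f_T])
  also have "\<dots> = (\<Prod>l\<in>M. ?c l) * (\<Prod>l\<in>T. ?f l)"
    using prod.subset_diff[OF M torus.finite_T, of ?f] by (simp add: prod.distrib ac_simps)
  finally show ?thesis .
qed

lemma comparison_basis_form:
  assumes rM: "(r, M) \<in> torus.basis_index"
  shows "comparison (torus.basis_form r M) = cmul (comparison_scalar r M) (basis_form r (I \<union> M))"
proof -
  note index = torus_basis_indexD[OF rM]
  let ?f = "\<lambda>l. basis_factor l (l \<in> I \<union> M) (r l)"
  let ?c = "\<lambda>l. of_nat (if r l = None then n l else 1) :: mpoly"
  have "r l = None" if "l \<in> I" for l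
    using that index(6) by (intro index(2)) blast
  then have prod_I: "(\<Prod>l\<in>I. Var l ^ base_exp (n l) (i l) True * w l) = (\<Prod>l\<in>I. ?f l)"
    by (intro prod.cong) (simp_all add: basis_factor_def factor_def)
  have "comparison (torus.basis_form r M)
      = wedge (dterm I (\<Prod>l\<in>I. ?f l)) (dterm M ((\<Prod>l\<in>M. ?c l) * (\<Prod>l\<in>T. ?f l)))"
    by (simp only: omega_pull_def omega_eq_harmonic harmonic_eq[OF I_harmonic_set] prod_I
        pullback_torus_basis_form[OF index(1)] prod_torus_factors[OF rM])
  also have "\<dots> = dterm (I \<union> M) (Const (sgn_sets I M) * (\<Prod>l\<in>M. ?c l) * ((\<Prod>l\<in>I. ?f l) * (\<Prod>l\<in>T. ?f l)))"
    using index by (simp add: wedge_dterm ac_simps)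
  also have "(\<Prod>l\<in>I. ?f l) * (\<Prod>l\<in>T. ?f l) = (\<Prod>l\<in>I \<union> T. ?f l)"
    using index torus.finite_T by (intro prod.union_disjoint[symmetric]) auto
  also have "I \<union> T = L"
    by (auto simp: Iset_eq Lset_eq)
  also have "Const (sgn_sets I M) * (\<Prod>l\<in>M. ?c l) = Const (comparison_scalar r M)"
    by (simp add: comparison_scalar_def Const_mult Const_prod Const_of_nat)
  finally show ?thesis
    by (simp add: basis_form_def)
qed

lemma basis_index_union_I:
  assumes "(r, M) \<in> torus.basis_index"
  shows "(r, I \<union> M) \<in> basis_index" "I \<inter> M = {}"
  using assms unfolding torus.basis_index_def basis_index_def factor_index_def by (auto simp: Lset_eq Iset_eq)

lemma independent_comparison_basis_forms:
  "form.independent_modulo (rels G) (\<lambda>(r, M). comparison (torus.basis_form r M)) torus.basis_index"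
proof (rule form.independent_modulo_reindex[OF independent_basis,
    where h = "\<lambda>(r, M). (r, I \<union> M)" and \<kappa> = "\<lambda>(r, M). comparison_scalar r M"])
  show "inj_on (\<lambda>(r, M). (r, I \<union> M)) torus.basis_index"
    using basis_index_union_I(2) by (auto simp: inj_on_def)
qed (auto simp: basis_index_union_I comparison_basis_form comparison_scalar_nonzero
  torus.basis_index_def)

sublocale torus: koszul_model "Tgens T" T "(*) 2" "\<lambda>l. Var (Suc (2 * l))" "\<lambda>_. Suc 0" "\<lambda>_. 0"
proof unfold_locales
  show "form.independent_modulo (rels (Tgens T)) (\<lambda>(r, S). torus.basis_form r S) torus.basis_index"
    by (rule form_pair.independent_modulo_linear_vimage[OF linear_comparison, where Z' = "rels G"])
      (use comparison_rels independent_comparison_basis_forms in \<open>auto simp: case_prod_unfold\<close>)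
qed

end

section \<open>Eigenspaces\<close>

lemma HU_closed_iff: "\<eta> \<in> HU_closed d n \<alpha> j \<longleftrightarrow> is_form {..d} j \<eta> \<and> ext_d \<eta> \<in> rels {Ueq d n \<alpha>}"
  unfolding HU_closed_def Uvars_def by (rule closed_forms_iff) (auto simp: poly_in_Ueq)

lemma HU_exact_eq: "HU_exact d n \<alpha> j = exacts {Ueq d n \<alpha>} \<inter> {\<eta>. is_form {..d} j \<eta>}"
  unfolding HU_exact_def Uvars_def by (rule exact_forms_eq) (auto simp: poly_in_Ueq)

lemma subspace_HU_exact: "form.subspace (HU_exact d n \<alpha> j)"
  unfolding HU_exact_eq by (intro form.subspace_inter subspace_exacts subspace_is_form) simp

lemma subspace_HU_closed: "form.subspace (HU_closed d n \<alpha> j)"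
  unfolding HU_closed_def Uvars_def by (rule subspace_closed_forms) (auto simp: poly_in_Ueq)

lemma lookup_act_poly: "lookup (act_poly \<nu> p) m = (\<Prod>k\<in>keys m. \<nu> k ^ lookup m k) * lookup p m"
proof -
  have "{m. (\<Prod>k\<in>keys m. \<nu> k ^ lookup m k) * lookup p m \<noteq> 0} \<subseteq> keys p"
    by (auto simp: in_keys_iff)
  then have "finite {m. (\<Prod>k\<in>keys m. \<nu> k ^ lookup m k) * lookup p m \<noteq> 0}"
    by (rule finite_subset) simp
  then show ?thesis
    unfolding act_poly_def by (simp add: Abs_poly_mapping_inverse)
qed

lemma dform_eqI: "(\<And>S m. lookup (\<eta> S) m = lookup (\<theta> S) m) \<Longrightarrow> \<eta> = (\<theta> :: dform)"
  by (rule ext) (rule poly_mapping_eqI)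

lemma lookup_act_form:
  "lookup (act_form \<nu> \<eta> S) m = (\<Prod>k\<in>S. \<nu> k) * (\<Prod>k\<in>keys m. \<nu> k ^ lookup m k) * lookup (\<eta> S) m"
  by (simp add: act_form_def lookup_act_poly)

interpretation act_form: Vector_Spaces.linear cmul cmul "act_form \<nu>" for \<nu>
  by (rule linear_formI; rule dform_eqI)
    (simp_all add: lookup_act_form form_apply lookup_add distrib_left mult.left_commute)

lemma form_filter_act_form: "form_filter Q (act_form \<nu> \<eta>) = act_form \<nu> (form_filter Q \<eta>)"
  by (rule dform_eqI) (simp add: form_filter_def lookup_poly_filter lookup_act_form)

lemma power_mod_mu:
  assumes "z \<in> mu N" "a mod N = b mod N"
  shows "z ^ a = z ^ b"
proof -
  have "z ^ c = z ^ (c mod N)" for c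
  proof -
    have "z ^ c = (z ^ N) ^ (c div N) * z ^ (c mod N)"
      by (simp flip: power_mult power_add)
    then show ?thesis
      using assms(1) by (simp add: mu_def)
  qed
  with assms(2) show ?thesis by metis
qed

lemma act_form_weight:
  assumes "form_supp (weight_term d n a q) \<eta>" "\<forall>k\<le>d. \<nu> k \<in> mu (n k)"
  shows "act_form \<nu> \<eta> = cmul (chi d a \<nu>) \<eta>"
proof (rule dform_eqI)
  fix S m
  show "lookup (act_form \<nu> \<eta> S) m = lookup (cmul (chi d a \<nu>) \<eta> S) m"
  proof (cases "m \<in> keys (\<eta> S)")
    case True
    then have "weight_term d n a q m S"
      using assms(1) by (simp add: form_supp_def poly_supp_def)
    then have S: "S \<subseteq> {..d}" "keys m \<subseteq> {..d}" "finite S"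
      and mod: "\<And>k. k \<le> d \<Longrightarrow> (lookup m k + of_bool (k \<in> S)) mod n k = a k mod n k"
      by (auto simp: weight_term_def degree_term_def)
    have "(\<Prod>k\<in>S. \<nu> k) = (\<Prod>k\<le>d. \<nu> k ^ of_bool (k \<in> S))"
      using S by (intro prod.mono_neutral_cong_left) auto
    moreover have "(\<Prod>k\<in>keys m. \<nu> k ^ lookup m k) = (\<Prod>k\<le>d. \<nu> k ^ lookup m k)"
      using S by (intro prod.mono_neutral_left) (auto simp: in_keys_iff)
    ultimately have "(\<Prod>k\<in>S. \<nu> k) * (\<Prod>k\<in>keys m. \<nu> k ^ lookup m k)
        = (\<Prod>k\<le>d. \<nu> k ^ (lookup m k + of_bool (k \<in> S)))"
      by (simp add: power_add prod.distrib mult.commute)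
    also have "\<dots> = chi d a \<nu>"
      unfolding chi_def
    proof (rule prod.cong[OF refl])
      fix k assume "k \<in> {..d}"
      then show "\<nu> k ^ (lookup m k + of_bool (k \<in> S)) = \<nu> k ^ a k"
        using assms(2) mod by (intro power_mod_mu[of _ "n k"]) simp_all
    qed
    finally show ?thesis
      by (simp add: lookup_act_form form_apply)
  qed (simp add: lookup_act_form form_apply in_keys_iff)
qed

definition weight_box :: "nat \<Rightarrow> (nat \<Rightarrow> nat) \<Rightarrow> (nat \<Rightarrow> nat) set" where
  "weight_box d n = {a. (\<forall>k\<le>d. a k < n k) \<and> (\<forall>k>d. a k = 0)}"

lemma Qset_subset_weight_box: "Qset d n \<subseteq> weight_box d n"
  by (auto simp: Qset_def weight_box_def)

lemma finite_weight_box: "finite (weight_box d n)"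
proof (rule finite_subset)
  show "finite {a. \<forall>k. (k \<in> {..d} \<longrightarrow> a k \<in> (\<Union>k\<le>d. {..<n k})) \<and> (k \<notin> {..d} \<longrightarrow> a k = 0)}"
    by (intro finite_set_of_finite_funs) auto
qed (auto simp: weight_box_def)

lemma sum_weight_components:
  assumes "\<forall>k\<le>d. 1 \<le> n k" "form_supp (degree_term {..d} q) \<eta>"
  shows "(\<Sum>a\<in>weight_box d n. form_filter (weight_term d n a q) \<eta>) = \<eta>"
proof (rule dform_eqI)
  fix S m
  let ?a = "\<lambda>k. if k \<le> d then (lookup m k + of_bool (k \<in> S)) mod n k else 0"
  have a: "?a \<in> weight_box d n"
    using assms(1) by (auto simp: weight_box_def Suc_le_eq)
  have "weight_term d n a q m S \<longleftrightarrow> a = ?a" if "m \<in> keys (\<eta> S)" "a \<in> weight_box d n" for a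
    using that assms(2) by (auto simp: weight_term_def form_supp_def poly_supp_def weight_box_def
      fun_eq_iff)
  then have "(\<Sum>a\<in>weight_box d n. lookup (form_filter (weight_term d n a q) \<eta> S) m)
      = (\<Sum>a\<in>weight_box d n. if a = ?a then lookup (\<eta> S) m else 0)"
    by (intro sum.cong) (auto simp: form_filter_def lookup_poly_filter in_keys_iff)
  then show "lookup ((\<Sum>a\<in>weight_box d n. form_filter (weight_term d n a q) \<eta>) S) m = lookup (\<eta> S) m"
    using a finite_weight_box by (simp add: form_apply lookup_sum)
qed

lemma mu_separates:
  assumes "e < N" "f < N" "e \<noteq> f"
  obtains \<zeta> where "\<zeta> \<in> mu N" "\<zeta> ^ e \<noteq> \<zeta> ^ f"
proof -
  define \<zeta> where "\<zeta> = cis (2 * pi / N)"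
  have "0 < N"
    using assms(1) by simp
  have power: "\<zeta> ^ k = cis (2 * pi * real k / real N)" for k
    by (simp add: \<zeta>_def DeMoivre mult_ac)
  have "inj_on (\<lambda>k. \<zeta> ^ k) {..<N}"
    using bij_betw_roots_unity[OF \<open>0 < N\<close>] by (simp add: power bij_betw_def)
  then have "\<zeta> ^ e \<noteq> \<zeta> ^ f"
    using assms by (simp add: inj_on_eq_iff)
  moreover have "\<zeta> \<in> mu N"
    using power[of N] \<open>0 < N\<close> by (simp add: mu_def)
  ultimately show thesis
    by (intro that)
qed

lemma chi_separates:
  assumes "a \<in> weight_box d n" "b \<in> weight_box d n" "a \<noteq> b"
  obtains \<nu> where "\<forall>k\<le>d. \<nu> k \<in> mu (n k)" "chi d a \<nu> \<noteq> chi d b \<nu>"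
proof -
  obtain k where k: "a k \<noteq> b k"
    using assms(3) by blast
  then have "k \<le> d"
    using assms(1,2) by (cases "k \<le> d") (simp_all add: weight_box_def)
  then obtain \<zeta> where \<zeta>: "\<zeta> \<in> mu (n k)" "\<zeta> ^ a k \<noteq> \<zeta> ^ b k"
    using mu_separates[of "a k" "n k" "b k"] assms(1,2) k by (auto simp: weight_box_def)
  let ?\<nu> = "(\<lambda>_. 1)(k := \<zeta>)"
  have "chi d c ?\<nu> = \<zeta> ^ c k" for c
  proof -
    have "chi d c ?\<nu> = (\<Prod>l\<le>d. if l = k then \<zeta> ^ c k else 1)"
      unfolding chi_def by (intro prod.cong) auto
    then show ?thesis
      using \<open>k \<le> d\<close> by simp
  qed
  moreover have "\<forall>l\<le>d. ?\<nu> l \<in> mu (n l)"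
    using \<zeta>(1) by (simp add: mu_def)
  ultimately show thesis
    by (intro that[of ?\<nu>]) (simp_all only: \<zeta>(2) not_False_eq_True)
qed

lemma grading_weight_Ueq: "grading {Ueq d n \<alpha>} (weight_term d n a)"
  by (rule grading_weight_term) (simp add: invariant_poly_Ueq)

lemma is_form_weight: "form_supp (weight_term d n a (int j)) \<eta> \<Longrightarrow> is_form {..d} j \<eta>"
  by (simp add: is_form_iff_form_supp) (erule form_supp_mono, simp add: weight_term_def)

lemma weight_component_exact:
  assumes a: "a \<in> weight_box d n" "i \<in> weight_box d n" "a \<noteq> i"
    and eigen: "\<And>\<nu>. \<forall>k\<le>d. \<nu> k \<in> mu (n k) \<Longrightarrow> act_form \<nu> \<eta> - cmul (chi d i \<nu>) \<eta> \<in> exacts {Ueq d n \<alpha>}"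
  shows "form_filter (weight_term d n a q) \<eta> \<in> exacts {Ueq d n \<alpha>}"
proof -
  let ?F = "form_filter (weight_term d n a q)"
  obtain \<nu> where \<nu>: "\<forall>k\<le>d. \<nu> k \<in> mu (n k)" "chi d a \<nu> \<noteq> chi d i \<nu>"
    using chi_separates[OF a] by blast
  have "act_form \<nu> (?F \<eta>) = cmul (chi d a \<nu>) (?F \<eta>)"
    by (rule act_form_weight[OF form_supp_filter \<nu>(1)])
  then have "?F (act_form \<nu> \<eta> - cmul (chi d i \<nu>) \<eta>) = cmul (chi d a \<nu> - chi d i \<nu>) (?F \<eta>)"
    by (simp add: form_filter.diff form_filter.scale form_filter_act_form cmul_simps)
  then have "cmul (chi d a \<nu> - chi d i \<nu>) (?F \<eta>) \<in> exacts {Ueq d n \<alpha>}"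
    using exacts_form_filter[OF grading_weight_Ueq eigen[OF \<nu>(1)]] by metis
  from form.subspace_scale[OF subspace_exacts this, of "1 / (chi d a \<nu> - chi d i \<nu>)"] show ?thesis
    using \<nu>(2) by simp
qed

lemma eig_closed_diff_weight_component:
  assumes n: "\<forall>k\<le>d. 1 \<le> n k" and i: "i \<in> weight_box d n" and \<eta>: "\<eta> \<in> eig_closed d n \<alpha> i j"
  shows "\<eta> - form_filter (weight_term d n i (int j)) \<eta> \<in> exacts {Ueq d n \<alpha>}"
proof -
  let ?F = "\<lambda>a. form_filter (weight_term d n a (int j)) \<eta>"
  have "form_supp (degree_term {..d} (int j)) \<eta>"
    using \<eta> by (simp add: eig_closed_def HU_closed_iff is_form_iff_form_supp)
  then have "\<eta> = (\<Sum>a\<in>weight_box d n. ?F a)"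
    using sum_weight_components[OF n] by simp
  also have "\<dots> = ?F i + (\<Sum>a\<in>weight_box d n - {i}. ?F a)"
    using finite_weight_box i by (rule sum.remove)
  finally have "\<eta> - ?F i = (\<Sum>a\<in>weight_box d n - {i}. ?F a)"
    by (simp add: diff_eq_eq add.commute)
  also have "\<dots> \<in> exacts {Ueq d n \<alpha>}"
  proof (intro form.subspace_sum subspace_exacts)
    fix a assume "a \<in> weight_box d n - {i}"
    then show "?F a \<in> exacts {Ueq d n \<alpha>}"
      using i \<eta> by (intro weight_component_exact[of a d n i]) (auto simp: eig_closed_def HU_exact_eq)
  qed
  finally show ?thesis .
qed

lemma weight_closed_in_eig_closed:
  assumes "form_supp (weight_term d n i (int j)) \<eta>" "ext_d \<eta> \<in> rels {Ueq d n \<alpha>}"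
  shows "\<eta> \<in> eig_closed d n \<alpha> i j"
  using assms form.subspace_0[OF subspace_HU_exact]
  by (simp add: eig_closed_def HU_closed_iff is_form_weight act_form_weight)

lemma subspace_eig_closed: "form.subspace (eig_closed d n \<alpha> i j)"
proof -
  have "form.subspace {\<eta>. act_form \<nu> \<eta> - cmul (chi d i \<nu>) \<eta> \<in> HU_exact d n \<alpha> j}" for \<nu>
  proof -
    interpret Vector_Spaces.linear cmul cmul "\<lambda>\<eta>. act_form \<nu> \<eta> - cmul (chi d i \<nu>) \<eta>"
      by (rule linear_formI) (simp_all add: act_form.add act_form.scale cmul_simps mult.commute)
    show ?thesis
      by (rule subspace_linear_preimage) (rule subspace_HU_exact)
  qed
  then have "form.subspace (HU_closed d n \<alpha> j \<inter>
      (\<Inter>\<nu>\<in>{\<nu>. \<forall>k\<le>d. \<nu> k \<in> mu (n k)}. {\<eta>. act_form \<nu> \<eta> - cmul (chi d i \<nu>) \<eta> \<in> HU_exact d n \<alpha> j}))"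
    by (intro form.subspace_inter subspace_HU_closed form.subspace_Inter) blast
  also have "\<dots> = eig_closed d n \<alpha> i j"
    by (auto simp: eig_closed_def)
  finally show ?thesis .
qed

section \<open>The cohomology of an eigenspace\<close>

lemma quot_dim_basis_modulo:
  assumes "form.basis_modulo B A b J" "finite J"
  shows "quot_dim A B (card J)"
proof -
  obtain h where h: "bij_betw h {..<card J} J"
    using ex_bij_betw_nat_finite[OF assms(2)] by (auto simp: atLeast0LessThan)
  have sum: "(\<Sum>k<card J. cmul (c (h k)) (b (h k))) = (\<Sum>j\<in>J. cmul (c j) (b j))" for c
    using h by (rule sum.reindex_bij_betw)
  have inv: "the_inv_into {..<card J} h (h k) = k" if "k < card J" for k
    using h that by (intro the_inv_into_f_f) (auto simp: bij_betw_def)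
  show ?thesis
    unfolding quot_dim_def
  proof (intro exI[of _ "b \<circ> h"] conjI allI impI ballI)
    show "(b \<circ> h) k \<in> A" if "k < card J" for k
      using that assms(1) bij_betwE[OF h] by (auto simp: form.basis_modulo_def)
    fix c k assume c: "(\<Sum>k<card J. cmul (c k) ((b \<circ> h) k)) \<in> B" and k: "k < card J"
    define a where "a j = c (the_inv_into {..<card J} h j)" for j
    have "(\<Sum>k<card J. cmul (c k) ((b \<circ> h) k)) = (\<Sum>j\<in>J. cmul (a j) (b j))"
      unfolding sum[symmetric] by (intro sum.cong) (simp_all add: a_def inv)
    then have "\<forall>j\<in>J. a j = 0"
      using assms c unfolding form.basis_modulo_def form.independent_modulo_def by auto
    then show "c k = 0"
      using bij_betwE[OF h] k by (auto simp: a_def inv dest: bspec[of _ _ "h k"])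
  next
    fix v assume "v \<in> A"
    then obtain y where y: "y \<in> form.span (b ` J)" "v - y \<in> B"
      using assms(1) by (auto simp: form.basis_modulo_def)
    obtain c where "y = (\<Sum>j\<in>J. cmul (c j) (b j))"
      using form.in_span_image_finiteE[OF y(1) assms(2)] .
    then show "\<exists>c. v - (\<Sum>k<card J. cmul (c k) ((b \<circ> h) k)) \<in> B"
      using y(2) sum[of c] by (intro exI[of _ "c \<circ> h"]) simp
  qed
qed

context eigenspace
begin

lemma i_in_weight_box: "i \<in> weight_box d n"
  using i Qset_subset_weight_box by blast

lemma eig_closed_basis:
  "form.basis_modulo (HU_exact d n \<alpha> j) (eig_closed d n \<alpha> i j) harmonic {S \<in> harmonic_sets. card S = j}"
  unfolding HU_exact_eq
proof (rule form.basis_modulo_restrict)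
  let ?V = "{\<eta>. form_supp (weight_term d n i (int j)) \<eta> \<and> ext_d \<eta> \<in> rels G}"
  show basis: "form.basis_modulo (exacts G) ?V harmonic {S \<in> harmonic_sets. card S = j}"
    using grading_weight_Ueq _ weight_forms_spanned form_supp_harmonic
    by (rule harmonic_basis_modulo_exacts) (simp add: weight_term_def degree_term_def)
  show "harmonic ` {S \<in> harmonic_sets. card S = j} \<subseteq> eig_closed d n \<alpha> i j"
    using basis weight_closed_in_eig_closed by (auto simp: form.basis_modulo_def)
  show "eig_closed d n \<alpha> i j \<subseteq> {\<eta>. is_form {..d} j \<eta>}"
    by (auto simp: eig_closed_def HU_closed_iff)
  fix \<eta> assume \<eta>: "\<eta> \<in> eig_closed d n \<alpha> i j"
  let ?\<eta> = "form_filter (weight_term d n i (int j)) \<eta>"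
  have "ext_d \<eta> \<in> rels G"
    using \<eta> by (simp add: eig_closed_def HU_closed_iff)
  then have "ext_d ?\<eta> \<in> rels G"
    using rels_form_filter[OF grading_weight_Ueq, of "ext_d \<eta>" d n \<alpha> i "int j + 1"]
      form_filter_ext_d[OF grading_weight_Ueq, of d n i "int j + 1" \<eta>] by simp
  then show "\<exists>\<theta>\<in>?V. \<eta> - \<theta> \<in> exacts G"
    using form_supp_filter eig_closed_diff_weight_component[OF n i_in_weight_box \<eta>] by blast
qed (simp_all add: subspace_exacts subspace_is_form)

lemma torus_closed_basis:
  "form.basis_modulo (exact_forms (Tvars T) (Tgens T) j) (closed_forms (Tvars T) (Tgens T) j)
    torus.harmonic {M \<in> torus.harmonic_sets. card M = j}"
proof -
  note T_finite = torus.finite_Tvars torus.finite_Tgens torus.poly_in_Tgens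
  let ?V = "{\<eta>. form_supp (degree_term (Tvars T) (int j)) \<eta> \<and> ext_d \<eta> \<in> rels (Tgens T)}"
  have closed: "closed_forms (Tvars T) (Tgens T) j = ?V"
    using closed_forms_iff[OF T_finite] by (auto simp: is_form_iff_form_supp torus.finite_Tvars)
  have exact: "exact_forms (Tvars T) (Tgens T) j = exacts (Tgens T) \<inter> {\<eta>. is_form (Tvars T) j \<eta>}"
    by (intro exact_forms_eq T_finite)
  have grading: "grading (Tgens T) (degree_term (Tvars T))"
    by (rule grading_degree_term) (rule torus.poly_in_Tgens)
  have basis: "form.basis_modulo (exacts (Tgens T)) ?V
      torus.harmonic {M \<in> torus.harmonic_sets. card M = j}"
    using grading _ torus.forms_spanned
    by (rule torus.harmonic_basis_modulo_exacts)
      (simp_all add: degree_term_def torus.harmonic_sets_eq torus.form_supp_harmonic)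
  show ?thesis
    unfolding exact closed
  proof (rule form.basis_modulo_restrict[OF basis subspace_exacts])
    show "torus.harmonic ` {M \<in> torus.harmonic_sets. card M = j} \<subseteq> ?V"
      using basis by (simp add: form.basis_modulo_def)
    show "\<exists>\<theta>\<in>?V. \<eta> - \<theta> \<in> exacts (Tgens T)" if "\<eta> \<in> ?V" for \<eta>
      using that rels_exacts[OF rels_0] by (intro bexI[of _ \<eta>]) simp_all
  qed (auto simp: subspace_is_form torus.finite_Tvars is_form_iff_form_supp)
qed

end

context eigenspace
begin

interpretation comparison: Vector_Spaces.linear cmul cmul comparison
  by (rule linear_comparison)

lemma comparison_harmonic:
  assumes "M \<in> torus.harmonic_sets"
  shows "comparison (torus.harmonic M) = cmul (comparison_scalar (\<lambda>_. None) M) (harmonic (I \<union> M))"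
  using assms by (intro comparison_basis_form) (simp add: torus.harmonic_sets_index)

lemma bij_betw_harmonic_sets:
  "bij_betw ((\<union>) I) {M \<in> torus.harmonic_sets. card M = j} {S \<in> harmonic_sets. card S = card I + j}"
proof (rule bij_betw_byWitness[where f' = "\<lambda>S. S - I"])
  have disj: "M \<inter> I = {}" if "M \<subseteq> T" for M
    using that by (auto simp: Lset_eq Iset_eq)
  have fin: "finite M" if "M \<subseteq> T" for M
    using that torus.finite_T finite_subset by blast
  have "I \<union> T = L" "finite I"
    by (auto simp: Lset_eq Iset_eq)
  with disj fin show "(\<union>) I ` {M \<in> torus.harmonic_sets. card M = j}
      \<subseteq> {S \<in> harmonic_sets. card S = card I + j}"
    by (auto simp: torus.harmonic_sets_eq harmonic_sets_iff card_Un_disjoint Int_commute)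
  show "(\<lambda>S. S - I) ` {S \<in> harmonic_sets. card S = card I + j} \<subseteq> {M \<in> torus.harmonic_sets. card M = j}"
    using \<open>I \<union> T = L\<close> \<open>finite I\<close>
    by (auto simp: torus.harmonic_sets_eq harmonic_sets_iff card_Diff_subset)
qed (unfold torus.harmonic_sets_eq, auto simp: harmonic_sets_iff Lset_eq Iset_eq)

lemma independent_comparison_harmonic:
  "form.independent_modulo (HU_exact d n \<alpha> (card I + j)) (\<lambda>M. comparison (torus.harmonic M)) {M
      \<in> torus.harmonic_sets. card M = j}"
proof (rule form.independent_modulo_reindex)
  show "form.independent_modulo (HU_exact d n \<alpha> (card I + j)) harmonic {S \<in> harmonic_sets. card S
      = card I + j}"
    using eig_closed_basis by (simp add: form.basis_modulo_def)
qed (use bij_betw_harmonic_sets[of j] in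
    \<open>auto simp: bij_betw_def comparison_harmonic comparison_scalar_nonzero torus.harmonic_sets_eq\<close>)

lemma comparison_closed_in_eig_closed:
  assumes "x \<in> closed_forms (Tvars T) (Tgens T) j"
  shows "comparison x \<in> eig_closed d n \<alpha> i (card I + j)"
proof -
  have "is_form (Tvars T) j x" "ext_d x \<in> rels (Tgens T)"
    using assms rel_forms_rels by (auto simp: closed_forms_def)
  then show ?thesis
    by (intro weight_closed_in_eig_closed form_supp_comparison comparison_closed)
qed

lemma comparison_exact_in_HU_exact:
  assumes "x \<in> exact_forms (Tvars T) (Tgens T) j"
  shows "comparison x \<in> HU_exact d n \<alpha> (card I + j)"
proof -
  obtain \<theta> where x: "is_form (Tvars T) j x" "x - ext_d \<theta> \<in> rel_forms (Tvars T) (Tgens T) j"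
    and \<theta>: "if j = 0 then \<theta> = 0 else is_form (Tvars T) (j - 1) \<theta>"
    using assms unfolding exact_forms_def by blast
  have "is_form (Tvars T) (j - 1) \<theta>"
    using \<theta> by (cases "j = 0") (simp_all add: is_form_def form_apply)
  with rel_forms_rels[OF x(2)] have "comparison x \<in> exacts G"
    by (rule comparison_exact)
  then show ?thesis
    using x(1) by (simp add: HU_exact_eq is_form_weight[OF form_supp_comparison])
qed

lemma comparison_injective:
  assumes "x \<in> closed_forms (Tvars T) (Tgens T) j" "comparison x \<in> HU_exact d n \<alpha> (card I + j)"
  shows "x \<in> exact_forms (Tvars T) (Tgens T) j"
proof (rule form_pair.basis_modulo_linear_injective[OF linear_comparison _ subspace_HU_exact _
  torus_closed_basis independent_comparison_harmonic assms])
  have "exact_forms (Tvars T) (Tgens T) j = exacts (Tgens T) \<inter> {\<eta>. is_form (Tvars T) j \<eta>}"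
    by (intro exact_forms_eq torus.finite_Tvars torus.finite_Tgens torus.poly_in_Tgens)
  then show "form.subspace (exact_forms (Tvars T) (Tgens T) j)"
    by (simp add: form.subspace_inter subspace_exacts subspace_is_form torus.finite_Tvars)
  show "comparison ` exact_forms (Tvars T) (Tgens T) j \<subseteq> HU_exact d n \<alpha> (card I + j)"
    using comparison_exact_in_HU_exact by blast
qed

lemma comparison_surjective:
  assumes "\<eta> \<in> eig_closed d n \<alpha> i (card I + j)"
  shows "\<exists>x\<in>closed_forms (Tvars T) (Tgens T) j. \<eta> - comparison x \<in> HU_exact d n \<alpha> (card I + j)"
proof (rule form_pair.basis_modulo_linear_surjective[OF linear_comparison _ eig_closed_basis _ assms])
  show subspace: "form.subspace (closed_forms (Tvars T) (Tgens T) j)"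
    by (intro subspace_closed_forms torus.finite_Tvars torus.finite_Tgens torus.poly_in_Tgens)
  show "harmonic ` {S \<in> harmonic_sets. card S = card I + j}
      \<subseteq> comparison ` closed_forms (Tvars T) (Tgens T) j"
  proof
    fix \<eta> assume "\<eta> \<in> harmonic ` {S \<in> harmonic_sets. card S = card I + j}"
    then obtain S where \<eta>: "\<eta> = harmonic S" and "S \<in> {S \<in> harmonic_sets. card S = card I + j}"
      by (rule imageE)
    then have "S \<in> (\<union>) I ` {M \<in> torus.harmonic_sets. card M = j}"
      using bij_betw_imp_surj_on[OF bij_betw_harmonic_sets[of j]] by (simp only:)
    then obtain M where S: "S = I \<union> M" and M: "M \<in> {M \<in> torus.harmonic_sets. card M = j}"
      by (rule imageE)
    let ?x = "cmul (1 / comparison_scalar (\<lambda>_. None) M) (torus.harmonic M)"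
    have "?x \<in> closed_forms (Tvars T) (Tgens T) j"
      using M torus_closed_basis[of j]
      by (intro form.subspace_scale[OF subspace]) (auto simp: form.basis_modulo_def)
    moreover have "comparison ?x = \<eta>"
      using M by (simp add: comparison.scale comparison_harmonic \<eta> S comparison_scalar_nonzero
        torus.harmonic_sets_eq)
    ultimately show "\<eta> \<in> comparison ` closed_forms (Tvars T) (Tgens T) j"
      by blast
  qed
qed

lemma card_I_le: "card I \<le> d"
proof -
  have "card I \<le> card L"
    by (intro card_mono) (auto simp: Iset_eq)
  then show ?thesis
    using k0 by simp
qed

lemma card_harmonic_sets:
  assumes "j \<le> d"
  shows "card {S \<in> harmonic_sets. card S = j} = (d - card I) choose (d - j)"
proof (cases "card I \<le> j")
  case True
  have "finite I" "I \<subseteq> L"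
    by (auto simp: Iset_eq)
  then have "card (L - I) = card L - card I"
    by (rule card_Diff_subset)
  moreover have "L - I = T"
    by (auto simp: Lset_eq Iset_eq)
  ultimately have "card T = d - card I"
    using k0 by simp
  have "card {S \<in> harmonic_sets. card S = j} = card {M. M \<subseteq> T \<and> card M = j - card I}"
    using bij_betw_same_card[OF bij_betw_harmonic_sets[of "j - card I"]] True
    by (simp add: torus.harmonic_sets_eq)
  also have "\<dots> = (d - card I) choose (j - card I)"
    using n_subsets[OF torus.finite_T] \<open>card T = d - card I\<close> by simp
  also have "\<dots> = (d - card I) choose (d - j)"
    using assms True binomial_symmetric[of "j - card I" "d - card I"] by simp
  finally show ?thesis .
next
  case False
  have "card I \<le> card S" if "S \<in> harmonic_sets" for S
    using that finite_subset_L by (intro card_mono) (auto simp: harmonic_sets_iff)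
  then have "{S \<in> harmonic_sets. card S = j} = {}"
    using False by auto
  moreover have "(d - card I) choose (d - j) = 0"
    using False card_I_le by (intro binomial_eq_0) simp
  ultimately show ?thesis
    by (simp only: card.empty)
qed

lemma quot_dim_eig_closed:
  assumes "j \<le> d"
  shows "quot_dim (eig_closed d n \<alpha> i j) (HU_exact d n \<alpha> j) ((d - card I) choose (d - j))"
proof -
  have "finite harmonic_sets"
    by (rule finite_subset[of _ "Pow L"]) (auto simp: harmonic_sets_def)
  then show ?thesis
    using quot_dim_basis_modulo[OF eig_closed_basis, of j] card_harmonic_sets[OF assms] by simp
qed

lemma eig_closed_exact_below:
  assumes "j < card I"
  shows "eig_closed d n \<alpha> i j \<subseteq> HU_exact d n \<alpha> j"
proof
  fix \<eta> assume "\<eta> \<in> eig_closed d n \<alpha> i j"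
  moreover have "j \<le> d" "d - card I < d - j"
    using assms card_I_le by auto
  then have "quot_dim (eig_closed d n \<alpha> i j) (HU_exact d n \<alpha> j) 0"
    using quot_dim_eig_closed[of j] by (simp add: binomial_eq_0)
  ultimately show "\<eta> \<in> HU_exact d n \<alpha> j"
    by (simp add: quot_dim_def)
qed

end

section \<open>Logarithmic forms\<close>

definition log_monomial :: "nat \<Rightarrow> (nat \<Rightarrow> nat) \<Rightarrow> complex \<Rightarrow> nat set \<Rightarrow> (nat \<Rightarrow> nat) \<Rightarrow> dform" where
  "log_monomial d n \<alpha> K f = dterm K (\<Prod>k\<in>K. Var k ^ f k * uinv d n \<alpha> k)"

definition dlog_poly :: "nat \<Rightarrow> nat \<Rightarrow> complex \<Rightarrow> mpoly" where
  "dlog_poly N k z = (\<Sum>m<N. Const (z ^ (N - 1 - m)) * Var k ^ m)"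

lemma gen_form_eq:
  assumes "finite K"
  shows "gen_form d n \<alpha> K \<nu> = dterm K (\<Prod>k\<in>K. dlog_poly (n k) k (\<nu> k) * uinv d n \<alpha> k)"
proof -
  have "dlog_form d n \<alpha> k z = dterm {k} (dlog_poly (n k) k z * uinv d n \<alpha> k)" for k z
    by (auto simp: dlog_form_def dterm_def dlog_poly_def fun_eq_iff)
  then have "gen_form d n \<alpha> K \<nu> = wedge_set (\<lambda>k. dterm {k} (dlog_poly (n k) k (\<nu> k) * uinv d n \<alpha> k)) K"
    by (simp only: gen_form_def wedge_set_def)
  then show ?thesis
    by (simp only: wedge_set_dterm[OF assms])
qed

lemma sum_mu:
  assumes "0 < N"
  shows "(\<Sum>z\<in>mu N. z ^ e) = (if N dvd e then of_nat N else 0)"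
proof (cases "N dvd e")
  case True
  have "z ^ e = 1" if "z \<in> mu N" for z
    using power_mod_mu[OF that, of e 0] True by simp
  then have "(\<Sum>z\<in>mu N. z ^ e) = of_nat (card (mu N))"
    by simp
  also have "card (mu N) = N"
    using card_roots_unity_eq[OF assms] by (simp add: mu_def)
  finally show ?thesis
    using True by simp
next
  case False
  then obtain \<zeta> where \<zeta>: "\<zeta> \<in> mu N" "\<zeta> ^ (e mod N) \<noteq> \<zeta> ^ 0"
    using mu_separates[of "e mod N" N 0] assms by (auto simp: mod_eq_0_iff_dvd)
  have "\<zeta> ^ e \<noteq> 1"
    using \<zeta> power_mod_mu[OF \<zeta>(1), of e "e mod N"] by simp
  have "\<zeta> \<noteq> 0"
    using \<zeta>(1) assms by (auto simp: mu_def zero_power)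
  then have "bij_betw (\<lambda>z. \<zeta> * z) (mu N) (mu N)"
    using \<zeta>(1) by (intro bij_betw_byWitness[where f' = "\<lambda>z. z / \<zeta>"])
      (auto simp: mu_def power_mult_distrib power_divide)
  from sum.reindex_bij_betw[OF this, of "\<lambda>z. z ^ e"]
  have "\<zeta> ^ e * (\<Sum>z\<in>mu N. z ^ e) = (\<Sum>z\<in>mu N. z ^ e)"
    by (simp add: power_mult_distrib sum_distrib_left)
  then show ?thesis
    using \<open>\<zeta> ^ e \<noteq> 1\<close> False by simp
qed

lemma dvd_add_diff_iff:
  fixes N :: nat
  assumes "f < N" "m < N"
  shows "N dvd f + N - m \<longleftrightarrow> m = f"
proof
  assume "N dvd f + N - m"
  then obtain q where q: "f + N - m = N * q" ..
  have "0 < N * q" "N * q < N * 2"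
    using assms by (simp_all flip: q)
  then have "q = 1" by simp
  with q assms show "m = f" by simp
qed simp

lemma Var_power_fourier:
  assumes "f < N"
  shows "(\<Sum>z\<in>mu N. Const (z ^ (f + 1) / of_nat N) * dlog_poly N k z) = Var k ^ f"
proof -
  have "(\<Sum>z\<in>mu N. Const (z ^ (f + 1) / of_nat N) * dlog_poly N k z)
      = (\<Sum>m<N. Const (\<Sum>z\<in>mu N. z ^ (f + 1) / of_nat N * z ^ (N - 1 - m)) * Var k ^ m)"
    unfolding dlog_poly_def sum_distrib_left Const_sum sum_distrib_right
    by (subst sum.swap) (simp only: Const_mult mult.assoc)
  also have "\<dots> = (\<Sum>m<N. if m = f then Var k ^ f else 0)"
  proof (rule sum.cong[OF refl])
    fix m assume m: "m \<in> {..<N}"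
    have "f + 1 + (N - 1 - m) = f + N - m"
      using m by auto
    then have "z ^ (f + 1) / of_nat N * z ^ (N - 1 - m) = z ^ (f + N - m) / of_nat N" for z :: complex
      by (metis power_add times_divide_eq_left)
    then have "(\<Sum>z\<in>mu N. z ^ (f + 1) / of_nat N * z ^ (N - 1 - m))
        = (\<Sum>z\<in>mu N. z ^ (f + N - m)) / of_nat N"
      by (simp only: sum_divide_distrib)
    also have "\<dots> = (if m = f then 1 else 0)"
      using assms m by (simp add: sum_mu dvd_add_diff_iff)
    finally show "Const (\<Sum>z\<in>mu N. z ^ (f + 1) / of_nat N * z ^ (N - 1 - m)) * Var k ^ m
        = (if m = f then Var k ^ f else 0)"
      by simp
  qed
  also have "\<dots> = Var k ^ f"
    using assms by simp
  finally show ?thesis .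
qed

lemma dterm_prod_in_span:
  assumes "finite K" "\<And>k. k \<in> K \<Longrightarrow> p k \<in> mpoly.span (h k ` A k)"
    and "\<And>x. (\<And>k. k \<in> K \<Longrightarrow> x k \<in> A k) \<Longrightarrow> dterm K (\<Prod>k\<in>K. h k (x k)) \<in> W" and "form.subspace W"
  shows "dterm K (\<Prod>k\<in>K. p k) \<in> W"
proof -
  have "(\<Prod>k\<in>K. p k) \<in> {p. dterm K p \<in> W}"
  proof (rule prod_in_subspace[OF assms(1) _ assms(2)])
    show "mpoly.subspace {p. dterm K p \<in> W}"
      using assms(4) by (rule dterm.subspace_linear_preimage)
    fix y assume "\<And>k. k \<in> K \<Longrightarrow> y k \<in> h k ` A k"
    then have "\<forall>k\<in>K. \<exists>x. x \<in> A k \<and> y k = h k x"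
      by blast
    then obtain x where x: "\<forall>k\<in>K. x k \<in> A k \<and> y k = h k (x k)"
      unfolding bchoice_iff by blast
    then have "(\<Prod>k\<in>K. y k) = (\<Prod>k\<in>K. h k (x k))"
      by (intro prod.cong) auto
    then show "(\<Prod>k\<in>K. y k) \<in> {p. dterm K p \<in> W}"
      using x assms(3)[of x] by simp
  qed
  then show ?thesis by simp
qed

definition gen_index :: "nat \<Rightarrow> (nat \<Rightarrow> nat) \<Rightarrow> nat \<Rightarrow> (nat set \<times> (nat \<Rightarrow> complex)) set" where
  "gen_index d n j = {(K, \<nu>). K \<subseteq> {..d} \<and> card K = j \<and> (\<forall>k\<in>K. \<nu> k \<in> mu (n k))}"

definition gen_span :: "nat \<Rightarrow> (nat \<Rightarrow> nat) \<Rightarrow> complex \<Rightarrow> nat \<Rightarrow> dform set" where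
  "gen_span d n \<alpha> j = form.span ((\<lambda>(K, \<nu>). gen_form d n \<alpha> K \<nu>) ` gen_index d n j)"

lemma gen_form_in_subspace:
  assumes K: "K \<subseteq> {..d}" and W: "form.subspace W"
    and "\<And>f. (\<And>k. k \<in> K \<Longrightarrow> f k < n k) \<Longrightarrow> log_monomial d n \<alpha> K f \<in> W"
  shows "gen_form d n \<alpha> K \<nu> \<in> W"
proof -
  have finK: "finite K"
    using K finite_subset by blast
  show ?thesis
    unfolding gen_form_eq[OF finK]
  proof (rule dterm_prod_in_span[OF finK _ _ W])
    show "dlog_poly (n k) k (\<nu> k) * uinv d n \<alpha> k
        \<in> mpoly.span ((\<lambda>m. Var k ^ m * uinv d n \<alpha> k) ` {..<n k})" for k
      unfolding dlog_poly_def sum_distrib_right mult.assoc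
      by (intro mpoly.span_sum mpoly.span_scale mpoly.span_base) auto
    show "dterm K (\<Prod>k\<in>K. Var k ^ x k * uinv d n \<alpha> k) \<in> W" if "\<And>k. k \<in> K \<Longrightarrow> x k \<in> {..<n k}" for x
      using assms(3)[of x] that by (simp add: log_monomial_def)
  qed
qed

lemma log_monomial_in_gen_span:
  assumes K: "K \<subseteq> {..d}" "card K = j" and f: "\<And>k. k \<in> K \<Longrightarrow> f k < n k"
  shows "log_monomial d n \<alpha> K f \<in> gen_span d n \<alpha> j"
proof -
  have finK: "finite K"
    using K(1) finite_subset by blast
  show ?thesis
    unfolding log_monomial_def
  proof (rule dterm_prod_in_span[OF finK])
    fix k assume "k \<in> K"
    from Var_power_fourier[OF f[OF this], of k]
    have "Var k ^ f k * uinv d n \<alpha> k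
        = (\<Sum>z\<in>mu (n k). Const (z ^ (f k + 1) / of_nat (n k)) * (dlog_poly (n k) k z * uinv d n \<alpha> k))"
      by (simp only: flip: sum_distrib_right mult.assoc)
    also have "\<dots> \<in> mpoly.span ((\<lambda>z. dlog_poly (n k) k z * uinv d n \<alpha> k) ` mu (n k))"
      by (intro mpoly.span_sum mpoly.span_scale mpoly.span_base) auto
    finally show "Var k ^ f k * uinv d n \<alpha> k
        \<in> mpoly.span ((\<lambda>z. dlog_poly (n k) k z * uinv d n \<alpha> k) ` mu (n k))" .
  next
    fix \<nu> assume "\<And>k. k \<in> K \<Longrightarrow> \<nu> k \<in> mu (n k)"
    then have "(K, \<nu>) \<in> gen_index d n j"
      using K by (simp add: gen_index_def)
    then have "(\<lambda>(K, \<nu>). gen_form d n \<alpha> K \<nu>) (K, \<nu>) \<in> gen_span d n \<alpha> j"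
      unfolding gen_span_def by (intro form.span_base imageI)
    then show "dterm K (\<Prod>k\<in>K. dlog_poly (n k) k (\<nu> k) * uinv d n \<alpha> k) \<in> gen_span d n \<alpha> j"
      by (simp add: gen_form_eq[OF finK])
  qed (simp add: gen_span_def)
qed

lemma (in eigenspace) harmonic_eq_log_monomial:
  "S \<in> harmonic_sets \<Longrightarrow> harmonic S = log_monomial d n \<alpha> S (\<lambda>k. base_exp (n k) (i k) True)"
  by (simp add: harmonic_eq log_monomial_def)

lemma (in eigenspace) harmonic_in_gen_span:
  assumes "S \<in> harmonic_sets"
  shows "harmonic S \<in> gen_span d n \<alpha> (card S)"
  unfolding harmonic_eq_log_monomial[OF assms]
proof (rule log_monomial_in_gen_span)
  show "S \<subseteq> {..d}"
    using assms by (auto simp: harmonic_sets_def)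
  then show "base_exp (n k) (i k) True < n k" if "k \<in> S" for k
    using that i n_pos_le[of k] by (auto simp: base_exp_def Qset_def)
qed simp

lemma (in eigenspace) eig_closed_spanned:
  assumes "\<eta> \<in> eig_closed d n \<alpha> i j"
  shows "\<exists>y\<in>gen_span d n \<alpha> j. \<eta> - y \<in> HU_exact d n \<alpha> j"
proof -
  obtain y where y: "y \<in> form.span (harmonic ` {S \<in> harmonic_sets. card S = j})"
    "\<eta> - y \<in> HU_exact d n \<alpha> j"
    using assms eig_closed_basis unfolding form.basis_modulo_def by blast
  have "form.span (harmonic ` {S \<in> harmonic_sets. card S = j}) \<subseteq> gen_span d n \<alpha> j"
    using harmonic_in_gen_span by (intro form.span_minimal) (auto simp: gen_span_def)
  with y show ?thesis by blast
qed

lemma log_monomial_eigenspace: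
  assumes "1 \<le> d" "\<forall>k\<le>d. 1 \<le> n k" "\<alpha> \<noteq> 0" and K: "K \<subseteq> {..d}" "card K \<le> d" and f: "\<And>k. k \<in> K \<Longrightarrow> f k < n k"
  obtains i where "i \<in> Qset d n" "log_monomial d n \<alpha> K f \<in> eig_closed d n \<alpha> i (card K)"
proof -
  have "K \<noteq> {..d}"
    using K(2) by auto
  then obtain k0 where outside: "k0 \<le> d" "k0 \<notin> K"
    using K(1) by auto
  define i where "i k = (if k \<in> K then (f k + 1) mod n k else 0)" for k
  have "i \<in> Qset d n"
    using assms(2) K(1) outside by (force simp: Qset_def i_def Suc_le_eq)
  have "i k0 = 0"
    using outside(2) by (simp add: i_def)
  interpret eigenspace d n \<alpha> i k0
    using assms(1-3) outside(1) \<open>i \<in> Qset d n\<close> \<open>i k0 = 0\<close> by unfold_locales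
  have "K \<in> harmonic_sets"
    using K(1) outside by (auto simp: harmonic_sets_iff Iset_def i_def split: if_splits)
  have "base_exp (n k) (i k) True = f k" if "k \<in> K" for k
    using that f[OF that] by (cases "f k + 1 = n k") (auto simp: base_exp_def i_def)
  then have "log_monomial d n \<alpha> K f = harmonic K"
    using \<open>K \<in> harmonic_sets\<close> by (simp add: harmonic_eq_log_monomial log_monomial_def)
  with \<open>K \<in> harmonic_sets\<close> show thesis
    using eig_closed_basis[of "card K"] \<open>i \<in> Qset d n\<close>
    by (intro that[of i]) (auto simp: form.basis_modulo_def)
qed

lemma QpartI:
  assumes "is_form (Uvars d) j \<eta>" "\<forall>i\<in>Qset d n. \<eta>s i \<in> eig_closed d n \<alpha> i j"
    and "\<eta> - (\<Sum>i\<in>Qset d n. \<eta>s i) \<in> HU_exact d n \<alpha> j"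
  shows "\<eta> \<in> Qpart d n \<alpha> j"
  using assms by (auto simp: Qpart_def)

lemma subspace_Qpart: "form.subspace (Qpart d n \<alpha> j)"
proof (rule form.subspaceI)
  let ?V = "\<lambda>i. eig_closed d n \<alpha> i j"
  have form: "form.subspace {\<eta>. is_form (Uvars d) j \<eta>}"
    by (simp add: Uvars_def subspace_is_form)
  show "0 \<in> Qpart d n \<alpha> j"
    using form.subspace_0[OF form] form.subspace_0[OF subspace_eig_closed]
      form.subspace_0[OF subspace_HU_exact]
    by (auto simp: Qpart_def intro!: exI[of _ "\<lambda>_. 0"])
  fix \<eta> assume "\<eta> \<in> Qpart d n \<alpha> j"
  then obtain \<eta>s where \<eta>: "is_form (Uvars d) j \<eta>" "\<forall>i\<in>Qset d n. \<eta>s i \<in> ?V i"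
    "\<eta> - (\<Sum>i\<in>Qset d n. \<eta>s i) \<in> HU_exact d n \<alpha> j"
    by (auto simp: Qpart_def)
  show "\<eta> + \<theta> \<in> Qpart d n \<alpha> j" if "\<theta> \<in> Qpart d n \<alpha> j" for \<theta>
  proof -
    obtain \<theta>s where \<theta>: "is_form (Uvars d) j \<theta>" "\<forall>i\<in>Qset d n. \<theta>s i \<in> ?V i"
      "\<theta> - (\<Sum>i\<in>Qset d n. \<theta>s i) \<in> HU_exact d n \<alpha> j"
      using \<open>\<theta> \<in> Qpart d n \<alpha> j\<close> by (auto simp: Qpart_def)
    have exact: "\<eta> + \<theta> - (\<Sum>i\<in>Qset d n. \<eta>s i + \<theta>s i) \<in> HU_exact d n \<alpha> j"
      using form.subspace_add[OF subspace_HU_exact \<eta>(3) \<theta>(3)] by (simp add: sum.distrib algebra_simps)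
    show ?thesis
      using form.subspace_add[OF form] form.subspace_add[OF subspace_eig_closed] \<eta>(1,2) \<theta>(1,2)
      by (intro QpartI[OF _ _ exact]) blast+
  qed
  show "cmul c \<eta> \<in> Qpart d n \<alpha> j" for c
  proof -
    have exact: "cmul c \<eta> - (\<Sum>i\<in>Qset d n. cmul c (\<eta>s i)) \<in> HU_exact d n \<alpha> j"
      using form.subspace_scale[OF subspace_HU_exact \<eta>(3), of c]
      by (simp add: cmul_simps form.scale_sum_right)
    show ?thesis
      using form.subspace_scale[OF form] form.subspace_scale[OF subspace_eig_closed] \<eta>(1,2)
      by (intro QpartI[OF _ _ exact]) blast+
  qed
qed

lemma finite_Qset: "finite (Qset d n)"
  using Qset_subset_weight_box finite_weight_box by (rule finite_subset)

lemma eig_closed_subset_Qpart: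
  assumes "i \<in> Qset d n"
  shows "eig_closed d n \<alpha> i j \<subseteq> Qpart d n \<alpha> j"
proof
  fix \<eta> assume \<eta>: "\<eta> \<in> eig_closed d n \<alpha> i j"
  let ?\<eta>s = "\<lambda>k. if k = i then \<eta> else 0"
  have exact: "\<eta> - (\<Sum>k\<in>Qset d n. ?\<eta>s k) \<in> HU_exact d n \<alpha> j"
    using assms finite_Qset form.subspace_0[OF subspace_HU_exact] by simp
  show "\<eta> \<in> Qpart d n \<alpha> j"
  proof (rule QpartI[OF _ _ exact])
    show "is_form (Uvars d) j \<eta>"
      using \<eta> by (simp add: eig_closed_def HU_closed_iff Uvars_def)
    show "\<forall>k\<in>Qset d n. ?\<eta>s k \<in> eig_closed d n \<alpha> k j"
      using \<eta> form.subspace_0[OF subspace_eig_closed] by simp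
  qed
qed

lemma gen_form_in_Qpart:
  assumes "1 \<le> d" "\<forall>k\<le>d. 1 \<le> n k" "\<alpha> \<noteq> 0" "K \<subseteq> {..d}" "card K \<le> d"
  shows "gen_form d n \<alpha> K \<nu> \<in> Qpart d n \<alpha> (card K)"
proof (rule gen_form_in_subspace[OF assms(4) subspace_Qpart])
  fix f assume "\<And>k. k \<in> K \<Longrightarrow> f k < n k"
  then obtain i where "i \<in> Qset d n" "log_monomial d n \<alpha> K f \<in> eig_closed d n \<alpha> i (card K)"
    using log_monomial_eigenspace[OF assms] by blast
  then show "log_monomial d n \<alpha> K f \<in> Qpart d n \<alpha> (card K)"
    using eig_closed_subset_Qpart by blast
qed

lemma Qpart_spanned:
  assumes "1 \<le> d" "\<forall>k\<le>d. 1 \<le> n k" "\<alpha> \<noteq> 0" "\<eta> \<in> Qpart d n \<alpha> j"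
  obtains F c where "finite F" "F \<subseteq> gen_index d n j"
    "\<eta> - (\<Sum>(K, \<nu>)\<in>F. cmul (c (K, \<nu>)) (gen_form d n \<alpha> K \<nu>)) \<in> HU_exact d n \<alpha> j"
proof -
  obtain \<eta>s where \<eta>s: "\<forall>i\<in>Qset d n. \<eta>s i \<in> eig_closed d n \<alpha> i j"
    "\<eta> - (\<Sum>i\<in>Qset d n. \<eta>s i) \<in> HU_exact d n \<alpha> j"
    using assms(4) by (auto simp: Qpart_def)
  have "\<forall>i\<in>Qset d n. \<exists>y. y \<in> gen_span d n \<alpha> j \<and> \<eta>s i - y \<in> HU_exact d n \<alpha> j"
  proof
    fix i assume i: "i \<in> Qset d n"
    then obtain k0 where "k0 \<le> d" "i k0 = 0"
      by (auto simp: Qset_def)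
    then interpret eigenspace d n \<alpha> i k0
      using assms(1-3) i by unfold_locales
    show "\<exists>y. y \<in> gen_span d n \<alpha> j \<and> \<eta>s i - y \<in> HU_exact d n \<alpha> j"
      using eig_closed_spanned \<eta>s(1) i by blast
  qed
  then obtain y where y: "\<forall>i\<in>Qset d n. y i \<in> gen_span d n \<alpha> j \<and> \<eta>s i - y i \<in> HU_exact d n \<alpha> j"
    unfolding bchoice_iff by blast
  then have "(\<Sum>i\<in>Qset d n. \<eta>s i - y i) \<in> HU_exact d n \<alpha> j"
    by (intro form.subspace_sum subspace_HU_exact) blast
  from form.subspace_add[OF subspace_HU_exact \<eta>s(2) this]
  have "\<eta> - (\<Sum>i\<in>Qset d n. y i) \<in> HU_exact d n \<alpha> j"
    by (simp add: sum_subtractf)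
  moreover have "(\<Sum>i\<in>Qset d n. y i) \<in> gen_span d n \<alpha> j"
    unfolding gen_span_def using y by (intro form.span_sum) (simp flip: gen_span_def)
  then obtain F c where "finite F" "F \<subseteq> gen_index d n j"
    "(\<Sum>i\<in>Qset d n. y i) = (\<Sum>x\<in>F. cmul (c x) ((\<lambda>(K, \<nu>). gen_form d n \<alpha> K \<nu>) x))"
    unfolding gen_span_def by (rule form.in_span_imageE)
  ultimately show thesis
    by (intro that[of F c]) (simp_all add: case_prod_unfold)
qed

theorem theorem3p9:
  fixes d j :: nat and n :: "nat \<Rightarrow> nat" and \<alpha> :: complex
  assumes "1 \<le> d" and "\<forall>k\<le>d. 1 \<le> n k" and "\<alpha> \<noteq> 0" and "\<alpha> \<noteq> 1" and "j \<le> d"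
  shows "(\<forall>K \<nu>. K \<subseteq> {..d} \<and> card K = j \<and> (\<forall>k\<in>K. \<nu> k \<in> mu (n k)) \<longrightarrow>
            gen_form d n \<alpha> K \<nu> \<in> Qpart d n \<alpha> j)
       \<and> (\<forall>\<eta>\<in>Qpart d n \<alpha> j. \<exists>F c. finite F \<and>
            (\<forall>(K, \<nu>)\<in>F. K \<subseteq> {..d} \<and> card K = j \<and> (\<forall>k\<in>K. \<nu> k \<in> mu (n k))) \<and>
            \<eta> - (\<Sum>(K, \<nu>)\<in>F. cmul (c (K, \<nu>)) (gen_form d n \<alpha> K \<nu>)) \<in> HU_exact d n \<alpha> j)
       \<and> (\<forall>i\<in>Qset d n. \<forall>k0\<le>d. i k0 = 0 \<longrightarrow>
            (let s = card (Iset d i); L = Lset d i k0 in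
              (if s \<le> j then
                 (\<forall>x\<in>closed_forms (Tvars L) (Tgens L) (j - s).
                     omega_pull d n \<alpha> i k0 x \<in> eig_closed d n \<alpha> i j)
               \<and> (\<forall>x\<in>exact_forms (Tvars L) (Tgens L) (j - s).
                     omega_pull d n \<alpha> i k0 x \<in> HU_exact d n \<alpha> j)
               \<and> (\<forall>x\<in>closed_forms (Tvars L) (Tgens L) (j - s).
                     omega_pull d n \<alpha> i k0 x \<in> HU_exact d n \<alpha> j \<longrightarrow>
                     x \<in> exact_forms (Tvars L) (Tgens L) (j - s))
               \<and> (\<forall>\<eta>\<in>eig_closed d n \<alpha> i j. \<exists>x\<in>closed_forms (Tvars L) (Tgens L) (j - s).
                     \<eta> - omega_pull d n \<alpha> i k0 x \<in> HU_exact d n \<alpha> j)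
               else eig_closed d n \<alpha> i j \<subseteq> HU_exact d n \<alpha> j)
              \<and> quot_dim (eig_closed d n \<alpha> i j) (HU_exact d n \<alpha> j) ((d - s) choose (d - j))))"
proof (intro conjI allI impI ballI, goal_cases)
  case (1 K \<nu>)
  then show ?case
    using gen_form_in_Qpart[OF assms(1-3), of K \<nu>] assms(5) by auto
next
  case (2 \<eta>)
  then obtain F c where "finite F" "F \<subseteq> gen_index d n j"
    "\<eta> - (\<Sum>(K, \<nu>)\<in>F. cmul (c (K, \<nu>)) (gen_form d n \<alpha> K \<nu>)) \<in> HU_exact d n \<alpha> j"
    using Qpart_spanned[OF assms(1-3)] by blast
  then show ?case
    by (intro exI[of _ F] exI[of _ c]) (auto simp: gen_index_def)
next
  case (3 i k0)
  then interpret eigenspace d n \<alpha> i k0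
    using assms(1-3) by unfold_locales
  show ?case
  proof (cases "card I \<le> j")
    case True
    then obtain q where "j = card I + q"
      using le_Suc_ex by blast
    then show ?thesis
      using comparison_closed_in_eig_closed[of _ q] comparison_exact_in_HU_exact[of _ q]
        comparison_injective[of _ q] comparison_surjective[of _ q] quot_dim_eig_closed[OF assms(5)]
      by (simp add: Let_def)
  qed (use quot_dim_eig_closed[OF assms(5)] eig_closed_exact_below[of j] in \<open>simp add: Let_def\<close>)
qed

end
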